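(* For every integer $n\ge 1$ and every composition $\underline{k}$ of $n$, the map $\Sigma_{\underline{k}}:D^\omega(\underline{k})\to \mathrm{Slide}^\omega(\underline{k})$ is a bijection, where $D^\omega(\underline{k})=\bigsqcup_{j=i+1}^{n}\mathrm{Slide}^\omega(\underline{k}^{(j)})$ with $i=\mathrm{maxzero}(\underline{k})$, and $\Sigma_{\underline{k}}(T)=\hat\sigma_{i,j}(T)$ if $T$ lies in the summand $\mathrm{Slide}^\omega(\underline{k}^{(j)})$ with $k_j>1$, and $\Sigma_{\underline{k}}(T)=\hat\sigma_j(T)$ if $T$ lies in the summand $\mathrm{Slide}^\omega(\underline{k}^{(j)})$ with $k_j=1$.
   Context: **Trees.** Labels $\{a,b,c,1,\dots,n\}$ are ordered $a<b<c<1<\dots<n$. A composition of $n$ is an $n$-tuple $\underline{k}=(k_1,\dots,k_n)$ of nonnegative integers with sum $n$ (for $n=0$ there is the empty composition). It is reverse-Catalan if $k_{n-i+1}+\dots+k_n\ge i$ for all $1\le i\le n$. A stable tree is a finite tree whose non-leaf vertices all have degree at least 3 and whose leaves are bijectively labeled by $\{a,b,c,1,\dots,n\}$, up to label-preserving isomorphism. An internal edge joins two non-leaf vertices. For a leaf $\ell$, $v_\ell$ is its neighbor; two leaves are adjacent if they have the same neighbor. **Slide labeling.** The $\omega$ $\underline{k}$-slide labeling of a stable tree $T$ is the result of the following procedure, if it never fails. For $\ell=n,n-1,\dots,1$ in this order, do the following $k_\ell$ times: let $T'$ be $T$ with all already labeled internal edges contracted; let $e$ be the first internal edge of $T'$ on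 the path from leaf $\ell$ to leaf $a$ (fail if none exists); let $v_\ell$ be the vertex of $T'$ adjacent to $\ell$ and $v$ the other endpoint of $e$; let $m_\ell$ be the smallest leaf label among branches at $v_\ell$ in $T'$ not containing $a$ or $\ell$, and $m_a$ the smallest leaf label among branches at $v$ not containing $a$ or $\ell$; if $\ell\ge m_\ell\ge m_a$, label $e$ with $\ell$, otherwise fail. $\mathrm{Slide}^\omega(\underline{k})$ is the set of stable trees admitting an $\omega$ $\underline{k}$-slide labeling (by a known theorem this agrees with the definition by iterated slides). Such trees are trivalent with $n$ internal edges, all of which receive a label, and $a,b$ are adjacent. Edge labels always refer to this labeling. For $n=0$, $\mathrm{Slide}^\omega(\underline{k})=\{T_0\}$, with $T_0$ the star with leaves $a,b,c$. **Branches.** The leaves $a,b$, their common neighbor, and the edges joining them form the root. The branch starting at an edge $e$ (internal or a leaf edge, but not at $a$ or $b$) consists of all edges and vertices, including $e$, on the side of $e$ opposite to the root. $\min(B)$ is the smallest leaf label in a branch $B$. **maxzero and last.** $\mathrm{maxzero}(\underline{k})$ is the largest $z$ with $k_z=0$; if no entry is zero, it is taken to be $0$ when used as an index and $c$ when used as a leaf label. If $B$ has smallest leaf $p$ and second smallest leaf $q$, $\mathrm{min}_2(B)$ is the largest branch contained in $B$ that contains $q$ but not $p$. For $T\in\mathrm{Slide}^\omega(\underline{k})$, let $B$ be the largest branch of $T$ whose smallest leaf is $\mathrm{maxzero}(\underline{k})$; while $B$ has at least two leaves replace $B$ by $\mathrm{min}_2(B)$; $\mathrm{last}(T)$ is the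 single leaf of the final $B$. (So $\mathrm{last}(T_0)=c$.) **$\underline{k}^{(j)}$.** For a composition $\underline{k}$ of $n$ and $j>i=\mathrm{maxzero}(\underline{k})$, $\underline{k}^{(j)}$ is the composition of $n-1$ obtained by decreasing $k_j$ by 1 and then removing the rightmost $0$ (in position $j$ if $k_j=1$, otherwise in position $i$). **Branches along a path.** For a leaf $u$ of a slide tree, split the sequence of internal edge labels on the path from $a$ to $u$ into maximal strictly decreasing consecutive runs; let $l$ be the number of runs. For $r<l$ let $B_r$ be the branch leaving the path at the vertex between the $r$th and $(r+1)$st runs; let $B_l$ be the branch at $v_u$ other than $u$ and off the path. Put $m_r=\min(B_r)$. **The map $\hat\sigma_{i,j}$.** Let $\underline{h}$ be a reverse-Catalan composition of $N$, $\mathrm{maxzero}(\underline{h})<i<j\le N+1$, and $\underline{h}'$ the composition of $N+1$ obtained from $\underline{h}$ by inserting a $0$ between $h_{i-1}$ and $h_i$ and then increasing the $j$th entry of the result by 1. The map $\hat\sigma_{i,j}:\mathrm{Slide}^\omega(\underline{h})\to\mathrm{Slide}^\omega(\underline{h}')$: given $T$, add 1 to all leaf and edge labels $\ge i$. Form $B_1,\dots,B_l$ and $m_1,\dots,m_l$ for the path from $a$ to leaf $j$. Then: - if $m_l<i<j$ or $m_{l-1}<i<j<m_l$: replace leaf $j$ by an internal edge with leaves $j$ and $i$ at its end; - if $m_1<\dots<m_{d-1}<i<m_d<\dots<m_l<j$: relabel leaf $m_d$ by $i$, leaf $m_{d+1}$ by $m_d$, ..., leaf $m_l$ by $m_{l-1}$,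 and replace leaf $j$ by an internal edge with leaves $j$ and $m_l$ at its end; - if $m_1<\dots<m_{d-1}<i<m_d<\dots<m_{l-1}<j<m_l$: relabel leaf $m_d$ by $i$, $m_{d+1}$ by $m_d$, ..., $m_{l-1}$ by $m_{l-2}$, and replace leaf $j$ by an internal edge with leaves $j$ and $m_{l-1}$ at its end. These cases are exhaustive. **The map $\hat\sigma_j$.** Let $\underline{h}$ be a reverse-Catalan composition of $N$, $\mathrm{maxzero}(\underline{h})<j\le N+1$, and $\underline{h}'$ obtained by inserting a $1$ between $h_{j-1}$ and $h_j$. The map $\hat\sigma_j:\mathrm{Slide}^\omega(\underline{h})\to\mathrm{Slide}^\omega(\underline{h}')$: given $T$, add 1 to all leaf and edge labels $\ge j$. Let $v$ be the (relabeled) leaf $\mathrm{last}(T)$, and (for $N\geq 1$) let $i<v$ be the leaf adjacent to it. - If $v<j$: replace leaf $v$ by an internal edge with leaves $j$ and $v$ at its end. - If $i<j<v$: replace leaf $i$ by an internal edge with leaves $j$ and $i$ at its end. - If $j<i$: form $m_1<\dots<m_l$ for the path from $a$ to $v$, let $d$ be such that $m_d<j<m_{d+1}$, and replace leaf $m_d$ by an internal edge with leaves $j$ and $m_d$ at its end. If $\underline{k}$ or $\underline{k}^{(j)}$ is not reverse-Catalan, the corresponding slide set is empty. *)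

theory Defs
  imports Main "HOL-Library.FSet" "HOL-Library.While_Combinator"
begin

section \<open>Labels and compositions\<close>

text \<open>
  The ordered label set \<open>a < b < c < 1 < 2 < \<dots>\<close> is realised inside the integers by
  \<open>a = -2\<close>, \<open>b = -1\<close>, \<open>c = 0\<close>. In particular the number \<open>0\<close> stands for the leaf \<open>c\<close>, which
  matches the convention that \<open>maxzero\<close> is \<open>0\<close> as an index and \<open>c\<close> as a leaf label if no
  entry vanishes.
\<close>

type_synonym label = int

abbreviation (input) lab_b :: label where "lab_b \<equiv> -1"
abbreviation (input) lab_c :: label where "lab_c \<equiv> 0"

text \<open>The entry \<open>k\<^sub>j\<close> (\<open>1 \<le> j \<le> n\<close>) of a composition is \<open>k ! (j - 1)\<close>.\<close>

definition composition :: "nat \<Rightarrow> nat list \<Rightarrow> bool" where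
  "composition n k \<longleftrightarrow> length k = n \<and> sum_list k = n"

definition maxzero :: "nat list \<Rightarrow> nat" where
  "maxzero k = Max (insert 0 {z \<in> {1..length k}. k ! (z - 1) = 0})"

text \<open>\<open>lower k j\<close> is \<open>k\<^sup>(\<^sup>j\<^sup>)\<close>: decrease entry \<open>j\<close> by one and delete the rightmost zero.\<close>

definition lower :: "nat list \<Rightarrow> nat \<Rightarrow> nat list" where
  "lower k j =
     (let h = k[j - 1 := k ! (j - 1) - 1]; z = maxzero h
      in take (z - 1) h @ drop z h)"


section \<open>Stable trees\<close>

text \<open>
  A stable tree is planted at its leaf \<open>a\<close>, which is kept implicit: the term represents
  everything on the far side of the leaf edge at \<open>a\<close>, so the top \<open>Node\<close> is the neighbour
  of \<open>a\<close>. A \<open>Node\<close> is a non-leaf vertex and its children are the branches at that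
  vertex not containing \<open>a\<close>. As the children form an unordered finite set and leaf labels do
  not repeat, two leaf-labelled trees are isomorphic by a label-preserving isomorphism iff
  they are represented by the same term.

  Every non-leaf vertex \<open>v\<close> is referred to by the subterm it tops. Every edge other than
  the one at \<open>a\<close> joins a subterm to its parent, and the internal edges are those above the
  \<open>Node\<close> subterms different from the whole tree. An edge is named by the set of leaves on
  its side opposite to \<open>a\<close>; in a stable tree different edges have different names, and
  contracting some edges does not change the names of the others.
\<close>

datatype (leaves: 'a) tree = Leaf 'a | Node "'a tree fset"
  for map: relabel

type_synonym ltree = "label tree"
type_synonym edge = "label set"

primrec children :: "'a tree \<Rightarrow> 'a tree set" where
  "children (Leaf x) = {}"
| "children (Node ts) = fset ts"

primrec subtrees :: "'a tree \<Rightarrow> 'a tree set" where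
  "subtrees (Leaf x) = {Leaf x}"
| "subtrees (Node ts) = insert (Node ts) (\<Union> (fset (subtrees |`| ts)))"

text \<open>
  The degree of a non-leaf vertex is one more than its number of children. Disjointness of
  the children expresses that no label occurs on two leaves.
\<close>

definition stable_tree :: "nat \<Rightarrow> ltree \<Rightarrow> bool" where
  "stable_tree n T \<longleftrightarrow>
     leaves T = {lab_b, lab_c} \<union> {1..int n} \<and>
     (\<forall>ts. Node ts \<in> subtrees T \<longrightarrow>
        3 \<le> fcard ts + 1 \<and>
        (\<forall>s \<in> fset ts. \<forall>t \<in> fset ts. s \<noteq> t \<longrightarrow> leaves s \<inter> leaves t = {}))"

text \<open>\<open>is_path x T p\<close>: the non-leaf vertices on the path from \<open>a\<close> to the leaf \<open>x\<close> are, in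
  this order, \<open>p\<close>; so \<open>hd p = T\<close>, and \<open>last p\<close> is the neighbour of \<open>x\<close>.\<close>

inductive is_path :: "'a \<Rightarrow> 'a tree \<Rightarrow> 'a tree list \<Rightarrow> bool" where
  "Leaf x |\<in>| ts \<Longrightarrow> is_path x (Node ts) [Node ts]"
| "t |\<in>| ts \<Longrightarrow> is_path x t p \<Longrightarrow> is_path x (Node ts) (Node ts # p)"

definition path :: "'a tree \<Rightarrow> 'a \<Rightarrow> 'a tree list" where
  "path T x = (THE p. is_path x T p)"


section \<open>Slide labelings\<close>

text \<open>\<open>splice C t\<close> is what remains of the branch \<open>t\<close>, as a set of children of the vertex
  above it, after contracting the edges in \<open>C\<close>.\<close>

primrec splice :: "edge set \<Rightarrow> ltree \<Rightarrow> ltree fset" where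
  "splice C (Leaf x) = {|Leaf x|}"
| "splice C (Node ts) =
     (let us = ffUnion (splice C |`| ts)
      in if leaves (Node ts) \<in> C then us else {|Node us|})"

fun contract :: "edge set \<Rightarrow> ltree \<Rightarrow> ltree" where
  "contract C (Leaf x) = Leaf x"
| "contract C (Node ts) = Node (ffUnion (splice C |`| ts))"

text \<open>Smallest leaf label among the branches at \<open>v\<close> containing neither \<open>a\<close> nor \<open>x\<close>.\<close>

definition min_off :: "ltree \<Rightarrow> label \<Rightarrow> label" where
  "min_off v x = Min (\<Union> {leaves t |t. t \<in> children v \<and> x \<notin> leaves t})"

type_synonym edge_labeling = "edge \<Rightarrow> label option"

text \<open>In the contracted tree the first internal edge from \<open>l\<close> towards \<open>a\<close>, if there is one,
  joins the last vertex \<open>v\<^sub>l\<close> of the path from \<open>a\<close> to \<open>l\<close> to the last but one, \<open>v\<close>.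
  The result \<open>None\<close> signals failure.\<close>

definition slide_step :: "ltree \<Rightarrow> label \<Rightarrow> edge_labeling \<Rightarrow> edge_labeling option" where
  "slide_step T l L =
     (let p = path (contract (dom L) T) l
      in if length p < 2 then None
         else let v\<^sub>l = p ! (length p - 1); v = p ! (length p - 2);
                  m\<^sub>l = min_off v\<^sub>l l; m\<^sub>a = min_off v l
              in if l \<ge> m\<^sub>l \<and> m\<^sub>l \<ge> m\<^sub>a then Some (L(leaves v\<^sub>l \<mapsto> l)) else None)"

text \<open>The sequence of labels used: \<open>n\<close> (\<open>k\<^sub>n\<close> times), \<open>n - 1\<close> (\<open>k\<^bsub>n-1\<^esub>\<close> times), and so on.\<close>

definition slide_word :: "nat list \<Rightarrow> label list" where
  "slide_word k =
     concat (map (\<lambda>l. replicate (k ! (l - 1)) (int l)) (rev [1..<Suc (length k)]))"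

definition slide_labeling :: "nat list \<Rightarrow> ltree \<Rightarrow> edge_labeling option" where
  "slide_labeling k T =
     foldl (\<lambda>L l. Option.bind L (slide_step T l)) (Some Map.empty) (slide_word k)"

definition Slide :: "nat list \<Rightarrow> ltree set" where
  "Slide k = {T. stable_tree (length k) T \<and> slide_labeling k T \<noteq> None}"


section \<open>Branches and the last leaf\<close>

text \<open>
  In a slide tree \<open>a\<close> and \<open>b\<close> are adjacent, and every edge outside the root starts a branch,
  represented by the subterm below that edge.
\<close>

definition branches :: "ltree \<Rightarrow> ltree set" where
  "branches T = subtrees T - {T, Leaf lab_b}"

definition largest :: "'a tree set \<Rightarrow> 'a tree" where
  "largest S = (THE B. B \<in> S \<and> (\<forall>B' \<in> S. B' \<in> subtrees B))"

definition min2 :: "ltree \<Rightarrow> ltree" where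
  "min2 B =
     (let p = Min (leaves B); q = Min (leaves B - {p})
      in largest {B' \<in> subtrees B. q \<in> leaves B' \<and> p \<notin> leaves B'})"

definition last_leaf :: "nat list \<Rightarrow> ltree \<Rightarrow> label" where
  "last_leaf k T =
     the_elem (leaves
       (while (\<lambda>B. 2 \<le> card (leaves B)) min2
          (largest {B \<in> branches T. Min (leaves B) = int (maxzero k)})))"


section \<open>Branches along a path\<close>

text \<open>Maximal strictly decreasing consecutive runs.\<close>

fun dec_runs :: "label list \<Rightarrow> label list list" where
  "dec_runs [] = []"
| "dec_runs [x] = [[x]]"
| "dec_runs (x # y # zs) =
     (let rs = dec_runs (y # zs)
      in if x > y then (x # hd rs) # tl rs else [x] # rs)"

definition off_branch :: "'a tree \<Rightarrow> 'a \<Rightarrow> 'a tree" where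
  "off_branch v u = (THE t. t \<in> children v \<and> u \<notin> leaves t)"

definition path_runs :: "edge_labeling \<Rightarrow> ltree \<Rightarrow> label \<Rightarrow> label list list" where
  "path_runs L T u = dec_runs (map (\<lambda>v. the (L (leaves v))) (tl (path T u)))"

text \<open>
  The list \<open>[m\<^sub>1, \<dots>, m\<^sub>l]\<close>. With the vertices of the path numbered from \<open>0\<close>, the vertex at
  which the \<open>r\<close>-th run ends has as its number the total length of the first \<open>r\<close> runs; for
  \<open>r = l\<close> this is the neighbour of \<open>u\<close>.
\<close>

definition path_mins :: "edge_labeling \<Rightarrow> ltree \<Rightarrow> label \<Rightarrow> label list" where
  "path_mins L T u =
     (let p = path T u; rs = path_runs L T u
      in map (\<lambda>r. Min (leaves (off_branch (p ! sum_list (map length (take r rs))) u)))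
           [1..<Suc (length rs)])"


section \<open>The insertion maps\<close>

definition bump :: "label \<Rightarrow> label \<Rightarrow> label" where
  "bump i x = (if i \<le> x then x + 1 else x)"

text \<open>The edge named \<open>E\<close> after bumping the leaf labels was named \<open>bump i -` E\<close> before.\<close>

definition bump_labeling :: "label \<Rightarrow> edge_labeling \<Rightarrow> edge_labeling" where
  "bump_labeling i L = (\<lambda>E. map_option (bump i) (L (bump i -` E)))"

text \<open>\<open>graft x y T\<close> replaces leaf \<open>x\<close> by an internal edge with leaves \<open>x\<close> and \<open>y\<close> at its
  end.\<close>

primrec graft :: "'a \<Rightarrow> 'a \<Rightarrow> 'a tree \<Rightarrow> 'a tree" where
  "graft x y (Leaf z) = (if z = x then Node {|Leaf x, Leaf y|} else Leaf z)"
| "graft x y (Node ts) = Node (graft x y |`| ts)"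

text \<open>For \<open>ms = [m\<^sub>d, \<dots>, m\<^sub>e]\<close>: relabel leaf \<open>m\<^sub>d\<close> by \<open>i\<close>, \<open>m\<^bsub>d+1\<^esub>\<close> by \<open>m\<^sub>d\<close>, \<dots>, \<open>m\<^sub>e\<close> by
  \<open>m\<^bsub>e-1\<^esub>\<close> (simultaneously).\<close>

definition shift_chain :: "label \<Rightarrow> label list \<Rightarrow> label \<Rightarrow> label" where
  "shift_chain i ms x =
     (case map_of (zip ms (i # butlast ms)) x of None \<Rightarrow> x | Some y \<Rightarrow> y)"

text \<open>
  The map \<open>\<sigma>\<^bsub>i,j\<^esub>\<close> on \<open>Slide h\<close>. The index \<open>d\<close> below is one less than the \<open>d\<close> of the
  inequalities \<open>m\<^sub>1 < \<dots> < m\<^bsub>d-1\<^esub> < i < m\<^sub>d < \<dots>\<close>, so that \<open>take d ms = [m\<^sub>1, \<dots>, m\<^bsub>d-1\<^esub>]\<close>.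
  In the first case the condition \<open>m\<^bsub>l-1\<^esub> < i\<close> is void if \<open>l = 1\<close>.
\<close>

definition sigma2 :: "nat list \<Rightarrow> label \<Rightarrow> label \<Rightarrow> ltree \<Rightarrow> ltree" where
  "sigma2 h i j T =
     (let T' = relabel (bump i) T;
          L' = bump_labeling i (the (slide_labeling h T));
          ms = path_mins L' T' j;
          l = length ms;
          case2 = (\<lambda>d. d < l \<and>
                     sorted_wrt (<) (take d ms @ [i] @ drop d ms @ [j]));
          case3 = (\<lambda>d. d < l - 1 \<and>
                     sorted_wrt (<) (take d ms @ [i] @ drop d (butlast ms) @ [j, last ms]))
      in if (last ms < i \<and> i < j) \<or>
            ((l = 1 \<or> ms ! (l - 2) < i) \<and> i < j \<and> j < last ms)
         then graft j i T'
         else if \<exists>d. case2 d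
         then let c = drop (THE d. case2 d) ms
              in graft j (last c) (relabel (shift_chain i c) T')
         else if \<exists>d. case3 d
         then let c = drop (THE d. case3 d) (butlast ms)
              in graft j (last c) (relabel (shift_chain i c) T')
         else undefined)"

text \<open>The map \<open>\<sigma>\<^sub>j\<close> on \<open>Slide h\<close>; here \<open>ms ! d\<close> is \<open>m\<^bsub>d+1\<^esub>\<close>. For \<open>h = []\<close> the first case
  applies, and the leaf \<open>i\<close> is not used.\<close>

definition sigma1 :: "nat list \<Rightarrow> label \<Rightarrow> ltree \<Rightarrow> ltree" where
  "sigma1 h j T =
     (let T' = relabel (bump j) T;
          L' = bump_labeling j (the (slide_labeling h T));
          v = bump j (last_leaf h T);
          i = (THE i. i < v \<and> Leaf i \<in> children (last (path T' v)));
          ms = path_mins L' T' v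
      in if v < j then graft v j T'
         else if i < j \<and> j < v then graft i j T'
         else if j < i
         then graft (ms ! (THE d. Suc d < length ms \<and> ms ! d < j \<and> j < ms ! Suc d)) j T'
         else undefined)"


section \<open>The map \<open>\<Sigma>\<^sub>k\<close>\<close>

definition D :: "nat list \<Rightarrow> (nat \<times> ltree) set" where
  "D k = (SIGMA j : {maxzero k + 1..length k}. Slide (lower k j))"

definition Sigma_map :: "nat list \<Rightarrow> nat \<times> ltree \<Rightarrow> ltree" where
  "Sigma_map k = (\<lambda>(j, T).
     if k ! (j - 1) > 1 then sigma2 (lower k j) (int (maxzero k)) (int j) T
     else sigma1 (lower k j) (int j) T)"

end

theory Submission
  imports Defs "HOL-Library.Multiset"
begin

text \<open>
  Write \<open>min(e)\<close> for the smallest leaf in the branch starting at an edge \<open>e\<close>. A tree with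
  edge labels is a slide tree exactly if for every internal edge \<open>e\<close> with label \<open>l\<close> the leaf \<open>l\<close>
  lies below \<open>e\<close>, no edge between \<open>e\<close> and \<open>l\<close> has a label below \<open>l\<close>, \<open>min(e) < l\<close>, and the
  labels strictly increase towards the root along edges with the same minimum. Drawing the child
  with the smaller minimum on the left turns this into a recursive condition on binary trees, and
  the maximal decreasing runs on a path become its maximal segments of constant minimum.

  The image of the summand \<open>j\<close> is the set of slide trees with last leaf \<open>j\<close>. Such a leaf \<open>j\<close> is
  adjacent to its predecessor in the chain of minima that defines the last leaf. If \<open>j\<close> labels
  only one edge, contract that cherry to the predecessor. Otherwise contract it to \<open>j\<close> and move
  each remaining element of the chain to the place of its predecessor, which makes the zero entry
  disappear; a count of labels shows that every label then still sits above its leaf.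
\<close>

section \<open>Binary trees with labelled internal edges\<close>

text \<open>A label condition on an edge refers to everything below that edge, while the insertions
  rearrange leaves deep inside the tree. The binary trees make the condition local: apart from its
  leaf set, a branch is seen from above only through its minimum, the label at its root and its open
  leaves. Each rearrangement therefore has to control the minimum and must not lose open leaves, and
  every induction carries an inclusion of open leaves along. Of \<open>i\<close> only two facts
  matter: it labels no edge, and every larger leaf labels one. Both hold for the leaf c if no entry
  vanishes, which is why the convention on \<open>maxzero\<close> needs no separate treatment. The
  delicate point is the shift along the chain. The minimum of a right branch is moved away, which
  destroys the label above that branch if it is this very minimum. No local condition excludes that;
  only the number of labels prescribed by the composition does. Binary shape is itself a consequence
  of counting: \<open>n\<close> labels require \<open>n\<close> internal edges, the largest number
  possible with \<open>n + 3\<close> leaves.\<close>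

text \<open>
  A vertex \<open>Fork l e r\<close> carries the label \<open>e\<close> of the edge above it. In a \<open>valid\<close> tree the left
  branch contains the smaller minimum, so that \<open>head\<close> is the smallest leaf.
\<close>

datatype 'a stree = is_Tip: Tip 'a | Fork "'a stree" 'a "'a stree"

primrec tips :: "'a stree \<Rightarrow> 'a set" where
  "tips (Tip x) = {x}"
| "tips (Fork l e r) = tips l \<union> tips r"

primrec head :: "'a stree \<Rightarrow> 'a" where
  "head (Tip x) = x"
| "head (Fork l e r) = head l"

primrec marks :: "'a stree \<Rightarrow> 'a multiset" where
  "marks (Tip x) = {#}"
| "marks (Fork l e r) = add_mset e (marks l + marks r)"

text \<open>
  The leaves that may label one more edge on top of the tree: no edge above such a leaf has a
  smaller label.
\<close>

primrec open_tips :: "'a :: linorder stree \<Rightarrow> 'a set" where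
  "open_tips (Tip x) = {x}"
| "open_tips (Fork l e r) = {x \<in> open_tips l \<union> open_tips r. x \<le> e}"

primrec mark_less :: "'a :: linorder stree \<Rightarrow> 'a \<Rightarrow> bool" where
  "mark_less (Tip x) e' \<longleftrightarrow> True"
| "mark_less (Fork l e r) e' \<longleftrightarrow> e < e'"

primrec valid :: "'a :: linorder stree \<Rightarrow> bool" where
  "valid (Tip x) \<longleftrightarrow> True"
| "valid (Fork l e r) \<longleftrightarrow> valid l \<and> valid r \<and> tips l \<inter> tips r = {} \<and> head l < head r \<and>
     mark_less l e \<and> e \<in> open_tips r"

text \<open>
  The minima of \<open>B\<close>, \<open>min\<^sub>2(B)\<close>, \<open>min\<^sub>2(min\<^sub>2(B))\<close>, \<open>\<dots>\<close> for a valid tree \<open>B\<close>.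
\<close>

primrec chain :: "'a :: linorder stree \<Rightarrow> 'a list" where
  "chain (Tip x) = [x]"
| "chain (Fork l e r) =
     (if \<not> is_Tip l \<and> chain l ! 1 < head r then chain l else head l # chain r)"

text \<open>Meaningful only for a leaf \<open>i\<close>: the largest branch of a valid tree with minimum \<open>i\<close>.\<close>

primrec branch :: "'a \<Rightarrow> 'a stree \<Rightarrow> 'a stree" where
  "branch i (Tip x) = Tip x"
| "branch i (Fork l e r) =
     (if head l = i then Fork l e r else if i \<in> tips l then branch i l else branch i r)"

section \<open>Minima, open leaves and the chain of a valid tree\<close>

lemma valid_ForkD:
  assumes "valid (Fork l e r)"
  shows "valid l" "valid r" "tips l \<inter> tips r = {}" "head l < head r" "mark_less l e" "e \<in> open_tips r"
  using assms by simp_all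

lemma finite_tips [simp]: "finite (tips t)"
  by (induction t) auto

lemma head_in_tips [simp]: "head t \<in> tips t"
  by (induction t) auto

lemma open_tips_subset: "open_tips t \<subseteq> tips t"
  by (induction t) auto

lemma head_le: "valid t \<Longrightarrow> x \<in> tips t \<Longrightarrow> head t \<le> x"
proof (induction t)
  case (Fork l e r)
  then show ?case by (cases "x \<in> tips l") auto
qed auto

lemma mark_gt_head: "valid (Fork l e r) \<Longrightarrow> head l < e"
  using open_tips_subset[of r] head_le[of r e] by fastforce

lemma head_open: "valid t \<Longrightarrow> head t \<in> open_tips t"
proof (induction t)
  case (Fork l e r)
  then show ?case using mark_gt_head[OF Fork.prems] by auto
qed auto

lemma marks_in_tips: "valid t \<Longrightarrow> x \<in># marks t \<Longrightarrow> x \<in> tips t"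
proof (induction t)
  case (Fork l e r)
  then show ?case using open_tips_subset[of r] by auto
qed auto

lemma marks_neq_head: "valid t \<Longrightarrow> x \<in># marks t \<Longrightarrow> head t < x"
proof (induction t)
  case (Fork l e r)
  then have "x \<in># marks r \<Longrightarrow> head l < x" by force
  then show ?case using Fork mark_gt_head[OF Fork.prems(1)] by auto
qed auto

lemma size_marks: "valid t \<Longrightarrow> Suc (size (marks t)) = card (tips t)"
proof (induction t)
  case (Fork l e r)
  then show ?case by (simp add: card_Un_disjoint)
qed auto

lemma chain_ne [simp]: "chain t \<noteq> []"
  by (induction t) auto

lemma hd_chain [simp]: "hd (chain t) = head t"
  by (induction t) auto

lemma tl_chain_eq_Nil: "tl (chain t) = [] \<longleftrightarrow> is_Tip t"
  by (induction t) auto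

lemma chain_in_tips: "set (chain t) \<subseteq> tips t"
  by (induction t) auto

lemma last_chain_in_tips: "last (chain t) \<in> tips t"
  using chain_in_tips[of t] chain_ne[of t] last_in_set by blast

lemma chain_Cons: "chain t = head t # tl (chain t)"
  by (metis chain_ne hd_chain list.collapse)

text \<open>The second smallest leaf of a fork is either that of the left branch or the minimum of
  the right branch, which is the comparison made in \<open>chain\<close>. This ties the chain to the
  leaf \<open>q\<close> in \<open>min2\<close>.\<close>

lemma chain_second:
  assumes "valid t" "\<not> is_Tip t" "x \<in> tips t" "x \<noteq> head t"
  shows "chain t ! 1 \<le> x"
  using assms
proof (induction t)
  case (Fork l e r)
  have r1: "chain r ! 0 = head r" by (metis chain_Cons nth_Cons_0)
  have hr: "x \<in> tips r \<Longrightarrow> head r \<le> x" using Fork.prems head_le[of r] by auto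
  show ?case
  proof (cases "\<not> is_Tip l \<and> chain l ! 1 < head r")
    case True
    then show ?thesis using Fork hr by auto
  next
    case False
    show ?thesis
    proof (cases "x \<in> tips l")
      case True
      then have "\<not> is_Tip l" using Fork.prems(4) by (cases l) auto
      then show ?thesis using False True Fork r1 by force
    next
      case F2: False
      then show ?thesis using False hr r1 Fork.prems by auto
    qed
  qed
qed auto

lemma sorted_chain: "valid t \<Longrightarrow> sorted_wrt (<) (chain t)"
proof (induction t)
  case (Fork l e r)
  have "head l < x" if "x \<in> tips r" for x
    using that Fork.prems head_le[of r x] by auto
  then show ?case using Fork chain_in_tips[of r] by auto
qed auto

text \<open>A label is a leaf of the right branch and hence not the minimum of the tree.\<close>

lemma mark_ge_second:
  assumes "valid t" "t = Fork l e r"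
  shows "chain t ! 1 \<le> e"
  using assms chain_second[of t e] mark_gt_head[of l e r] open_tips_subset[of r]
    by (cases l) auto

text \<open>If the left branch were a fork, its root label would be at least its second smallest
  leaf and less than \<open>e = j\<close>, so the chain would have stayed on the left. Hence the end
  of a chain forms a cherry with its predecessor.\<close>

lemma cherry_at_right_tip:
  assumes "valid (Fork l e (Tip j))" "\<not> (\<not> is_Tip l \<and> chain l ! 1 < j)"
  shows "(\<exists>y. l = Tip y) \<and> e = j"
proof (cases l)
  case (Fork l1 e1 r1)
  then have "chain l ! 1 \<le> e1" "e1 < j" using mark_ge_second[of l] assms(1) by auto
  then show ?thesis using assms(2) Fork by auto
qed (use assms(1) in simp)

text \<open>The chain of a fork ends in a tip that is a right branch. Such a tip is the only open
  leaf of its branch, so it must be the label of the fork above it.\<close>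

lemma last_chain_marked: "valid t \<Longrightarrow> \<not> is_Tip t \<Longrightarrow> last (chain t) \<in># marks t"
proof (induction t)
  case (Fork l e r)
  show ?case
  proof (cases r)
    case (Tip x)
    then show ?thesis using Fork by auto
  next
    case (Fork l' e' r')
    then have "last (chain r) \<in># marks r" using Fork.IH Fork.prems by simp
    then show ?thesis using Fork.IH Fork.prems by auto
  qed
qed auto

section \<open>The largest branch with a given minimum\<close>

lemma tips_branch: "tips (branch i t) \<subseteq> tips t"
  by (induction t) auto

lemma head_branch: "i \<in> tips t \<Longrightarrow> head (branch i t) = i"
  by (induction t) auto

lemma valid_branch: "valid t \<Longrightarrow> valid (branch i t)"
  by (induction t) auto

lemma branch_head: "branch (head t) t = t"
  by (induction t) auto

lemma marks_branch: "marks (branch i t) \<subseteq># marks t"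
proof (induction t)
  case (Fork l e r)
  have "marks l \<subseteq># marks (Fork l e r)" "marks r \<subseteq># marks (Fork l e r)"
    by (simp_all add: subseteq_mset_def)
  then show ?case using Fork subset_mset.order_trans[of "marks (branch i l)"]
      subset_mset.order_trans[of "marks (branch i r)"] by (simp del: marks.simps)
qed auto

lemma chain_Tip: "is_Tip t \<Longrightarrow> chain t = [head t]"
  by (cases t) auto

lemma chain_Fork:
  assumes "\<not> is_Tip t" obtains ys where "chain t = head t # chain t ! 1 # ys"
proof -
  have "tl (chain t) \<noteq> []" using assms by (simp add: tl_chain_eq_Nil)
  then show thesis using that chain_Cons[of t] by (cases "tl (chain t)") (auto simp del: hd_chain)
qed

lemma second_gt_head:
  assumes "valid t" "\<not> is_Tip t" shows "head t < chain t ! 1"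
proof -
  from chain_Fork[OF assms(2)] obtain ys where "chain t = head t # chain t ! 1 # ys" .
  then show ?thesis using sorted_chain[OF assms(1)] by (metis list.set_intros(1) sorted_wrt.simps(2))
qed

lemma takeWhile_chain_Nil: "\<not> head t < j \<Longrightarrow> takeWhile (\<lambda>x. x < j) (chain t) = []"
  by (subst chain_Cons) simp

lemma takeWhile_chain_ne: "head t < j \<Longrightarrow> takeWhile (\<lambda>x. x < j) (chain t) \<noteq> []"
  by (subst chain_Cons) simp

lemma takeWhile_chain_single:
  assumes "head t < j" "\<not> is_Tip t \<Longrightarrow> \<not> chain t ! 1 < j"
  shows "takeWhile (\<lambda>x. x < j) (chain t) = [head t]"
proof (cases "is_Tip t")
  case False
  then obtain ys where "chain t = head t # chain t ! 1 # ys" by (rule chain_Fork)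
  then show ?thesis using assms False by (metis takeWhile.simps(2))
qed (use assms chain_Tip[of t] in simp)

section \<open>Insertion of a leaf that labels one edge\<close>

primrec sgraft :: "'a \<Rightarrow> 'a \<Rightarrow> 'a stree \<Rightarrow> 'a stree" where
  "sgraft p j (Tip z) = (if z = p then Fork (Tip p) j (Tip j) else Tip z)"
| "sgraft p j (Fork l e r) = Fork (sgraft p j l) e (sgraft p j r)"

lemma sgraft_id: "p \<notin> tips t \<Longrightarrow> sgraft p j t = t"
  by (induction t) auto

lemma tips_sgraft: "p \<in> tips t \<Longrightarrow> tips (sgraft p j t) = insert j (tips t)"
proof (induction t)
  case (Fork l e r)
  then show ?case by (cases "p \<in> tips l"; cases "p \<in> tips r") (auto simp: sgraft_id)
qed auto

lemma head_sgraft [simp]: "head (sgraft p j t) = head t"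
  by (induction t) auto

lemma marks_sgraft: "valid t \<Longrightarrow> p \<in> tips t \<Longrightarrow> marks (sgraft p j t) = add_mset j (marks t)"
proof (induction t)
  case (Fork l e r)
  then show ?case by (cases "p \<in> tips l"; cases "p \<in> tips r") (auto simp: sgraft_id)
qed auto

lemma open_sgraft: "p < j \<Longrightarrow> open_tips t \<subseteq> open_tips (sgraft p j t)"
  by (induction t) auto

lemma mark_less_sgraft: "mark_less t e \<Longrightarrow> (\<And>x. t = Tip x \<Longrightarrow> j < e) \<Longrightarrow> mark_less (sgraft p j t) e"
  by (cases t) auto

lemma last_takeWhile:
  assumes "xs \<noteq> []" "P (hd xs)"
  shows "last (takeWhile P xs) \<in> set xs \<and> P (last (takeWhile P xs))"
proof -
  have "takeWhile P xs \<noteq> []" using assms by (cases xs) auto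
  then show ?thesis by (meson last_in_set set_takeWhileD)
qed

text \<open>All three cases of \<open>sigma1\<close> graft at this leaf: it is the end of the chain
  if that end is below \<open>j\<close>, the neighbour of the end if only the end exceeds
  \<open>j\<close>, and otherwise \<open>m\<^sub>d\<close>.\<close>

definition slot :: "'a \<Rightarrow> 'a :: linorder stree \<Rightarrow> 'a" where
  "slot j t = last (takeWhile (\<lambda>x. x < j) (chain t))"

lemma slot_props:
  assumes "head t < j" shows "slot j t \<in> tips t" "slot j t < j"
  using last_takeWhile[of "chain t" "\<lambda>x. x < j"] assms chain_in_tips unfolding slot_def by auto

text \<open>Placed next to the last chain element below \<open>j\<close>, the new leaf beats every
  larger continuation, so the chain is cut and ends in \<open>j\<close>. This is how
  \<open>j\<close> can be read off the resulting tree.\<close>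

lemma graft_chain:
  assumes "valid t" "j \<notin> tips t" "head t < j"
  shows "valid (sgraft (slot j t) j t) \<and>
     chain (sgraft (slot j t) j t) = takeWhile (\<lambda>x. x < j) (chain t) @ [j]"
  using assms
proof (induction t)
  case (Tip x)
  then show ?case by (simp add: slot_def)
next
  case (Fork l e r)
  note v = valid_ForkD[OF Fork.prems(1)]
  have hj: "head l < j" "j \<notin> tips l" "j \<notin> tips r"
    using Fork.prems by auto
  note IHl = Fork.IH(1)[OF v(1) hj(2,1)]
  show ?case
  proof (cases "\<not> is_Tip l \<and> chain l ! 1 < head r")
    case True
    have s: "slot j (Fork l e r) = slot j l" using True by (simp add: slot_def)
    have p: "slot j l \<in> tips l" "slot j l < j" using slot_props hj by auto
    then have r: "sgraft (slot j l) j r = r" using v by (intro sgraft_id) auto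
    let ?l = "sgraft (slot j l) j l"
    from True have "\<not> is_Tip l" by simp
    from chain_Fork[OF this] obtain ys where y: "chain l = head l # chain l ! 1 # ys" .
    \<comment> \<open>The second smallest leaf on the left is the old one or \<open>j\<close>. In
      the latter case it has only become smaller, so the chain still stays on the left.\<close>
    have "\<not> is_Tip ?l \<and> chain ?l ! 1 < head r"
    proof -
      have "chain ?l = takeWhile (\<lambda>x. x < j) (head l # chain l ! 1 # ys) @ [j]" using IHl y by simp
      then have "chain ?l ! 1 = (if chain l ! 1 < j then chain l ! 1 else j)" "length (chain ?l) > 1"
        using hj by auto
      moreover have "j < head r" if "\<not> chain l ! 1 < j" using that True by auto
      ultimately show ?thesis using chain_Tip[of ?l] True by (auto split: if_splits)
    qed
    moreover have "mark_less ?l e" using True v by (intro mark_less_sgraft) auto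
    moreover have "tips ?l \<inter> tips r = {}" using tips_sgraft[OF p(1)] v hj by auto
    ultimately show ?thesis using IHl v r True by (simp add: s)
  next
    case False
    note F = this
    show ?thesis
    proof (cases "head r < j")
      case True
      note IHr = Fork.IH(2)[OF v(2) hj(3) True]
      have s: "slot j (Fork l e r) = slot j r"
        using False hj True takeWhile_chain_ne[of r j] by (auto simp: slot_def)
      have p: "slot j r \<in> tips r" "slot j r < j" using slot_props True by auto
      then have l: "sgraft (slot j r) j l = l" using v by (intro sgraft_id) auto
      have "e \<in> open_tips (sgraft (slot j r) j r)" using open_sgraft[OF p(2)] v by auto
      moreover have "tips (sgraft (slot j r) j r) \<inter> tips l = {}" using tips_sgraft[OF p(1)] v hj by auto
      ultimately show ?thesis using IHr v l False hj by (auto simp: s)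
    next
      case False
      then have jr: "j < head r" using hj by (metis head_in_tips linorder_neqE)
      have tw: "takeWhile (\<lambda>x. x < j) (chain r) = []" using jr by (intro takeWhile_chain_Nil) auto
      have s: "slot j (Fork l e r) = head l"
        using F hj tw by (auto simp: slot_def)
      have tl': "takeWhile (\<lambda>x. x < j) (chain l) = [head l]"
        using F jr hj by (intro takeWhile_chain_single) auto
      have sl: "slot j l = head l" by (simp add: slot_def tl')
      let ?l = "sgraft (head l) j l"
      have IH: "valid ?l" "chain ?l = [head l, j]" using IHl unfolding sl tl' by auto
      have r: "sgraft (head l) j r = r" using v head_in_tips[of l] by (intro sgraft_id) blast
      \<comment> \<open>If \<open>l\<close> was a tip, the new edge has the same minimum as the edge
        labelled \<open>e\<close> above it, so \<open>j < e\<close> is required. As a leaf of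
        \<open>r\<close>, the label \<open>e\<close> is at least \<open>head r\<close>.\<close>
      have "head r \<le> e" using v open_tips_subset head_le by blast
      then have "mark_less ?l e" using v jr by (intro mark_less_sgraft) auto
      moreover have "tips ?l \<inter> tips r = {}" using tips_sgraft[of "head l" l j] v hj by auto
      moreover have "\<not> is_Tip ?l" using chain_Tip[of ?l] IH by auto
      ultimately show ?thesis using IH v r jr F tw hj by (auto simp add: s)
    qed
  qed
qed

text \<open>Above the largest branch with minimum \<open>i\<close> the graft changes neither minima
  nor root labels, and open leaves are only gained.\<close>

lemma graft_branch:
  assumes "valid t" "j \<notin> tips t" "i \<in> tips t" "i < j"
  shows "valid (sgraft (slot j (branch i t)) j t) \<and>
     branch i (sgraft (slot j (branch i t)) j t) = sgraft (slot j (branch i t)) j (branch i t)"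
  using assms
proof (induction t)
  case (Tip x)
  then show ?case by (auto simp: slot_def)
next
  case (Fork l e r)
  show ?case
  proof (cases "head l = i")
    case True
    then show ?thesis using graft_chain[OF Fork.prems(1,2)] Fork.prems by simp
  next
    case False
    note v = valid_ForkD[OF Fork.prems(1)]
    have hj: "j \<notin> tips l" "j \<notin> tips r"
      using Fork.prems by auto
    have p: "slot j (branch i (Fork l e r)) < j"
      "slot j (branch i (Fork l e r)) \<in> tips (branch i (Fork l e r))"
      using Fork.prems by (auto intro!: slot_props simp del: branch.simps simp: head_branch)
    show ?thesis
    proof (cases "i \<in> tips l")
      case True
      let ?p = "slot j (branch i l)"
      have pl: "?p \<in> tips l" using p True False tips_branch[of i l] by auto
      have "sgraft ?p j r = r" using pl v by (intro sgraft_id) auto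
      moreover have "mark_less (sgraft ?p j l) e" using v True False
        by (intro mark_less_sgraft) auto
      moreover have "tips (sgraft ?p j l) \<inter> tips r = {}" using tips_sgraft[OF pl] v hj by auto
      ultimately show ?thesis using Fork.IH(1)[OF v(1) hj(1) True Fork.prems(4)] v True False
        by (auto simp: tips_sgraft pl)
    next
      case i: False
      then have ir: "i \<in> tips r" using Fork.prems by auto
      let ?p = "slot j (branch i r)"
      have pr: "?p \<in> tips r" "?p < j" using p i False tips_branch[of i r] by auto
      have "sgraft ?p j l = l" using pr v by (intro sgraft_id) auto
      moreover have "e \<in> open_tips (sgraft ?p j r)" using open_sgraft[OF pr(2)] v by auto
      moreover have "tips (sgraft ?p j r) \<inter> tips l = {}" using tips_sgraft[OF pr(1)] v hj by auto
      ultimately show ?thesis using Fork.IH(2)[OF v(2) hj(2) ir Fork.prems(4)] v False i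
        by (auto simp: tips_sgraft pr)
    qed
  qed
qed

text \<open>The new leaf \<open>j\<close> itself shows which cherry has to be contracted, so the two
  grafting positions may be arbitrary.\<close>

lemma sgraft_inj:
  "sgraft p j s = sgraft q j t \<Longrightarrow> j \<notin> tips s \<Longrightarrow> j \<notin> tips t \<Longrightarrow> s = t"
proof (induction s arbitrary: t)
  case (Tip x)
  then show ?case
  proof (cases t)
    case (Fork l e r)
    have "sgraft q j r \<noteq> Tip j" using Tip Fork by (cases r) auto
    then show ?thesis using Tip Fork by (auto split: if_splits)
  qed (auto split: if_splits)
next
  case (Fork l e r)
  then show ?case
  proof (cases t)
    case (Tip x)
    have "sgraft p j r \<noteq> Tip j" using Fork.prems by (cases r) auto
    then show ?thesis using Tip Fork.prems by (auto split: if_splits)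
  next
    case (Fork l' e' r')
    then have "sgraft p j l = sgraft q j l'" "e = e'" "sgraft p j r = sgraft q j r'"
      "j \<notin> tips l" "j \<notin> tips r" "j \<notin> tips l'" "j \<notin> tips r'"
      using Fork.prems by simp_all
    then show ?thesis using Fork Fork.IH(1)[of l'] Fork.IH(2)[of r'] by simp
  qed
qed

text \<open>The contraction removes one label \<open>j\<close>; as there is no other, no fork
  further up relies on \<open>j\<close>. The inclusion of open leaves drives the induction: the
  label of a fork differs from \<open>j\<close> and so stays open in the smaller right
  branch.\<close>

lemma ungraft_chain:
  assumes "valid t" "\<not> is_Tip t" "j = last (chain t)" "count (marks t) j = 1"
  shows "\<exists>s. valid s \<and> j \<notin> tips s \<and> head s = head t \<and> t = sgraft (slot j s) j s \<and>
     open_tips t - {j} \<subseteq> open_tips s"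
  using assms
proof (induction t)
  case (Fork l e r)
  note v = valid_ForkD[OF Fork.prems(1)]
  show ?case
  proof (cases "\<not> is_Tip l \<and> chain l ! 1 < head r")
    case True
    then have j: "j = last (chain l)" "j \<in># marks l" using Fork.prems last_chain_marked[of l] v by auto
    have jr: "j \<notin> tips r" using j marks_in_tips[of l j] v by auto
    then have "count (marks r) j = 0" using marks_in_tips[of r j] v by (meson count_eq_zero_iff)
    moreover have "e \<noteq> j" using jr v open_tips_subset by blast
    ultimately have "count (marks l) j = 1" using Fork.prems by auto
    then obtain s where s: "valid s" "j \<notin> tips s" "head s = head l" "l = sgraft (slot j s) j s"
      "open_tips l - {j} \<subseteq> open_tips s"
      using Fork.IH(1) v True j by blast
    have hsj: "head s < j" using marks_neq_head[OF v(1) j(2)] s(3) by simp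
    have tl: "tips l = insert j (tips s)" using tips_sgraft[OF slot_props(1)[OF hsj], of j] s(4) by simp
    have ch: "chain l = takeWhile (\<lambda>x. x < j) (chain s) @ [j]"
      using graft_chain[OF s(1,2) hsj] s(4) by simp
    have ml: "mark_less s e" using v(5) s(4) by (cases s) auto
    let ?s = "Fork s e r"
    \<comment> \<open>Without \<open>j\<close> the chain may leave the left branch. This happens
      only if \<open>j\<close> was the second smallest leaf there; then all of \<open>r\<close>
      exceeds \<open>j\<close>, and the slot is the same.\<close>
    have sl: "slot j ?s = slot j s"
    proof (cases "\<not> is_Tip s \<and> chain s ! 1 < head r")
      case True
      then show ?thesis by (simp add: slot_def)
    next
      case F: False
      have tw: "takeWhile (\<lambda>x. x < j) (chain s) = [head s]"
      proof (rule takeWhile_chain_single[OF hsj], rule notI)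
        assume n: "\<not> is_Tip s" and y: "chain s ! 1 < j"
        from n obtain ys where "chain s = head s # chain s ! 1 # ys" by (rule chain_Fork)
        then have "chain l ! 1 = chain s ! 1" using ch y hsj
          by (metis One_nat_def append_Cons nth_Cons_0 nth_Cons_Suc takeWhile.simps(2))
        then show False using F True n by simp
      qed
      then have "chain l = [head s, j]" using ch by simp
      then have "j < head r" using True by simp
      then have "takeWhile (\<lambda>x. x < j) (chain r) = []" by (intro takeWhile_chain_Nil) auto
      then show ?thesis using F tw hsj by (auto simp: slot_def)
    qed
    have "sgraft (slot j s) j r = r" using slot_props(1)[OF hsj] tl v by (intro sgraft_id) auto
    then have "Fork l e r = sgraft (slot j ?s) j ?s" using sl s(4) by simp
    moreover have "valid ?s" using s(1,3) v ml tl by auto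
    moreover have "j \<notin> tips ?s" using s(2) jr by auto
    moreover have "open_tips (Fork l e r) - {j} \<subseteq> open_tips ?s" using s(5) by auto
    moreover have "head ?s = head (Fork l e r)" using s(3) by simp
    ultimately show ?thesis by blast
  next
    case False
    then have j: "j = last (chain r)" using Fork.prems by auto
    show ?thesis
    proof (cases r)
      case (Tip x)
      then have c: "\<not> (\<not> is_Tip l \<and> chain l ! 1 < x)" "x = j" using False j by auto
      then obtain y where l: "l = Tip y" "e = x" using cherry_at_right_tip Fork.prems(1) unfolding Tip by blast
      then have x: "x = j" "e = j" using c by simp_all
      have "head l < j" "y < j" using v Tip x l by auto
      then show ?thesis using l Tip x by (intro exI[of _ "Tip y"]) (auto simp: slot_def)
    next
      case (Fork l1 e1 r1)
      then have tr: "\<not> is_Tip r" by auto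
      then have jm: "j \<in># marks r" using last_chain_marked[OF v(2)] j by auto
      then have "count (marks r) j > 0" by simp
      then have cnt: "count (marks r) j = 1" "e \<noteq> j" using Fork.prems(4)
        by (simp_all del: count_greater_zero_iff split: if_splits)
      obtain s where s: "valid s" "j \<notin> tips s" "head s = head r" "r = sgraft (slot j s) j s"
        "open_tips r - {j} \<subseteq> open_tips s"
        using Fork.IH(2)[OF v(2) tr j cnt(1)] by blast
      have hsj: "head s < j" using marks_neq_head[OF v(2) jm] s(3) by simp
      have tl: "tips r = insert j (tips s)" using tips_sgraft[OF slot_props(1)[OF hsj], of j] s(4) by simp
      let ?s = "Fork l e s"
      have sl: "slot j ?s = slot j s"
        using False hsj s(3) v takeWhile_chain_ne[of s j] marks_neq_head[OF v(2) jm] by (auto simp: slot_def)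
      have "sgraft (slot j s) j l = l" using slot_props(1)[OF hsj] tl v by (intro sgraft_id) auto
      then have "Fork l e r = sgraft (slot j ?s) j ?s" using sl s(4) by simp
      moreover have "valid ?s" using s(1,3,5) v tl cnt by auto
      moreover have "j \<notin> tips ?s" using s(2) tl v by auto
      moreover have "open_tips (Fork l e r) - {j} \<subseteq> open_tips ?s" using s(5) by auto
      moreover have "head ?s = head (Fork l e r)" by simp
      ultimately show ?thesis by blast
    qed
  qed
qed auto

lemma ungraft_branch:
  assumes "valid t" "i \<in> tips t" "\<not> is_Tip (branch i t)" "j = last (chain (branch i t))"
    "count (marks t) j = 1"
  shows "\<exists>s. valid s \<and> j \<notin> tips s \<and> i \<in> tips s \<and> head s = head t \<and> t = sgraft (slot j (branch i s)) j s \<and>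
     open_tips t - {j} \<subseteq> open_tips s"
  using assms
proof (induction t)
  case (Fork l e r)
  note v = valid_ForkD[OF Fork.prems(1)]
  have jm: "j \<in># marks (branch i (Fork l e r))" using Fork.prems last_chain_marked valid_branch by blast
  have ij: "i < j" using jm marks_neq_head[OF valid_branch[OF Fork.prems(1)]] head_branch[OF Fork.prems(2)]
    by metis
  show ?case
  proof (cases "head l = i")
    case True
    have b: "branch i (Fork l e r) = Fork l e r" using True by simp
    have "\<exists>s. valid s \<and> j \<notin> tips s \<and> head s = head (Fork l e r) \<and> Fork l e r = sgraft (slot j s) j s \<and>
     open_tips (Fork l e r) - {j} \<subseteq> open_tips s"
      using Fork.prems unfolding b by (intro ungraft_chain) blast+
    then obtain s where s: "valid s" "j \<notin> tips s" "head s = head (Fork l e r)"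
      "Fork l e r = sgraft (slot j s) j s" "open_tips (Fork l e r) - {j} \<subseteq> open_tips s"
      by blast
    have "branch i s = s" using s(3) True branch_head[of s] by simp
    moreover have "i \<in> tips s" using s(3) True head_in_tips[of s] by simp
    moreover have "Fork l e r = sgraft (slot j (branch i s)) j s" using s(4) \<open>branch i s = s\<close> by (simp only:)
    ultimately show ?thesis using s by blast
  next
    case False
    show ?thesis
    proof (cases "i \<in> tips l")
      case True
      have b: "branch i (Fork l e r) = branch i l" using True False by simp
      have jl: "j \<in># marks l" using jm marks_branch[of i l] b by (metis mset_subset_eqD)
      have jr: "j \<notin> tips r" using jl marks_in_tips[of l j] v by auto
      then have "count (marks r) j = 0" using marks_in_tips[of r j] v by (meson count_eq_zero_iff)
      moreover have "e \<noteq> j" using jr v open_tips_subset by blast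
      ultimately have "count (marks l) j = 1" using Fork.prems by auto
      then obtain s where s: "valid s" "j \<notin> tips s" "i \<in> tips s" "head s = head l"
        "l = sgraft (slot j (branch i s)) j s" "open_tips l - {j} \<subseteq> open_tips s"
        using Fork.IH(1)[OF v(1) True] Fork.prems(3,4) unfolding b by blast
      have p: "slot j (branch i s) \<in> tips s"
        using slot_props(1)[of "branch i s" j] ij head_branch[OF s(3)] tips_branch[of i s] by auto
      have tl: "tips l = insert j (tips s)" using tips_sgraft[OF p, of j] s(5) by simp
      have ml: "mark_less s e" using v(5) s(5) by (cases s) auto
      let ?s = "Fork s e r"
      have bs: "branch i ?s = branch i s" using False s(3,4) by simp
      have "sgraft (slot j (branch i s)) j r = r" using p tl v by (intro sgraft_id) auto
      then have "Fork l e r = sgraft (slot j (branch i ?s)) j ?s" using bs s(5) by simp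
      moreover have "valid ?s" using s(1,4) v ml tl by auto
      moreover have "j \<notin> tips ?s" using s(2) jr by auto
      moreover have "open_tips (Fork l e r) - {j} \<subseteq> open_tips ?s" using s(6) by auto
      moreover have "i \<in> tips ?s" "head ?s = head (Fork l e r)" using s(3,4) by simp_all
      ultimately show ?thesis by blast
    next
      case i: False
      then have ir: "i \<in> tips r" using Fork.prems by auto
      have b: "branch i (Fork l e r) = branch i r" using i False by simp
      have jl: "j \<in># marks r" using jm marks_branch[of i r] b by (metis mset_subset_eqD)
      then have "count (marks r) j > 0" by simp
      then have cnt: "count (marks r) j = 1" "e \<noteq> j" using Fork.prems(5)
        by (simp_all del: count_greater_zero_iff split: if_splits)
      then obtain s where s: "valid s" "j \<notin> tips s" "i \<in> tips s" "head s = head r"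
        "r = sgraft (slot j (branch i s)) j s" "open_tips r - {j} \<subseteq> open_tips s"
        using Fork.IH(2)[OF v(2) ir] Fork.prems(3,4) unfolding b by blast
      have p: "slot j (branch i s) \<in> tips s"
        using slot_props(1)[of "branch i s" j] ij head_branch[OF s(3)] tips_branch[of i s] by auto
      have tl: "tips r = insert j (tips s)" using tips_sgraft[OF p, of j] s(5) by simp
      let ?s = "Fork l e s"
      have bs: "branch i ?s = branch i s" using False i s(4) v by auto
      have "sgraft (slot j (branch i s)) j l = l" using p tl v by (intro sgraft_id) auto
      then have "Fork l e r = sgraft (slot j (branch i ?s)) j ?s" using bs s(5) by simp
      moreover have "valid ?s" using s(1,4,6) v tl cnt by auto
      moreover have "j \<notin> tips ?s" using s(2) tl v by auto
      moreover have "open_tips (Fork l e r) - {j} \<subseteq> open_tips ?s" using s(6) by auto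
      moreover have "i \<in> tips ?s" "head ?s = head (Fork l e r)" using s(3,4) by simp_all
      ultimately show ?thesis by blast
    qed
  qed
qed auto

section \<open>Insertion of a leaf that labels no edge\<close>

primrec set_head :: "'a \<Rightarrow> 'a stree \<Rightarrow> 'a stree" where
  "set_head x (Tip y) = Tip x"
| "set_head x (Fork l e r) = Fork (set_head x l) e r"

text \<open>
  On the way down to \<open>j\<close>, the leaf \<open>x\<close> replaces the minimum of the current branch, and the
  replaced leaf is carried into the next branch to the right. In \<open>ins j (Tip y)\<close> always \<open>y = j\<close>.
\<close>

primrec ins :: "'a \<Rightarrow> 'a stree \<Rightarrow> 'a \<Rightarrow> 'a stree" where
  "ins j (Tip y) x = Fork (Tip x) j (Tip j)"
| "ins j (Fork l e r) x =
     (if j \<in> tips l then Fork (ins j l x) e r else Fork (set_head x l) e (ins j r (head l)))"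

text \<open>Minima below \<open>i\<close> on the way to \<open>j\<close> stay where they are. The
  first branch on this way whose minimum exceeds \<open>i\<close> receives \<open>i\<close>, and the
  shift starts there.\<close>

primrec place :: "'a :: linorder \<Rightarrow> 'a \<Rightarrow> 'a stree \<Rightarrow> 'a stree" where
  "place i j (Tip y) = (if i < y then ins j (Tip y) i else Tip y)"
| "place i j (Fork l e r) =
     (if i < head l then ins j (Fork l e r) i
      else if j \<in> tips l then Fork (place i j l) e r else Fork l e (place i j r))"

lemma head_set_head [simp]: "head (set_head x t) = x"
  by (induction t) auto

lemma set_head_set_head [simp]: "set_head x (set_head y t) = set_head x t"
  by (induction t) auto

lemma set_head_head [simp]: "set_head (head t) t = t"
  by (induction t) auto

lemma set_head_inj: "set_head x s = set_head x t \<Longrightarrow> head s = head t \<Longrightarrow> s = t"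
  by (metis set_head_head set_head_set_head)

lemma is_Tip_set_head [simp]: "is_Tip (set_head x t) = is_Tip t"
  by (cases t) auto

lemma marks_set_head [simp]: "marks (set_head x t) = marks t"
  by (induction t) auto

lemma mark_less_set_head [simp]: "mark_less (set_head x t) e = mark_less t e"
  by (cases t) auto

lemma head_notin_right: "valid (Fork l e r) \<Longrightarrow> head l \<notin> tips r"
  by (metis disjoint_iff head_in_tips valid.simps(2))

lemma tips_set_head: "valid t \<Longrightarrow> tips (set_head x t) = insert x (tips t - {head t})"
proof (induction t)
  case (Fork l e r)
  then show ?case using head_notin_right[OF Fork.prems] by auto
qed auto

lemma open_set_head: "open_tips t - {head t} \<subseteq> open_tips (set_head x t)"
  by (induction t) auto

text \<open>Only the leftmost tip changes, while labels refer to leaves of right branches; so it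
  suffices that the new minimum is below all other leaves.\<close>

lemma valid_set_head:
  "valid t \<Longrightarrow> (\<And>y. y \<in> tips t \<Longrightarrow> y \<noteq> head t \<Longrightarrow> x < y) \<Longrightarrow> valid (set_head x t)"
proof (induction t)
  case (Fork l e r)
  have n: "y \<noteq> head l" if "y \<in> tips r" for y using that head_notin_right[OF Fork.prems(1)] by auto
  have "x \<notin> tips r" using Fork.prems(2)[of x] n[of x] by auto
  moreover have "x < head r" using Fork.prems(2)[of "head r"] n[of "head r"] by auto
  moreover have "valid (set_head x l)" using Fork.IH(1) Fork.prems by auto
  ultimately show ?case using Fork.prems(1) by (auto simp: tips_set_head)
qed auto

lemma chain_set_head: "chain (set_head x t) = x # tl (chain t)"
proof (induction t)
  case (Fork l e r)
  have "chain l ! 1 = tl (chain l) ! 0" by (metis One_nat_def chain_Cons nth_Cons_Suc)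
  then show ?case using Fork by simp
qed auto

lemma chain_set_head_1: "\<not> is_Tip t \<Longrightarrow> chain (set_head x t) ! 1 = chain t ! 1"
  by (metis chain_set_head chain_Cons One_nat_def nth_Cons_Suc)

lemma head_ins [simp]: "head (ins j t x) = x"
  by (induction t) auto

lemma is_Tip_ins [simp]: "\<not> is_Tip (ins j t x)"
  by (cases t) auto

lemma mark_less_insD: "mark_less (ins j t x) e \<Longrightarrow> mark_less t e"
  by (cases t) (auto split: if_splits)

text \<open>At a right turn the old minimum of the left branch becomes the minimum of the right
  branch and thereby the second smallest leaf of the fork; at a left turn the second smallest leaf
  is found in the left branch. Either way the chain follows the path to \<open>j\<close>.\<close>

lemma ins_props:
  assumes "valid t" "j \<in> tips t" "x < head t"
  shows "valid (ins j t x) \<and> tips (ins j t x) = insert x (tips t) \<and>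
     marks (ins j t x) = add_mset j (marks t) \<and> open_tips t \<subseteq> open_tips (ins j t x) \<and>
     chain (ins j t x) ! 1 = head t \<and> last (chain (ins j t x)) = j"
  using assms
proof (induction t arbitrary: x)
  case (Fork l e r)
  note v = valid_ForkD[OF Fork.prems(1)]
  have x: "x < head l"
    using Fork.prems by auto
  have xr: "x \<notin> tips r" "x \<notin> tips l" using head_le v x by fastforce+
  show ?case
  proof (cases "j \<in> tips l")
    case True
    note IH = Fork.IH(1)[OF v(1) True x]
    have hr: "head r \<le> e" using head_le[OF v(2)] v(6) open_tips_subset by blast
    \<comment> \<open>If \<open>l\<close> is the tip \<open>j\<close>, the new edge is labelled
      \<open>j\<close>, and \<open>j < head r \<le> e\<close>.\<close>
    have "mark_less (ins j l x) e"
    proof (cases l)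
      case (Tip y)
      then show ?thesis using hr v True by auto
    qed (use v in auto)
    then show ?thesis using IH v True xr x by auto
  next
    case False
    then have jr: "j \<in> tips r" using Fork.prems by auto
    note IH = Fork.IH(2)[OF v(2) jr v(4)]
    have vl: "valid (set_head x l)"
      using valid_set_head[OF v(1), of x] head_le[OF v(1)] x by force
    \<comment> \<open>The leaf handed down is lost on the left, but as the minimum of the new right
      branch it is open there.\<close>
    have hl: "head l \<in> open_tips (ins j r (head l))" using head_open[of "ins j r (head l)"] IH by simp
    have "open_tips l \<subseteq> insert (head l) (open_tips (set_head x l))" using open_set_head[of l x] by auto
    then have op: "open_tips (Fork l e r) \<subseteq> open_tips (ins j (Fork l e r) x)"
      using IH hl False by auto
    have ch: "\<not> (\<not> is_Tip (set_head x l) \<and> chain (set_head x l) ! 1 < head (ins j r (head l)))"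
      using chain_set_head_1[of l x] second_gt_head[OF v(1)] by (cases "is_Tip l") auto
    have c1: "chain (ins j r (head l)) ! 0 = head l" by (metis chain_Cons head_ins nth_Cons_0)
    show ?thesis using IH vl xr x v False op ch c1 head_notin_right[OF Fork.prems(1)] head_in_tips[of l]
      by (auto simp: tips_set_head)
  qed
qed auto

text \<open>\<open>set_head\<close> never introduces \<open>j\<close>, so both trees send
  \<open>j\<close> to the same side. The replaced minimum of a left branch is recovered as the
  minimum of the new right branch.\<close>

lemma ins_inj:
  assumes "ins j s x = ins j t y" "valid s" "valid t" "j \<in> tips s" "j \<in> tips t" "x < head s" "y < head t"
  shows "x = y \<and> s = t"
  using assms
proof (induction s arbitrary: t x y)
  case (Tip a)
  show ?case
  proof (cases t)
    case (Fork l e r)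
    then have "ins j r (head l) = Tip j \<or> r = Tip j \<and> j \<in> tips l" using Tip by (auto split: if_splits)
    then have "r = Tip j \<and> j \<in> tips l" using is_Tip_ins[of j r "head l"] by (auto simp del: is_Tip_ins)
    then show ?thesis using Fork Tip.prems by auto
  qed (use Tip in auto)
next
  case (Fork l e r)
  have xy: "x = y" using Fork.prems(1) by (metis head_ins)
  show ?case
  proof (cases t)
    case (Tip a)
    then have "ins j r (head l) = Tip j \<or> r = Tip j \<and> j \<in> tips l" using Fork.prems by (auto split: if_splits)
    then have "r = Tip j \<and> j \<in> tips l" using is_Tip_ins[of j r "head l"] by (auto simp del: is_Tip_ins)
    then show ?thesis using Fork.prems by auto
  next
    case t: (Fork l' e' r')
    have tl: "tips (ins j l x) = insert x (tips l)" if "j \<in> tips l" "valid l" "x < head l" for l x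
      using ins_props[of l j x] that by auto
    have jx: "x < j" using Fork.prems(2,4,6) head_le[of "Fork l e r" j] by auto
    have js: "j \<notin> tips (set_head x l)" if "j \<notin> tips l" "valid l" for l
      using that jx by (auto simp: tips_set_head)
    consider (L) "j \<in> tips l" "j \<in> tips l'" | (R) "j \<notin> tips l" "j \<notin> tips l'"
      | (LR) "j \<in> tips l" "j \<notin> tips l'" | (RL) "j \<notin> tips l" "j \<in> tips l'" by blast
    then show ?thesis
    proof cases
      case L
      then show ?thesis using Fork.IH(1)[of x l' y] Fork.prems t by simp
    next
      case R
      then have e: "ins j r (head l) = ins j r' (head l')" "set_head x l = set_head x l'" "e = e'"
        using Fork.prems(1) t xy by auto
      have jr: "j \<in> tips r" "j \<in> tips r'" using R Fork.prems(4,5) t by auto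
      have vr: "valid r" "valid r'" "head l < head r" "head l' < head r'" using Fork.prems(2,3) t by auto
      have hr: "head l = head l' \<and> r = r'" by (rule Fork.IH(2)[OF e(1) vr(1,2) jr vr(3,4)])
      then have "l = l'" using set_head_inj[OF e(2)] by simp
      then show ?thesis using hr e(3) xy t by simp
    next
      case LR
      then have "ins j l x = set_head x l'" using Fork.prems(1) t xy by auto
      then show ?thesis using tl[of l x] js[of l'] LR Fork.prems t by simp
    next
      case RL
      then have "ins j l' x = set_head x l" using Fork.prems(1) t xy by auto
      then show ?thesis using tl[of l' x] js[of l] RL Fork.prems t xy by simp
    qed
  qed
qed

lemma head_place: "j \<in> tips t \<Longrightarrow> i < j \<Longrightarrow> head (place i j t) = (if i < head t then i else head t)"
  by (induction t) auto

lemma mark_less_place: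
  assumes "mark_less t e" "\<not> i < head t" "j \<in> tips t" "i < j" shows "mark_less (place i j t) e"
  using assms by (cases t) auto

text \<open>Above the place of insertion the minimum of a right branch may drop to \<open>i\<close>,
  but the minimum to its left is below \<open>i\<close>, so the left-right order of the branches
  persists.\<close>

lemma place_props:
  assumes "valid t" "j \<in> tips t" "i < j" "i \<notin> tips t"
  shows "valid (place i j t) \<and> tips (place i j t) = insert i (tips t) \<and>
     marks (place i j t) = add_mset j (marks t) \<and> open_tips t \<subseteq> open_tips (place i j t) \<and>
     \<not> is_Tip (branch i (place i j t)) \<and> last (chain (branch i (place i j t))) = j"
  using assms
proof (induction t)
  case (Fork l e r)
  note v = valid_ForkD[OF Fork.prems(1)]
  have i: "i \<notin> tips l" "i \<notin> tips r" "i \<noteq> head l"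
    using Fork.prems by auto
  show ?case
  proof (cases "i < head l")
    case True
    then have "place i j (Fork l e r) = ins j (Fork l e r) i" by simp
    then show ?thesis using ins_props[OF Fork.prems(1,2), of i] True branch_head[of "ins j (Fork l e r) i"]
      by (metis head.simps(2) head_ins is_Tip_ins)
  next
    case False
    show ?thesis
    proof (cases "j \<in> tips l")
      case True
      note IH = Fork.IH(1)[OF v(1) True Fork.prems(3) i(1)]
      show ?thesis using IH v False True i mark_less_place[of l e i j]
          head_place[OF True Fork.prems(3)] Fork.prems(3) by auto
    next
      case j: False
      then have jr: "j \<in> tips r" using Fork.prems by auto
      note IH = Fork.IH(2)[OF v(2) jr Fork.prems(3) i(2)]
      show ?thesis using IH v False j jr i head_place[OF jr Fork.prems(3)] by auto
    qed
  qed
qed auto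

lemma place_inj:
  assumes "place i j s = place i j t" "valid s" "valid t" "j \<in> tips s" "j \<in> tips t"
    "i < j" "i \<notin> tips s" "i \<notin> tips t"
  shows "s = t"
  using assms
proof (induction s arbitrary: t)
  case (Tip a)
  have "head (place i j (Tip a)) = i" using head_place[of j "Tip a" i] Tip.prems(4,6) by simp
  then have "head (place i j t) = i" unfolding Tip.prems(1) .
  then have it: "i < head t" using head_place[of j t i] Tip.prems head_in_tips[of t] by (metis)
  then have "place i j t = ins j t i" by (cases t) auto
  then show ?case using ins_inj[of j "Tip a" i t i] Tip.prems it by auto
next
  case (Fork l e r)
  show ?case
  proof (cases "i < head l")
    case True
    then have "head (place i j t) = i" using Fork.prems(1) by (metis head_ins place.simps(2))
    then have it: "i < head t" using head_place[of j t i] Fork.prems head_in_tips[of t] by (metis)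
    then have "place i j t = ins j t i" by (cases t) auto
    then show ?thesis using ins_inj[of j "Fork l e r" i t i] Fork.prems it True by auto
  next
    case False
    have hl: "head l < i" using False Fork.prems(7) head_in_tips[of l] by (metis UnI1 linorder_neqE tips.simps(2))
    have "head (place i j t) = head l" using head_place[OF Fork.prems(4,6)] Fork.prems(1) False by simp
    then have it: "\<not> i < head t" using head_place[OF Fork.prems(5,6)] hl by auto
    then obtain l' e' r' where t: "t = Fork l' e' r'" using Fork.prems by (cases t) auto
    have tl: "tips (place i j l) = insert i (tips l)" if "j \<in> tips l" "valid l" "i \<notin> tips l" for l
      using place_props[of l j i] that Fork.prems by auto
    consider (L) "j \<in> tips l" "j \<in> tips l'" | (R) "j \<notin> tips l" "j \<notin> tips l'"
      | (LR) "j \<in> tips l" "j \<notin> tips l'" | (RL) "j \<notin> tips l" "j \<in> tips l'" by blast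
    then show ?thesis
    proof cases
      case L
      then show ?thesis using Fork.IH(1)[of l'] Fork.prems t it False by simp
    next
      case R
      then show ?thesis using Fork.IH(2)[of r'] Fork.prems t it False by simp
    next
      case LR
      then have "place i j l = l'" using Fork.prems(1) t it False by auto
      then show ?thesis using tl[of l] LR Fork.prems by auto
    next
      case RL
      then have "l = place i j l'" using Fork.prems(1) t it False by auto
      then show ?thesis using tl[of l'] RL Fork.prems t by auto
    qed
  qed
qed

text \<open>
  If \<open>e\<close> were the minimum of the right branch \<open>r\<close>, no other leaf of \<open>r\<close> could label an edge above
  \<open>r\<close>, so each of them labels an edge of \<open>r\<close>, and \<open>j\<close> labels two. That is one label too many.
\<close>

lemma marked_right_gt:
  assumes "valid (Fork l e r)"
    and G: "\<And>y. y \<in> tips r \<Longrightarrow> y \<noteq> head r \<Longrightarrow> y \<in># marks (Fork l e r) \<or> y \<in> open_tips (Fork l e r)"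
    and j: "j \<in> tips r" "j \<noteq> head r"
    and H: "2 \<le> count (marks (Fork l e r)) j + (if j \<in> open_tips (Fork l e r) then 1 else 0)"
  shows "e \<noteq> head r"
proof
  assume e: "e = head r"
  have v: "valid l" "valid r" "tips l \<inter> tips r = {}" using assms(1) by auto
  have nl: "y \<notin># marks l" if "y \<in> tips r" for y using marks_in_tips[OF v(1), of y] that v by auto
  have gt: "y \<notin> open_tips (Fork l e r)" if "y \<in> tips r" "y \<noteq> head r" for y
    using head_le[OF v(2) that(1)] that e by auto
  have "mset_set (tips r - {head r}) + {#j#} \<subseteq># marks r"
  proof (rule mset_subset_eqI)
    fix y
    show "count (mset_set (tips r - {head r}) + {#j#}) y \<le> count (marks r) y"
    proof (cases "y \<in> tips r \<and> y \<noteq> head r")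
      case True
      then have "y \<in># marks r" using G[of y] gt[of y] nl[of y] e by auto
      then have "Suc 0 \<le> count (marks r) y" by (simp add: Suc_le_eq)
      moreover have "2 \<le> count (marks r) y" if "y = j"
        using H gt[OF j] nl[OF j(1)] j e that by (auto simp: not_in_iff)
      ultimately show ?thesis using True by (auto split: if_splits)
    next
      case False
      then show ?thesis using j by (auto simp: count_mset_set')
    qed
  qed
  then have "card (tips r - {head r}) + 1 \<le> size (marks r)" using size_mset_mono by fastforce
  then show False using size_marks[OF v(2)] by (simp add: card_Diff_singleton)
qed

text \<open>Hands the number of uses of \<open>j\<close> down to the branch containing
  \<open>j\<close>, where an open leaf counts as one possible use above the branch.\<close>

lemma count_bound_transfer:
  "m \<le> count M j + (if P then 1 else 0) \<Longrightarrow> count M j = count N j \<Longrightarrow> (P \<Longrightarrow> Q) \<Longrightarrow>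
    m \<le> count N j + (if Q then 1 else 0)"
  by (auto split: if_splits)

text \<open>At each right step of the chain the minimum of the right branch returns to the left
  spine. A branch does not see the labels above it, so "labels an edge" is weakened to "labels an
  edge or is open", and one of the two uses of \<open>j\<close> may lie above; in this form the
  hypotheses are inherited by branches.\<close>

lemma unins:
  assumes "valid t" "\<not> is_Tip t" "j = last (chain t)"
    and "\<And>y. y \<in> tips t \<Longrightarrow> y \<noteq> head t \<Longrightarrow> y \<in># marks t \<or> y \<in> open_tips t"
    and "2 \<le> count (marks t) j + (if j \<in> open_tips t then 1 else 0)"
  shows "\<exists>s. valid s \<and> j \<in> tips s \<and> t = ins j s (head t) \<and> head t < head s \<and>
     open_tips t - {head t} \<subseteq> open_tips s"
  using assms
proof (induction t)
  case (Fork l e r)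
  note v = valid_ForkD[OF Fork.prems(1)]
  note G = Fork.prems(4) and H = Fork.prems(5)
  have er: "e \<in> tips r" using v open_tips_subset by blast
  have ml: "y \<notin># marks l" "y \<notin> open_tips l" "y \<notin> tips l" if "y \<in> tips r" for y
    using marks_in_tips[OF v(1), of y] that v open_tips_subset[of l] by auto
  have mr: "y \<notin># marks r" "y \<notin> open_tips r" "y \<noteq> e" if "y \<in> tips l" for y
    using marks_in_tips[OF v(2), of y] that v open_tips_subset[of r] er by auto
  show ?case
  proof (cases "\<not> is_Tip l \<and> chain l ! 1 < head r")
    case True
    then have j: "j = last (chain l)" using Fork.prems by auto
    have jl: "j \<in> tips l" using j last_chain_in_tips by auto
    have "y \<in># marks l \<or> y \<in> open_tips l" if "y \<in> tips l" "y \<noteq> head l" for y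
      using G[of y] that mr[of y] by auto
    moreover have "2 \<le> count (marks l) j + (if j \<in> open_tips l then 1 else 0)"
      using mr[OF jl] by (intro count_bound_transfer[OF H]) (auto simp: not_in_iff)
    ultimately obtain s where s: "valid s" "j \<in> tips s" "l = ins j s (head l)" "head l < head s"
      "open_tips l - {head l} \<subseteq> open_tips s"
      using Fork.IH(1)[OF v(1) _ j] True by blast
    note p = ins_props[OF s(1,2,4), folded s(3)]
    have "mark_less s e" using v(5) s(3) mark_less_insD by metis
    moreover have "head s < head r" using p True by simp
    moreover have "tips s \<inter> tips r = {}" using p v by auto
    ultimately have "valid (Fork s e r)" using s(1) v by simp
    moreover have "Fork l e r = ins j (Fork s e r) (head (Fork l e r))" using s(2,3) by simp
    moreover have "open_tips (Fork l e r) - {head (Fork l e r)} \<subseteq> open_tips (Fork s e r)" using s(5) by auto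
    moreover have "j \<in> tips (Fork s e r)" "head (Fork l e r) < head (Fork s e r)" using s(2,4) by auto
    ultimately show ?thesis by blast
  next
    case False
    then have j: "j = last (chain r)" using Fork.prems by auto
    have jr: "j \<in> tips r" using j last_chain_in_tips by auto
    show ?thesis
    proof (cases r)
      case (Tip x)
      then have c: "\<not> (\<not> is_Tip l \<and> chain l ! 1 < x)" "x = j" using False j by auto
      then obtain y where l: "l = Tip y" "e = x" using cherry_at_right_tip Fork.prems(1) unfolding Tip by blast
      then have x: "x = j" "e = j" using c by simp_all
      show ?thesis using l Tip x v(4) by (intro exI[of _ "Tip j"]) auto
    next
      case (Fork l1 e1 r1)
      then have tr: "\<not> is_Tip r" by auto
      have jm: "j \<in># marks r" using last_chain_marked[OF v(2) tr] j by auto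
      have jh: "j \<noteq> head r" using marks_neq_head[OF v(2) jm] by auto
      \<comment> \<open>\<open>head r\<close> is about to leave \<open>r\<close>, whereas the label
        \<open>e\<close> has to remain a leaf of the right branch.\<close>
      have eh: "e \<noteq> head r" using marked_right_gt[OF Fork.prems(1) _ jr jh H] G head_notin_right[OF Fork.prems(1)]
        by (metis UnI2 head.simps(2) tips.simps(2))
      have "y \<in># marks r \<or> y \<in> open_tips r" if "y \<in> tips r" "y \<noteq> head r" for y
      proof -
        have "y \<noteq> head l" using that head_notin_right[OF Fork.prems(1)] by auto
        then show ?thesis using G[of y] that ml[of y] v(6) by auto
      qed
      \<comment> \<open>If \<open>e = j\<close>, the use of \<open>j\<close> at this fork is
        replaced by \<open>j\<close> being open in \<open>r\<close>.\<close>
      moreover have "2 \<le> count (marks r) j + (if j \<in> open_tips r then 1 else 0)"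
      proof (cases "e = j")
        case True
        have "Suc 0 \<le> count (marks r) j" using jm by (simp only: Suc_le_eq count_greater_zero_iff)
        then show ?thesis using True v(6) by simp
      next
        case False
        then show ?thesis using ml[OF jr] by (intro count_bound_transfer[OF H]) (auto simp: not_in_iff)
      qed
      ultimately obtain s where s: "valid s" "j \<in> tips s" "r = ins j s (head r)" "head r < head s"
        "open_tips r - {head r} \<subseteq> open_tips s"
        using Fork.IH(2)[OF v(2) tr j] by blast
      note p = ins_props[OF s(1,2,4), folded s(3)]
      let ?l = "set_head (head r) l"
      have hs: "head r \<notin> tips s" using head_le[OF s(1)] s(4) by fastforce
      \<comment> \<open>The chain went to the right, so the second smallest leaf of \<open>l\<close>
        exceeds \<open>head r\<close>, which can therefore serve as the minimum of the left
        branch.\<close>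
      have "head r < y" if "y \<in> tips l" "y \<noteq> head l" for y
      proof -
        have "\<not> is_Tip l" using that by (cases l) auto
        then have "head r \<le> chain l ! 1" "chain l ! 1 \<le> y" using False chain_second[OF v(1) _ that] by auto
        moreover have "y \<noteq> head r" using that v(3) head_in_tips[of r] by auto
        ultimately show ?thesis by simp
      qed
      then have vl: "valid ?l" using valid_set_head[OF v(1)] by blast
      have tls: "tips ?l \<inter> tips s = {}" using p v hs by (auto simp: tips_set_head)
      have "e \<in> open_tips s" using s(5) v(6) eh by blast
      then have "valid (Fork ?l e s)" using vl s(1,4) tls v(5) by simp
      moreover have "j \<notin> tips ?l" using tls s(2) by blast
      then have "Fork l e r = ins j (Fork ?l e s) (head (Fork l e r))" using s(3) by simp
      moreover have "open_tips (Fork l e r) - {head (Fork l e r)} \<subseteq> open_tips (Fork ?l e s)"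
      proof
        fix y assume y: "y \<in> open_tips (Fork l e r) - {head (Fork l e r)}"
        have "head r \<in> open_tips ?l" using head_open[OF vl] by simp
        then show "y \<in> open_tips (Fork ?l e s)" using y open_set_head[of l "head r"] s(5) by (cases "y = head r") auto
      qed
      moreover have "j \<in> tips (Fork ?l e s)" "head (Fork l e r) < head (Fork ?l e s)" using s(2) v(4) by auto
      ultimately show ?thesis by blast
    qed
  qed
qed auto

text \<open>Only leaves above \<open>i\<close> are known to have labels, which is enough inside the
  largest branch with minimum \<open>i\<close>. In the forks above it \<open>i\<close> can be
  removed without harm, since it is not the label of any of them.\<close>

lemma unplace:
  assumes "valid t" "i \<in> tips t" "\<not> is_Tip (branch i t)" "j = last (chain (branch i t))"
    and "i \<notin># marks t"
    and "\<And>y. y \<in> tips t \<Longrightarrow> i < y \<Longrightarrow> y \<in># marks t \<or> y \<in> open_tips t"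
    and "2 \<le> count (marks t) j + (if j \<in> open_tips t then 1 else 0)"
  shows "\<exists>s. valid s \<and> j \<in> tips s \<and> i \<notin> tips s \<and> i < j \<and> t = place i j s \<and>
     open_tips t - {i} \<subseteq> open_tips s"
  using assms
proof (induction t)
  case (Fork l e r)
  note v = valid_ForkD[OF Fork.prems(1)]
  note G = Fork.prems(6) and H = Fork.prems(7)
  have er: "e \<in> tips r" using v open_tips_subset by blast
  have ml: "y \<notin># marks l" "y \<notin> open_tips l" "y \<notin> tips l" if "y \<in> tips r" for y
    using marks_in_tips[OF v(1), of y] that v open_tips_subset[of l] by auto
  have mr: "y \<notin># marks r" "y \<notin> open_tips r" "y \<noteq> e" if "y \<in> tips l" for y
    using marks_in_tips[OF v(2), of y] that v open_tips_subset[of r] er by auto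
  show ?case
  proof (cases "head l = i")
    case True
    have b: "branch i (Fork l e r) = Fork l e r" using True by simp
    have jt: "\<not> is_Tip (Fork l e r)" "j = last (chain (Fork l e r))" using Fork.prems(4) unfolding b by simp_all
    have "i < y" if "y \<in> tips (Fork l e r)" "y \<noteq> head (Fork l e r)" for y
      using head_le[OF Fork.prems(1) that(1)] that True by auto
    then obtain s where s: "valid s" "j \<in> tips s" "Fork l e r = ins j s (head (Fork l e r))"
      "head (Fork l e r) < head s" "open_tips (Fork l e r) - {head (Fork l e r)} \<subseteq> open_tips s"
      using unins[OF Fork.prems(1) jt _ H] G by blast
    have "i < head s" using s(4) True by simp
    moreover from this have "place i j s = ins j s i" by (cases s) simp_all
    moreover have "i \<notin> tips s" "i < j"
      using head_le[OF s(1), of i] head_le[OF s(1,2)] \<open>i < head s\<close> by auto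
    ultimately have "place i j s = ins j s i" "i \<notin> tips s" "i < j" by blast+
    then show ?thesis using s True by auto
  next
    case False
    show ?thesis
    proof (cases "i \<in> tips l")
      case True
      have b: "branch i (Fork l e r) = branch i l" using True False by simp
      have nt: "\<not> is_Tip (branch i l)" "j = last (chain (branch i l))" using Fork.prems(3,4) unfolding b by blast+
      have jl: "j \<in> tips l" unfolding nt(2) using last_chain_in_tips[of "branch i l"] tips_branch[of i l] by (rule rev_subsetD)
      have "y \<in># marks l \<or> y \<in> open_tips l" if "y \<in> tips l" "i < y" for y
        using G[of y] that mr[of y] by auto
      moreover have "2 \<le> count (marks l) j + (if j \<in> open_tips l then 1 else 0)"
        using mr[OF jl] by (intro count_bound_transfer[OF H]) (auto simp: not_in_iff)
      moreover have "i \<notin># marks l" using Fork.prems(5) by simp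
      ultimately obtain s where s: "valid s" "j \<in> tips s" "i \<notin> tips s" "i < j" "l = place i j s"
        "open_tips l - {i} \<subseteq> open_tips s"
        using Fork.IH(1)[OF v(1) True nt] by blast
      have hs: "head l = head s" "\<not> i < head s" using head_place[OF s(2,4)] s(5) False by (auto split: if_splits)
      note p = place_props[OF s(1,2,4,3), folded s(5)]
      have "mark_less s e" using v(5) s(2,5) hs(2) by (cases s) (auto split: if_splits)
      then have "valid (Fork s e r)" using s(1) v p hs by auto
      moreover have "Fork l e r = place i j (Fork s e r)" using s(2,5) hs(2) by simp
      moreover have "open_tips (Fork l e r) - {i} \<subseteq> open_tips (Fork s e r)" using s(6) by auto
      moreover have "j \<in> tips (Fork s e r)" "i \<notin> tips (Fork s e r)" using s(2,3) True v(3) by auto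
      ultimately show ?thesis using s(4) by blast
    next
      case nl: False
      then have ir: "i \<in> tips r" using Fork.prems by auto
      have b: "branch i (Fork l e r) = branch i r" using nl False by simp
      have nt: "\<not> is_Tip (branch i r)" "j = last (chain (branch i r))" using Fork.prems(3,4) unfolding b by blast+
      have jm: "j \<in># marks r" using last_chain_marked[OF valid_branch[OF v(2)] nt(1)] marks_branch[of i r]
        unfolding nt(2) by (rule mset_subset_eqD[rotated])
      have jr: "j \<in> tips r" unfolding nt(2) using last_chain_in_tips[of "branch i r"] tips_branch[of i r] by (rule rev_subsetD)
      have "y \<in># marks r \<or> y \<in> open_tips r" if "y \<in> tips r" "i < y" for y
        using G[of y] that ml[of y] v(6) by auto
      moreover have "2 \<le> count (marks r) j + (if j \<in> open_tips r then 1 else 0)"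
      proof (cases "e = j")
        case True
        have "Suc 0 \<le> count (marks r) j" using jm by (simp only: Suc_le_eq count_greater_zero_iff)
        then show ?thesis using True v(6) by simp
      next
        case False
        then show ?thesis using ml[OF jr] by (intro count_bound_transfer[OF H]) (auto simp: not_in_iff)
      qed
      moreover have "i \<notin># marks r" "e \<noteq> i" using Fork.prems(5) by auto
      ultimately obtain s where s: "valid s" "j \<in> tips s" "i \<notin> tips s" "i < j" "r = place i j s"
        "open_tips r - {i} \<subseteq> open_tips s"
        using Fork.IH(2)[OF v(2) ir nt] by blast
      note p = place_props[OF s(1,2,4,3), folded s(5)]
      have hr: "head l < i" "head r \<le> head s"
        using v(4) head_le[OF v(2) ir] head_place[OF s(2,4)] s(5) by (auto split: if_splits)
      have jl: "j \<notin> tips l" using jr v(3) by auto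
      have "e \<in> open_tips s" using s(6) v(6) \<open>e \<noteq> i\<close> by blast
      then have "valid (Fork l e s)" using s(1) v p hr by auto
      moreover have "Fork l e r = place i j (Fork l e s)" using s(5) less_not_sym[OF hr(1)] jl by simp
      moreover have "open_tips (Fork l e r) - {i} \<subseteq> open_tips (Fork l e s)" using s(6) by auto
      moreover have "j \<in> tips (Fork l e s)" "i \<notin> tips (Fork l e s)" using s(2,3) nl by auto
      ultimately show ?thesis using s(4) by blast
    qed
  qed
qed auto

section \<open>Clusters and paths\<close>

definition disjoint_tree :: "'a tree \<Rightarrow> bool" where
  "disjoint_tree T \<longleftrightarrow> (\<forall>ts. Node ts \<in> subtrees T \<longrightarrow>
     (\<forall>s \<in> fset ts. \<forall>t \<in> fset ts. s \<noteq> t \<longrightarrow> leaves s \<inter> leaves t = {}))"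

definition branching_tree :: "'a tree \<Rightarrow> bool" where
  "branching_tree T \<longleftrightarrow> (\<forall>ts. Node ts \<in> subtrees T \<longrightarrow> 2 \<le> fcard ts)"

text \<open>The names of the edges above the non-leaf vertices; the set of all leaves stands for the
  edge at the leaf a.\<close>

primrec clusters :: "'a tree \<Rightarrow> 'a set set" where
  "clusters (Leaf x) = {}"
| "clusters (Node ts) = insert (leaves (Node ts)) (\<Union> (fset (clusters |`| ts)))"

lemma disjoint_tree_Leaf [simp]: "disjoint_tree (Leaf x)"
  by (simp add: disjoint_tree_def)

lemma disjoint_tree_Node:
  "disjoint_tree (Node ts) \<longleftrightarrow>
     (\<forall>s \<in> fset ts. \<forall>t \<in> fset ts. s \<noteq> t \<longrightarrow> leaves s \<inter> leaves t = {}) \<and> (\<forall>t \<in> fset ts. disjoint_tree t)"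
  unfolding disjoint_tree_def by (auto; blast)

lemma branching_tree_Leaf [simp]: "branching_tree (Leaf x)"
  by (simp add: branching_tree_def)

lemma branching_tree_Node:
  "branching_tree (Node ts) \<longleftrightarrow> 2 \<le> fcard ts \<and> (\<forall>t \<in> fset ts. branching_tree t)"
  unfolding branching_tree_def by auto

lemma finite_leaves [simp]: "finite (leaves T)"
  by (induction T) auto

lemma branching_leaves_ne: "branching_tree T \<Longrightarrow> leaves T \<noteq> {}"
proof (induction T)
  case (Node ts)
  then have "ts \<noteq> {||}" by (auto simp: branching_tree_Node fcard.rep_eq)
  then obtain t where "t \<in> fset ts" by auto
  then show ?case using Node by (auto simp: branching_tree_Node)
qed auto

lemma child_unique:
  "disjoint_tree (Node ts) \<Longrightarrow> s \<in> fset ts \<Longrightarrow> t \<in> fset ts \<Longrightarrow> x \<in> leaves s \<Longrightarrow> x \<in> leaves t \<Longrightarrow> s = t"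
  by (auto simp: disjoint_tree_Node)

section \<open>Paths as descending families of clusters\<close>

lemma is_path_leaf: "is_path x T p \<Longrightarrow> x \<in> leaves T"
  by (induction rule: is_path.induct) force+

lemma is_path_hd: "is_path x T p \<Longrightarrow> p \<noteq> [] \<and> hd p = T \<and> (\<exists>ts. T = Node ts)"
  by (induction rule: is_path.induct) auto

lemma is_path_unique: "is_path x T p \<Longrightarrow> disjoint_tree T \<Longrightarrow> is_path x T q \<Longrightarrow> p = q"
proof (induction arbitrary: q rule: is_path.induct)
  case (1 x ts)
  from 1(3) show ?case
  proof cases
    case (2 t p)
    then have "t = Leaf x" using child_unique[OF 1(2), of t "Leaf x" x] 1(1) is_path_leaf by fastforce
    then show ?thesis using 2(3) is_path_hd by fastforce
  qed auto
next
  case (2 t ts x p)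
  from 2(5) show ?case
  proof cases
    case 1
    then have "t = Leaf x" using child_unique[OF 2(4), of t "Leaf x" x] 2(1) is_path_leaf[OF 2(2)] by fastforce
    then show ?thesis using 2(2) is_path_hd by fastforce
  next
    case t': (2 t' p')
    then have "t' = t" using child_unique[OF 2(4), of t t' x] 2(1) is_path_leaf[OF 2(2)] is_path_leaf by fastforce
    then show ?thesis using 2 t' by (auto simp: disjoint_tree_Node)
  qed
qed

lemma path_eqI: "disjoint_tree T \<Longrightarrow> is_path x T p \<Longrightarrow> path T x = p"
  unfolding path_def using is_path_unique by (metis the_equality)

lemma is_path_ex: "x \<in> leaves (Node ts) \<Longrightarrow> \<exists>p. is_path x (Node ts) p"
proof (induction "Node ts" arbitrary: ts)
  case (Node ts)
  then obtain t where t: "t \<in> fset ts" "x \<in> leaves t" by auto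
  show ?case
  proof (cases t)
    case (Leaf y)
    then show ?thesis using t is_path.intros(1) by fastforce
  next
    case n: (Node us)
    then obtain p where "is_path x t p" using Node.hyps[of us] t by auto
    then show ?thesis using t is_path.intros(2) by fastforce
  qed
qed

lemma is_path_path: "disjoint_tree (Node ts) \<Longrightarrow> x \<in> leaves (Node ts) \<Longrightarrow> is_path x (Node ts) (path (Node ts) x)"
  using is_path_ex path_eqI by metis

lemma path_Node_Leaf:
  "disjoint_tree (Node ts) \<Longrightarrow> Leaf x \<in> fset ts \<Longrightarrow> path (Node ts) x = [Node ts]"
  by (simp add: is_path.intros(1) path_eqI)

lemma path_Node_Node:
  assumes "disjoint_tree (Node ts)" "Node us \<in> fset ts" "x \<in> leaves (Node us)"
  shows "path (Node ts) x = Node ts # path (Node us) x"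
proof -
  have "disjoint_tree (Node us)" using assms(1,2) unfolding disjoint_tree_Node[of ts] by blast
  then have "is_path x (Node us) (path (Node us) x)" by (rule is_path_path[OF _ assms(3)])
  then show ?thesis by (rule path_eqI[OF assms(1) is_path.intros(2)[OF assms(2)]])
qed

lemma hd_path:
  assumes "disjoint_tree (Node ts)" "x \<in> leaves (Node ts)"
  shows "path (Node ts) x = Node ts # tl (path (Node ts) x)"
  using is_path_hd[OF is_path_path[OF assms]] by (metis list.collapse)

lemma clusters_subset: "E \<in> clusters T \<Longrightarrow> E \<subseteq> leaves T"
  by (induction T) fastforce+

lemma leaves_psubset:
  assumes "disjoint_tree (Node ts)" "branching_tree (Node ts)" "t \<in> fset ts"
  shows "leaves t \<subset> leaves (Node ts)"
proof -
  have "\<exists>s \<in> fset ts. s \<noteq> t"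
  proof (rule ccontr)
    assume "\<not> ?thesis"
    then have "fset ts = {t}" using assms(3) by blast
    then have "fcard ts = 1" by (simp add: fcard.rep_eq)
    then show False using assms(2) by (simp add: branching_tree_Node)
  qed
  then obtain s where s: "s \<in> fset ts" "s \<noteq> t" by auto
  then have "leaves s \<noteq> {}" "leaves s \<inter> leaves t = {}"
    using assms branching_leaves_ne[of s] by (simp_all add: branching_tree_Node disjoint_tree_Node)
  then show ?thesis using s assms(3) by auto
qed

text \<open>Replaces a path by the family of clusters through its end, which no longer refers to the
  recursive structure. Branching makes the inclusions strict.\<close>

lemma path_clusters:
  assumes "disjoint_tree T" "branching_tree T" "x \<in> leaves T" "T = Node ts"
  shows "sorted_wrt (\<supset>) (map leaves (path T x)) \<and> set (map leaves (path T x)) = {E \<in> clusters T. x \<in> E}"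
  using assms
proof (induction T arbitrary: ts)
  case (Node us)
  then have us: "ts = us" by simp
  obtain t where t: "t \<in> fset us" "x \<in> leaves t" using Node.prems(3) by auto
  have "x \<notin> E" if "s \<in> fset us" "s \<noteq> t" "E \<in> clusters s" for s E
    using child_unique[OF Node.prems(1) that(1) t(1), of x] that clusters_subset t(2) by blast
  then have cl: "{E \<in> clusters (Node us). x \<in> E} = insert (leaves (Node us)) {E \<in> clusters t. x \<in> E}"
    using t Node.prems(3) by auto
  show ?case
  proof (cases t)
    case (Leaf y)
    then show ?thesis using cl t path_Node_Leaf[OF Node.prems(1)] by simp
  next
    case n: (Node vs)
    have p: "path (Node us) x = Node us # path t x" using path_Node_Node Node.prems(1) t n by metis
    have "disjoint_tree t" "branching_tree t"
      using Node.prems(1,2) t by (auto simp: disjoint_tree_Node branching_tree_Node)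
    then have IH: "sorted_wrt (\<supset>) (map leaves (path t x))" "set (map leaves (path t x)) = {E \<in> clusters t. x \<in> E}"
      using Node.IH[OF t(1) _ _ t(2) n] by auto
    have "E \<subset> leaves (Node us)" if "E \<in> clusters t" for E
      using leaves_psubset[OF Node.prems(1,2) t(1)] clusters_subset[OF that] by auto
    then show ?thesis using IH cl p by auto
  qed
qed auto

section \<open>Contraction of edges\<close>

lemma in_ffUnion [simp]: "x |\<in>| ffUnion A \<longleftrightarrow> (\<exists>S. S |\<in>| A \<and> x |\<in>| S)"
  by (induction A) auto

lemma fset_ffUnion: "fset (ffUnion (f |`| ts)) = (\<Union>t\<in>fset ts. fset (f t))"
  by (simp add: ffUnion.rep_eq)

lemma leaves_splice: "\<Union> (leaves ` fset (splice C t)) = leaves t"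
proof (induction t)
  case (Node ts)
  have "\<Union> (leaves ` fset (ffUnion (splice C |`| ts))) = (\<Union>t\<in>fset ts. \<Union> (leaves ` fset (splice C t)))"
    unfolding fset_ffUnion by blast
  also have "\<dots> = leaves (Node ts)" using Node by auto
  finally show ?case by (auto simp: Let_def)
qed auto

lemma leaves_contract: "leaves (contract C T) = leaves T"
proof (cases T)
  case (Node ts)
  have "leaves (contract C T) = (\<Union>t\<in>fset ts. \<Union> (leaves ` fset (splice C t)))"
    unfolding Node contract.simps tree.set fset_ffUnion by blast
  then show ?thesis using Node by (simp add: leaves_splice)
qed auto

lemma splice_Node:
  "splice C (Node ts) = (if leaves (Node ts) \<in> C then ffUnion (splice C |`| ts) else {|contract C (Node ts)|})"
  by (simp add: Let_def)

lemma in_splice_leaves: "s \<in> fset (splice C t) \<Longrightarrow> leaves s \<subseteq> leaves t"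
  using leaves_splice[of C t] by auto

lemma disjoint_contract: "disjoint_tree T \<Longrightarrow> disjoint_tree (contract C T)"
proof (induction T)
  case (Node ts)
  have sp: "(\<forall>s \<in> fset (splice C t). \<forall>s' \<in> fset (splice C t). s \<noteq> s' \<longrightarrow> leaves s \<inter> leaves s' = {}) \<and>
     (\<forall>s \<in> fset (splice C t). disjoint_tree s)" if t: "t \<in> fset ts" for t
  proof (cases t)
    case n: (Node us)
    have "disjoint_tree (contract C t)" using Node t by (simp add: disjoint_tree_Node)
    then show ?thesis unfolding n splice_Node by (auto simp: disjoint_tree_Node n)
  qed auto
  have "leaves s \<inter> leaves s' = {}"
    if "s \<in> fset (splice C t)" "s' \<in> fset (splice C t')" "s \<noteq> s'" "t \<in> fset ts" "t' \<in> fset ts" for s s' t t'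
  proof (cases "t = t'")
    case False
    then have "leaves t \<inter> leaves t' = {}" using Node.prems that unfolding disjoint_tree_Node[of ts] by blast
    then show ?thesis using in_splice_leaves that by blast
  qed (use sp that in blast)
  then have "\<forall>s \<in> fset (ffUnion (splice C |`| ts)). \<forall>t \<in> fset (ffUnion (splice C |`| ts)).
      s \<noteq> t \<longrightarrow> leaves s \<inter> leaves t = {}" unfolding fset_ffUnion by blast
  moreover have "\<forall>t \<in> fset (ffUnion (splice C |`| ts)). disjoint_tree t" unfolding fset_ffUnion using sp by blast
  ultimately show ?case by (simp only: contract.simps disjoint_tree_Node)
qed auto

lemma is_path_mono:
  assumes "is_path x (Node us) p" "fset us \<subseteq> fset vs" shows "is_path x (Node vs) (Node vs # tl p)"
  using assms(1)
proof cases
  case 1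
  then show ?thesis using assms(2) is_path.intros(1)[of x vs] by auto
next
  case (2 t p)
  then show ?thesis using assms(2) is_path.intros(2)[of t vs] by auto
qed

text \<open>The top vertex is exempt from the filter because \<open>contract\<close> never dissolves
  the root.\<close>

lemma path_contract:
  assumes "disjoint_tree T" "x \<in> leaves T" "T = Node ts"
  shows "map leaves (path (contract C T) x) = leaves T # filter (\<lambda>E. E \<notin> C) (tl (map leaves (path T x)))"
  using assms
proof (induction T arbitrary: ts)
  case (Node us)
  obtain t where t: "t \<in> fset us" "x \<in> leaves t" using Node.prems(2) by auto
  have dc: "disjoint_tree (contract C (Node us))" by (rule disjoint_contract[OF Node.prems(1)])
  show ?case
  proof (cases t)
    case (Leaf y)
    then have x: "Leaf x \<in> fset us" using t by auto
    then have "Leaf x |\<in>| ffUnion (splice C |`| us)" by force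
    then have "path (contract C (Node us)) x = [contract C (Node us)]"
      using path_Node_Leaf[of "ffUnion (splice C |`| us)" x] dc by (simp del: in_ffUnion)
    then show ?thesis using x path_Node_Leaf[OF Node.prems(1)] leaves_contract[of C "Node us"]
      by (simp del: contract.simps)
  next
    case n: (Node vs)
    have p: "path (Node us) x = Node us # path t x" using path_Node_Node Node.prems(1) t n by metis
    have dt: "disjoint_tree t" using Node.prems(1) t by (auto simp: disjoint_tree_Node)
    have IH: "map leaves (path (contract C t) x) = leaves t # filter (\<lambda>E. E \<notin> C) (tl (map leaves (path t x)))"
      using Node.IH[OF t(1) dt t(2) n] .
    have ip: "is_path x (contract C t) (path (contract C t) x)"
      using disjoint_contract[OF dt, of C] t(2)[folded leaves_contract[of C t]]
      unfolding n contract.simps by (rule is_path_path)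
    have pt: "map leaves (path t x) = leaves t # tl (map leaves (path t x))"
      using hd_path[of vs x] dt t(2) n by (metis list.map(2) list.sel(3))
    show ?thesis
    proof (cases "leaves t \<in> C")
      case True
      \<comment> \<open>When the edge above \<open>t\<close> is contracted, the children of
        \<open>t\<close> become children of the root, and the path inside \<open>t\<close> continues
        from the root.\<close>
      have "fset (ffUnion (splice C |`| vs)) \<subseteq> fset (ffUnion (splice C |`| us))"
      proof -
        have "fset (splice C t) \<subseteq> fset (ffUnion (splice C |`| us))" using t(1) unfolding fset_ffUnion by blast
        then show ?thesis using True n splice_Node[of C vs] by (simp only: if_True)
      qed
      then have "is_path x (contract C (Node us)) (contract C (Node us) # tl (path (contract C t) x))"
        using is_path_mono[OF ip[unfolded n contract.simps]] n by (simp only: contract.simps)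
      then have pc: "path (contract C (Node us)) x = contract C (Node us) # tl (path (contract C t) x)"
        by (rule path_eqI[OF dc])
      have "map leaves (tl (path (contract C t) x)) = filter (\<lambda>E. E \<notin> C) (tl (map leaves (path t x)))"
        using IH by (metis list.sel(3) map_tl)
      moreover have "filter (\<lambda>E. E \<notin> C) (map leaves (path t x)) = filter (\<lambda>E. E \<notin> C) (tl (map leaves (path t x)))"
        using True by (subst pt) simp
      ultimately show ?thesis using leaves_contract[of C "Node us"] by (simp add: pc p del: contract.simps)
    next
      case False
      have "contract C t |\<in>| splice C t" using False n splice_Node[of C vs] by simp
      then have "contract C t |\<in>| ffUnion (splice C |`| us)" using t(1) unfolding fset_ffUnion by blast
      then have "is_path x (contract C (Node us)) (contract C (Node us) # path (contract C t) x)"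
        using is_path.intros(2) ip by (simp only: contract.simps)
      then have pc: "path (contract C (Node us)) x = contract C (Node us) # path (contract C t) x"
        by (rule path_eqI[OF dc])
      have "filter (\<lambda>E. E \<notin> C) (map leaves (path t x)) = leaves t # filter (\<lambda>E. E \<notin> C) (tl (map leaves (path t x)))"
        using False by (subst pt) simp
      then show ?thesis using IH leaves_contract[of C "Node us"] by (simp add: pc p del: contract.simps)
    qed
  qed
qed auto

text \<open>Turns the union in \<open>min_off\<close> into a difference of consecutive clusters;
  after the last vertex the leaf itself plays the part of the next cluster.\<close>

lemma off_leaves:
  assumes "is_path x T p" "disjoint_tree T" "i < length p"
  shows "\<Union> {leaves t |t. t \<in> children (p ! i) \<and> x \<notin> leaves t} =
     leaves (p ! i) - (if Suc i < length p then leaves (p ! Suc i) else {x})"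
  using assms
proof (induction arbitrary: i rule: is_path.induct)
  case (1 x ts)
  have u: "t = Leaf x" if "t \<in> fset ts" "x \<in> leaves t" for t
    using child_unique[OF 1(2) that(1) 1(1) that(2)] by simp
  have "\<Union> {leaves t |t. t \<in> fset ts \<and> x \<notin> leaves t} = (\<Union>s\<in>fset ts. leaves s) - {x}"
  proof (intro set_eqI iffI)
    fix y assume "y \<in> (\<Union>s\<in>fset ts. leaves s) - {x}"
    then obtain s where s: "s \<in> fset ts" "y \<in> leaves s" "y \<noteq> x" by blast
    then have "x \<notin> leaves s" using u[OF s(1)] by fastforce
    then show "y \<in> \<Union> {leaves t |t. t \<in> fset ts \<and> x \<notin> leaves t}" using s by blast
  qed blast
  then show ?case using 1(3) by simp
next
  case (2 t ts x p)
  show ?case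
  proof (cases i)
    case 0
    have p0: "p ! 0 = t" "p \<noteq> []" using is_path_hd[OF 2(2)] by (auto simp: hd_conv_nth)
    have xt: "x \<in> leaves t" using is_path_leaf[OF 2(2)] .
    have u: "s = t" if "s \<in> fset ts" "y \<in> leaves s" "y \<in> leaves t" for s y
      using child_unique[OF 2(4) that(1) _ that(2,3)] 2(1) by auto
    have "\<Union> {leaves s |s. s \<in> fset ts \<and> x \<notin> leaves s} = (\<Union>s\<in>fset ts. leaves s) - leaves t"
    proof (intro set_eqI iffI)
      fix y assume "y \<in> \<Union> {leaves s |s. s \<in> fset ts \<and> x \<notin> leaves s}"
      then obtain s where "s \<in> fset ts" "x \<notin> leaves s" "y \<in> leaves s" by auto
      then show "y \<in> (\<Union>s\<in>fset ts. leaves s) - leaves t" using u[of s y] xt by auto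
    next
      fix y assume "y \<in> (\<Union>s\<in>fset ts. leaves s) - leaves t"
      then obtain s where "s \<in> fset ts" "y \<in> leaves s" "y \<notin> leaves t" by auto
      then show "y \<in> \<Union> {leaves s |s. s \<in> fset ts \<and> x \<notin> leaves s}" using u[of s x] xt by blast
    qed
    then show ?thesis using 0 p0 by simp
  next
    case (Suc k)
    have "disjoint_tree t" using 2(1,4) by (simp add: disjoint_tree_Node)
    then show ?thesis using 2(3)[of k] 2(5) Suc by simp
  qed
qed

section \<open>Slide labelings as static conditions\<close>

definition open_clusters :: "'a tree \<Rightarrow> 'a \<Rightarrow> ('a set \<Rightarrow> 'b option) \<Rightarrow> 'a set set" where
  "open_clusters T l L = {E \<in> clusters T. l \<in> E \<and> E \<notin> dom L}"

text \<open>For the unlabelled clusters through a leaf \<open>l\<close> these two name the vertices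
  \<open>v\<^sub>l\<close> and \<open>v\<close> of a slide step.\<close>

definition bottom_two :: "'a set set \<Rightarrow> 'a set \<Rightarrow> 'a set \<Rightarrow> bool" where
  "bottom_two U E F \<longleftrightarrow> E \<in> U \<and> F \<in> U \<and> E \<subset> F \<and> (\<forall>G \<in> U. G = E \<or> F \<subseteq> G)"

lemma bottom_two_unique:
  assumes "bottom_two U E F" "bottom_two U E' F'" shows "E = E' \<and> F = F'"
proof -
  note d = assms[unfolded bottom_two_def]
  have "E = E' \<or> F' \<subseteq> E" "E' = E \<or> F \<subseteq> E'" using d by meson+
  then have E: "E = E'" using d by (meson psubset_subset_trans psubset_trans order.asym)
  then have "F' \<subseteq> F" "F \<subseteq> F'" using d by (metis psubset_eq)+
  then show ?thesis using E by simp
qed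

lemma bottom_two_list:
  assumes "sorted_wrt (\<supset>) Q" "2 \<le> length Q"
  shows "bottom_two (set Q) (last Q) (Q ! (length Q - 2))"
proof -
  obtain Q1 E where Q1: "Q = Q1 @ [E]" using assms(2) by (cases Q rule: rev_cases) auto
  obtain Q2 F where Q2: "Q1 = Q2 @ [F]" using assms(2) Q1 by (cases Q1 rule: rev_cases) auto
  have "Q ! (length Q - 2) = F" using Q1 Q2 by (simp add: nth_append)
  then show ?thesis using assms(1) Q1 Q2 unfolding bottom_two_def by (auto simp: sorted_wrt_append)
qed

locale proper_tree =
  fixes T :: ltree and ts
  assumes T: "T = Node ts" and disjoint: "disjoint_tree T" and branching: "branching_tree T"
begin

lemma top_cluster: "leaves T \<in> clusters T"
  using T by simp

lemma unlabelled_path: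
  assumes "l \<in> leaves T" "leaves T \<notin> dom L"
  shows "map leaves (path (contract (dom L) T) l) = filter (\<lambda>E. E \<notin> dom L) (map leaves (path T l))"
proof -
  have "map leaves (path T l) = leaves T # tl (map leaves (path T l))"
    using hd_path[of ts l] disjoint assms(1) T by (metis list.map(2) list.sel(3))
  then show ?thesis using path_contract[OF disjoint assms(1) T, of "dom L"] assms(2)
    by (metis filter.simps(2))
qed

lemma unlabelled_path_sorted:
  assumes "l \<in> leaves T" "leaves T \<notin> dom L"
  defines "Q \<equiv> map leaves (path (contract (dom L) T) l)"
  shows "sorted_wrt (\<supset>) Q" "set Q = open_clusters T l L"
  using path_clusters[OF disjoint branching assms(1) T] unfolding Q_def unlabelled_path[OF assms(1,2)]
  by (auto intro: sorted_wrt_filter simp: open_clusters_def)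

text \<open>The contracted tree enters a slide step only through its two lowest clusters containing
  \<open>l\<close>: the branches away from a and \<open>l\<close> at the two vertices fill
  \<open>E - {l}\<close> and \<open>F - E\<close>.\<close>

lemma slide_step_bottom_two:
  assumes "l \<in> leaves T" "leaves T \<notin> dom L" "bottom_two (open_clusters T l L) E F"
  shows "slide_step T l L =
    (if Min (E - {l}) \<le> l \<and> Min (F - E) \<le> Min (E - {l}) then Some (L(E \<mapsto> l)) else None)"
proof -
  define p where "p = path (contract (dom L) T) l"
  define Q where "Q = map leaves p"
  have Q: "sorted_wrt (\<supset>) Q" "set Q = open_clusters T l L"
    using unlabelled_path_sorted[OF assms(1,2)] unfolding Q_def p_def by auto
  have len: "2 \<le> length Q"
  proof -
    have "{E, F} \<subseteq> set Q" using assms(3) unfolding Q(2) bottom_two_def by simp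
    then have "card {E, F} \<le> card (set Q)" by (intro card_mono) simp_all
    moreover have "E \<noteq> F" using assms(3) unfolding bottom_two_def by blast
    then have "card {E, F} = 2" by simp
    ultimately show ?thesis using card_length[of Q] by linarith
  qed
  have "E = last Q" "F = Q ! (length Q - 2)"
    using bottom_two_unique[OF assms(3)] bottom_two_list[OF Q(1) len] Q(2) by auto
  moreover obtain N where "length Q = 2 + N" using le_Suc_ex[OF len] by blast
  then have N: "length p = Suc (Suc N)" by (simp add: Q_def)
  moreover have "Q \<noteq> []" using len by auto
  ultimately have EF: "E = leaves (p ! Suc N)" "F = leaves (p ! N)"
    by (simp_all add: Q_def last_conv_nth)
  obtain us where c: "contract (dom L) T = Node us" using T by simp
  have dc: "disjoint_tree (Node us)" using disjoint_contract[OF disjoint] c by metis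
  have "is_path l (Node us) p" unfolding p_def c
    using is_path_path[OF dc] assms(1) leaves_contract[of "dom L" T] c by metis
  note off = off_leaves[OF this dc]
  have "min_off (p ! Suc N) l = Min (E - {l})" "min_off (p ! N) l = Min (F - E)"
    using off[of "Suc N"] off[of N] N EF unfolding min_off_def by simp_all
  then show ?thesis using N EF unfolding slide_step_def by (simp add: Let_def flip: p_def)
qed

lemma slide_step_None:
  assumes "l \<in> leaves T" "leaves T \<notin> dom L" "\<nexists>E F. bottom_two (open_clusters T l L) E F"
  shows "slide_step T l L = None"
proof -
  define Q where "Q = map leaves (path (contract (dom L) T) l)"
  have "\<not> 2 \<le> length Q"
    using bottom_two_list[of Q] unlabelled_path_sorted[OF assms(1,2), folded Q_def] assms(3) by metis
  then show ?thesis unfolding slide_step_def Q_def by (simp add: Let_def)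
qed

lemma bottom_two_ex:
  assumes "l \<in> leaves T" "leaves T \<notin> dom L" "E \<in> open_clusters T l L" "E \<noteq> leaves T"
  shows "\<exists>E F. bottom_two (open_clusters T l L) E F"
proof -
  define Q where "Q = map leaves (path (contract (dom L) T) l)"
  have Q: "sorted_wrt (\<supset>) Q" "set Q = open_clusters T l L"
    using unlabelled_path_sorted[OF assms(1,2), folded Q_def] by auto
  have "{E, leaves T} \<subseteq> set Q" using Q(2) assms top_cluster by (auto simp: open_clusters_def)
  then have "card {E, leaves T} \<le> card (set Q)" by (intro card_mono) auto
  then have "2 \<le> length Q" using assms(4) card_length[of Q] by simp
  then show ?thesis using bottom_two_list[OF Q(1)] Q(2) by metis
qed

end

text \<open>
  The last condition expresses the inequality between the two minima in a slide step: the next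
  unlabelled edge above has a smaller minimum iff all edges above with the same minimum are
  already labelled. Their labels are then larger than \<open>l\<close>, as the edges labelled \<open>l\<close> are used from
  bottom to top.
\<close>

definition slide_edge :: "edge set \<Rightarrow> edge_labeling \<Rightarrow> edge \<Rightarrow> label \<Rightarrow> bool" where
  "slide_edge C L E l \<longleftrightarrow> l \<in> E \<and> Min E < l \<and>
     (\<forall>G \<in> C. G \<subset> E \<longrightarrow> l \<in> G \<longrightarrow> (\<exists>m\<ge>l. L G = Some m)) \<and>
     (\<forall>F \<in> C. E \<subset> F \<longrightarrow> Min F = Min E \<longrightarrow> (\<exists>m>l. L F = Some m))"

text \<open>Refers to no order of labelling, so it serves both as an invariant of the partial
  labelings and as a description of the final one.\<close>

definition good :: "ltree \<Rightarrow> edge_labeling \<Rightarrow> bool" where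
  "good T L \<longleftrightarrow> dom L \<subseteq> clusters T - {leaves T} \<and>
     (\<forall>E l. L E = Some l \<longrightarrow> slide_edge (clusters T) L E l)"

lemma slide_edge_mono: "slide_edge C L E l \<Longrightarrow> C' \<subseteq> C \<Longrightarrow> slide_edge C' L E l"
  unfolding slide_edge_def by (simp add: subset_iff)

definition label_mset :: "edge_labeling \<Rightarrow> label multiset" where
  "label_mset L = image_mset (\<lambda>E. the (L E)) (mset_set (dom L))"

lemma finite_clusters [simp]: "finite (clusters T)"
  by (induction T) auto

lemma good_finite: "good T L \<Longrightarrow> finite (dom L)"
  unfolding good_def by (meson finite_clusters finite_Diff finite_subset)

lemma label_mset_upd:
  assumes "finite (dom L)" "E \<notin> dom L" shows "label_mset (L(E \<mapsto> l)) = add_mset l (label_mset L)"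
proof -
  have "image_mset (\<lambda>G. the ((L(E \<mapsto> l)) G)) (mset_set (dom L)) = image_mset (\<lambda>G. the (L G)) (mset_set (dom L))"
    using assms by (intro image_mset_cong) auto
  then show ?thesis using assms unfolding label_mset_def by simp
qed

lemma count_label_mset:
  assumes "finite (dom L)" shows "count (label_mset L) m = card {E. L E = Some m}"
proof -
  have "{x. the (L x) = m} \<inter> dom L = {E. L E = Some m}" by auto
  moreover have "count (mset_set (dom L)) E = 1" if "L E = Some m" for E
    using assms that by (simp add: domI)
  ultimately show ?thesis using assms unfolding label_mset_def
    by (simp add: count_image_mset vimage_def)
qed

lemma cluster_finite: "E \<in> clusters T \<Longrightarrow> finite E"
  using clusters_subset finite_subset finite_leaves by metis

text \<open>Lets the condition \<open>l \<ge> m\<^sub>l\<close> of a slide step be expressed as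
  \<open>Min E < l\<close>.\<close>

lemma Min_Diff_eq:
  assumes "finite E" "E - {l} \<noteq> {}" "Min (E - {l}) \<le> (l :: int)"
  shows "Min E = Min (E - {l})" "Min E < l"
proof -
  have m: "Min (E - {l}) \<in> E - {l}" using assms by (intro Min_in) auto
  then have "Min (E - {l}) < l" using assms(3) by auto
  then have "Min E = Min (E - {l})" proof (intro Min_eqI)
    fix y assume "y \<in> E"
    then show "Min (E - {l}) \<le> y" using assms(1) \<open>Min (E - {l}) < l\<close> by (cases "y = l") auto
  qed (use m assms(1) in auto)
  then show "Min E = Min (E - {l})" "Min E < l" using \<open>Min (E - {l}) < l\<close> by auto
qed

context proper_tree
begin

lemma cluster_ne:
  assumes "E \<in> clusters T" shows "E - {l} \<noteq> {}"
proof -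
  have "2 \<le> card E" if "E \<in> clusters S" "disjoint_tree S" "branching_tree S" for E :: edge and S
    using that
  proof (induction S)
    case (Node us)
    show ?case
    proof (cases "E = leaves (Node us)")
      case True
      have "2 \<le> card (fset us)" using Node.prems by (simp add: branching_tree_Node fcard.rep_eq)
      then obtain t s where ts: "t \<in> fset us" "s \<in> fset us" "s \<noteq> t"
        by (metis card_le_Suc0_iff_eq finite_fset not_less_eq_eq numeral_2_eq_2)
      then obtain x y where xy: "x \<in> leaves t" "y \<in> leaves s"
        using branching_leaves_ne Node.prems by (metis branching_tree_Node equals0I)
      then have "x \<noteq> y" using child_unique[OF Node.prems(2) ts(1,2)] ts(3) by auto
      moreover have "card {x, y} \<le> card E" using True ts xy by (intro card_mono) auto
      ultimately show ?thesis by simp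
    next
      case False
      then obtain t where "t \<in> fset us" "E \<in> clusters t" using Node.prems(1) by auto
      then show ?thesis using Node by (auto simp: branching_tree_Node disjoint_tree_Node)
    qed
  qed auto
  from this[OF assms disjoint branching] show ?thesis
    by (metis One_nat_def Suc_1 card.empty card_insert_le_m1 card_mono finite.emptyI finite.insertI
        insert_Diff_if le_zero_eq nat.simps(3) not_less_eq_eq subset_singleton_iff Diff_eq_empty_iff card_1_singleton_iff order_refl)
qed

lemma step_good:
  assumes "good T L" "l \<in> leaves T" "\<And>m. m \<in> ran L \<Longrightarrow> l \<le> m" "slide_step T l L = Some L'"
  shows "good T L' \<and> (\<exists>E. E \<notin> dom L \<and> L' = L(E \<mapsto> l))"
proof -
  have tn: "leaves T \<notin> dom L" using assms(1) by (auto simp: good_def)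
  obtain E F where EF: "bottom_two (open_clusters T l L) E F"
    using slide_step_None[OF assms(2) tn] assms(4) by fastforce
  have s: "Min (E - {l}) \<le> l" "Min (F - E) \<le> Min (E - {l})" "L' = L(E \<mapsto> l)"
    using slide_step_bottom_two[OF assms(2) tn EF] assms(4) by (auto split: if_splits)
  have E: "E \<in> clusters T" "l \<in> E" "E \<notin> dom L" and F: "F \<in> clusters T" "E \<subset> F"
    and low: "\<And>G. G \<in> clusters T \<Longrightarrow> l \<in> G \<Longrightarrow> G \<notin> dom L \<Longrightarrow> G = E \<or> F \<subseteq> G"
    using EF unfolding bottom_two_def open_clusters_def by auto
  have fin: "finite E" "finite F" using E F cluster_finite by auto
  have mE: "Min E = Min (E - {l})" "Min E < l" using Min_Diff_eq[OF fin(1) cluster_ne[OF E(1)] s(1)] by auto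
  have "Min (F - E) \<in> F - E" using F fin by (intro Min_in) auto
  moreover have "Min E \<in> E" using E fin by (intro Min_in) auto
  ultimately have "Min (F - E) < Min E" "Min F \<le> Min (F - E)" using s(2) mE(1) fin by (auto simp: order_less_le)
  then have mF: "Min F < Min E" by simp
  have "F \<subseteq> leaves T" using clusters_subset[OF F(1)] .
  then have dom: "dom L' \<subseteq> clusters T - {leaves T}" using assms(1) E(1) F(2) s(3) by (auto simp: good_def)
  have ext: "L G = Some m \<Longrightarrow> L' G = Some m" for G m using s(3) E(3) by auto
  have A: "\<exists>m\<ge>l. L' G = Some m" if "G \<in> clusters T" "G \<subset> E" "l \<in> G" for G
  proof -
    have "G \<in> dom L" using low[OF that(1,3)] that(2) F(2) by auto
    then obtain m where "L G = Some m" by blast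
    then show ?thesis using ext assms(3)[of m] by (auto simp: ran_def)
  qed
  have B: "\<exists>m>l. L' G = Some m" if G: "G \<in> clusters T" "E \<subset> G" "Min G = Min E" for G
  proof -
    \<comment> \<open>An unlabelled \<open>G\<close> above \<open>E\<close> would contain
      \<open>F\<close>, whose minimum is smaller than that of \<open>E\<close>; hence
      \<open>G\<close> already has a label.\<close>
    have "\<not> F \<subseteq> G"
    proof
      assume "F \<subseteq> G"
      then have "Min G \<le> Min F" using F(2) cluster_finite[OF G(1)] by (intro Min_antimono) auto
      then show False using mF G(3) by simp
    qed
    then have "G \<in> dom L" using low[of G] G E(2) by auto
    then obtain m where m: "L G = Some m" "l \<le> m" using assms(3) by (auto simp: ran_def dom_def)
    \<comment> \<open>If \<open>G\<close> already had the label \<open>l\<close>, goodness would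
      require a label on \<open>E\<close> below it, because \<open>l \<in> E\<close>.\<close>
    moreover have "m \<noteq> l" using assms(1) m(1) E G(2) unfolding good_def slide_edge_def by blast
    ultimately show ?thesis using ext by force
  qed
  have "slide_edge (clusters T) L' E' l'" if "L' E' = Some l'" for E' l'
  proof (cases "E' = E")
    case True
    then have "l' = l" using that s(3) by auto
    then show ?thesis using True A B E(2) mE(2) unfolding slide_edge_def by blast
  next
    case False
    then have "L E' = Some l'" using that s(3) by auto
    then show ?thesis using assms(1) ext unfolding good_def slide_edge_def by meson
  qed
  then have "good T L'" using dom unfolding good_def by blast
  then show ?thesis using E(3) s(3) by blast
qed

lemma fold_None: "foldl (\<lambda>L l. Option.bind L (slide_step T l)) None ws = None"
  by (induction ws) auto

lemma fold_good:
  assumes "good T L" "sorted_wrt (\<ge>) ws" "set ws \<subseteq> leaves T" "\<And>m w. m \<in> ran L \<Longrightarrow> w \<in> set ws \<Longrightarrow> w \<le> m"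
    "foldl (\<lambda>L l. Option.bind L (slide_step T l)) (Some L) ws = Some L'"
  shows "good T L' \<and> label_mset L' = label_mset L + mset ws"
  using assms
proof (induction ws arbitrary: L)
  case (Cons w ws)
  obtain L1 where L1: "slide_step T w L = Some L1"
    using Cons.prems(5) fold_None by (cases "slide_step T w L") auto
  have g: "good T L1" and "\<exists>E. E \<notin> dom L \<and> L1 = L(E \<mapsto> w)"
    using step_good[OF Cons.prems(1) _ _ L1] Cons.prems(3,4) by auto
  then obtain E where E: "E \<notin> dom L" "L1 = L(E \<mapsto> w)" by blast
  have "w' \<le> m" if "m \<in> ran L1" "w' \<in> set ws" for m w'
  proof (cases "m = w")
    case False
    then have "m \<in> ran L" using that(1) E by (auto simp: ran_def split: if_splits)
    then show ?thesis using that(2) Cons.prems(4) by simp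
  qed (use that(2) Cons.prems(2) in auto)
  then have "good T L' \<and> label_mset L' = label_mset L1 + mset ws"
    using Cons.IH[OF g] Cons.prems L1 by auto
  then show ?case using label_mset_upd[OF good_finite[OF Cons.prems(1)] E(1)] E(2) by simp
qed simp

text \<open>The procedure has to rediscover \<open>M\<close>. The word lists the labels in
  decreasing order, so comparing multiplicities shows that \<open>L\<close> contains all edges whose
  label in \<open>M\<close> exceeds the current letter.\<close>

lemma fold_complete:
  assumes "good T M" "dom M = clusters T - {leaves T}" "L \<subseteq>\<^sub>m M" "sorted_wrt (\<ge>) ws" "set ws \<subseteq> leaves T"
    "label_mset M = label_mset L + mset ws"
  shows "foldl (\<lambda>L l. Option.bind L (slide_step T l)) (Some L) ws = Some M"
  using assms
proof (induction ws arbitrary: L)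
  case Nil
  have "dom L \<subseteq> dom M" using Nil.prems(3) by (rule map_le_implies_dom_le)
  moreover have "card (dom L) = card (dom M)"
    using arg_cong[OF Nil.prems(6), of size] by (simp add: label_mset_def)
  ultimately have "dom L = dom M" using good_finite[OF Nil.prems(1)] card_subset_eq by blast
  then have "L = M" using Nil.prems(3) by (metis map_le_antisym map_le_def)
  then show ?case by simp
next
  case (Cons w ws)
  note g = Cons.prems(1)
  have finM: "finite (dom M)" using good_finite[OF g] .
  have finL: "finite (dom L)" by (rule finite_subset[OF map_le_implies_dom_le[OF Cons.prems(3)] finM])
  have sub: "L E = Some m \<Longrightarrow> M E = Some m" for E m
    using Cons.prems(3) domI[of L E m] by (simp add: map_le_def)
  have finS: "finite {E. M E = Some m}" for m using finM by (rule finite_subset[rotated]) auto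
  have big: "E \<in> dom L" if "M E = Some m" "w < m" for E m
  proof -
    have "m \<notin> set (w # ws)" using Cons.prems(4) that(2) by auto
    then have "count (label_mset M) m = count (label_mset L) m" using Cons.prems(6)
      by (simp add: count_mset_0_iff)
    then have "card {E. L E = Some m} = card {E. M E = Some m}" using count_label_mset finL finM by simp
    then have "{E. L E = Some m} = {E. M E = Some m}" using sub by (intro card_subset_eq[OF finS]) auto
    then have "L E = Some m" using that(1) by blast
    then show ?thesis by (rule domI)
  qed
  have "\<exists>E. M E = Some w \<and> E \<notin> dom L"
  proof (rule ccontr)
    assume "\<not> ?thesis"
    then have "{E. M E = Some w} \<subseteq> {E. L E = Some w}" using sub by (auto simp: dom_def)
    then have "card {E. M E = Some w} \<le> card {E. L E = Some w}"
      using finite_subset[OF _ finM, of "{E. L E = Some w}"] sub by (intro card_mono) (auto simp: dom_def)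
    then show False using Cons.prems(6) count_label_mset[of L w] count_label_mset[of M w] finL finM by simp
  qed
  then obtain E' where E': "M E' = Some w" "E' \<notin> dom L" by blast
  have wT: "w \<in> leaves T" and tn: "leaves T \<notin> dom L" using Cons.prems(2,3,5) map_le_implies_dom_le by fastforce+
  have "E' \<in> dom M" using E' by blast
  then have E'c: "E' \<in> clusters T" "E' \<noteq> leaves T" "w \<in> E'"
    using Cons.prems(1,2) E'(1) by (auto simp: good_def slide_edge_def)
  then have "E' \<in> open_clusters T w L" using E'(2) by (simp add: open_clusters_def)
  then obtain E F where EF: "bottom_two (open_clusters T w L) E F"
    using bottom_two_ex[OF wT tn _ E'c(2)] by blast
  have E: "E \<in> clusters T" "w \<in> E" "E \<notin> dom L" and F: "F \<in> clusters T" "F \<notin> dom L" "E \<subset> F"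
    and low: "\<And>G. G \<in> clusters T \<Longrightarrow> w \<in> G \<Longrightarrow> G \<notin> dom L \<Longrightarrow> G = E \<or> F \<subseteq> G"
    using EF unfolding bottom_two_def open_clusters_def by auto
  \<comment> \<open>The lowest unlabelled edge \<open>E\<close> is \<open>E'\<close> or lies below
    it. As \<open>M E' = Some w\<close>, goodness gives \<open>E\<close> a label of at least
    \<open>w\<close>, and labels above \<open>w\<close> have all been placed.\<close>
  have ME: "M E = Some w"
  proof (cases "E = E'")
    case False
    then have "E \<subset> E'" using low[OF E'c(1,3) E'(2)] F(3) by blast
    then obtain m where m: "M E = Some m" "w \<le> m" using g E'(1) E unfolding good_def slide_edge_def by blast
    then have "m = w" using big[of E m] E(3) by fastforce
    then show ?thesis using m by simp
  qed (use E' in simp)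
  have fin: "finite E" "finite F" using E F cluster_finite by auto
  have mE: "Min E < w" using g ME unfolding good_def slide_edge_def by blast
  have "Min E \<in> E" using fin E(2) by (intro Min_in) auto
  then have "Min E \<in> E - {w}" using mE by simp
  then have m1: "Min (E - {w}) = Min E" using fin by (intro Min_eqI) auto
  have "Min F \<le> Min E" using F(3) E(2) fin by (intro Min_antimono) auto
  moreover have "Min F \<noteq> Min E"
  proof
    assume "Min F = Min E"
    then obtain m where "w < m" "M F = Some m" using g ME F unfolding good_def slide_edge_def by blast
    then show False using big F(2) by blast
  qed
  ultimately have mF: "Min F < Min E" by simp
  have "Min F \<in> F" using fin F(3) by (intro Min_in) auto
  moreover have "Min F \<notin> E" using mF Min_le[OF fin(1), of "Min F"] by linarith
  ultimately have "Min F \<in> F - E" by blast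
  then have "Min (F - E) \<le> Min F" using fin by (intro Min_le) auto
  then have st: "slide_step T w L = Some (L(E \<mapsto> w))"
    using slide_step_bottom_two[OF wT tn EF] m1 mF mE by simp
  have "L(E \<mapsto> w) \<subseteq>\<^sub>m M" using Cons.prems(3) ME by (auto simp: map_le_def)
  moreover have "label_mset M = label_mset (L(E \<mapsto> w)) + mset ws"
    using Cons.prems(6) label_mset_upd[OF finL E(3)] by simp
  moreover have "sorted_wrt (\<ge>) ws" "set ws \<subseteq> leaves T" using Cons.prems(4,5) by simp_all
  ultimately have "foldl (\<lambda>L l. Option.bind L (slide_step T l)) (Some (L(E \<mapsto> w))) ws = Some M"
    using Cons.IH[OF g Cons.prems(2)] by blast
  then show ?case using st by (simp del: fun_upd_apply)
qed

end

section \<open>Slide trees as marked binary trees\<close>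

primrec shape :: "'a stree \<Rightarrow> 'a tree" where
  "shape (Tip x) = Leaf x"
| "shape (Fork l e r) = Node {|shape l, shape r|}"

definition planted :: "label stree \<Rightarrow> ltree" where
  "planted t = Node {|Leaf (-1), shape t|}"

primrec ordered :: "'a :: linorder stree \<Rightarrow> bool" where
  "ordered (Tip x) \<longleftrightarrow> True"
| "ordered (Fork l e r) \<longleftrightarrow> ordered l \<and> ordered r \<and> tips l \<inter> tips r = {} \<and> head l < head r"

primrec agrees :: "edge_labeling \<Rightarrow> label stree \<Rightarrow> bool" where
  "agrees L (Tip x) \<longleftrightarrow> True"
| "agrees L (Fork l e r) \<longleftrightarrow> L (tips l \<union> tips r) = Some e \<and> agrees L l \<and> agrees L r"

primrec mark_with :: "edge_labeling \<Rightarrow> label stree \<Rightarrow> label stree" where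
  "mark_with L (Tip x) = Tip x"
| "mark_with L (Fork l e r) = Fork (mark_with L l) (the (L (tips l \<union> tips r))) (mark_with L r)"

lemma leaves_shape [simp]: "leaves (shape t) = tips t"
  by (induction t) auto

lemma valid_ordered: "valid t \<Longrightarrow> ordered t"
  by (induction t) auto

lemma ordered_head_le: "ordered t \<Longrightarrow> x \<in> tips t \<Longrightarrow> head t \<le> x"
proof (induction t)
  case (Fork l e r)
  then show ?case by (cases "x \<in> tips l") auto
qed auto

lemma Min_tips: "ordered t \<Longrightarrow> Min (tips t) = head t"
  using ordered_head_le by (intro Min_eqI) auto

lemma clusters_shape_Fork:
  "clusters (shape (Fork l e r)) = insert (tips l \<union> tips r) (clusters (shape l) \<union> clusters (shape r))"
  by auto

lemma tips_mark_with [simp]: "tips (mark_with L t) = tips t"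
  by (induction t) auto

lemma head_mark_with [simp]: "head (mark_with L t) = head t"
  by (induction t) auto

lemma shape_mark_with [simp]: "shape (mark_with L t) = shape t"
  by (induction t) auto

lemma ordered_mark_with [simp]: "ordered (mark_with L t) = ordered t"
  by (induction t) auto

lemma agrees_mark_with: "clusters (shape t) \<subseteq> dom L \<Longrightarrow> agrees L (mark_with L t)"
proof (induction t)
  case (Fork l e r)
  then show ?case unfolding clusters_shape_Fork by auto
qed auto

lemma agrees_cong:
  "agrees L t \<Longrightarrow> (\<And>E. E \<in> clusters (shape t) \<Longrightarrow> L' E = L E) \<Longrightarrow> agrees L' t"
  by (induction t) auto

lemma shape_clusters_subset: "E \<in> clusters (shape t) \<Longrightarrow> E \<subseteq> tips t"
  using clusters_subset[of E "shape t"] by simp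

lemma cluster_shape_ne: "E \<in> clusters (shape t) \<Longrightarrow> E \<noteq> {}"
proof (induction t)
  case (Fork l e r)
  then show ?case unfolding clusters_shape_Fork using head_in_tips[of l] by blast
qed auto

lemma tips_in_clusters: "\<not> is_Tip t \<Longrightarrow> tips t \<in> clusters (shape t)"
  by (cases t) auto

lemma proper_shape: "ordered t \<Longrightarrow> disjoint_tree (shape t) \<and> branching_tree (shape t)"
proof (induction t)
  case (Fork l e r)
  have "shape l \<noteq> shape r"
  proof
    assume "shape l = shape r"
    then have "tips l = tips r" using leaves_shape by metis
    then show False using Fork.prems head_in_tips[of l] by auto
  qed
  then have "fcard {|shape l, shape r|} = 2" by (simp add: fcard.rep_eq)
  then show ?case using Fork by (auto simp: disjoint_tree_Node branching_tree_Node)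
qed auto

text \<open>The minima decide which child is on the left, and \<open>L\<close> supplies the
  labels.\<close>

lemma shape_inj:
  "shape s = shape t \<Longrightarrow> ordered s \<Longrightarrow> ordered t \<Longrightarrow> agrees L s \<Longrightarrow> agrees L t \<Longrightarrow> s = t"
proof (induction s arbitrary: t)
  case (Tip x)
  then show ?case by (cases t) auto
next
  case (Fork l e r)
  then obtain l' e' r' where t: "t = Fork l' e' r'" by (cases t) auto
  have hd: "shape u = shape v \<Longrightarrow> ordered u \<Longrightarrow> ordered v \<Longrightarrow> head u = head v" for u v :: "label stree"
    using Min_tips leaves_shape by metis
  have "fset {|shape l, shape r|} = fset {|shape l', shape r'|}" using Fork.prems(1) t by simp
  then have "{shape l, shape r} = {shape l', shape r'}" by simp
  then consider "shape l = shape l'" "shape r = shape r'" | "shape l = shape r'" "shape r = shape l'"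
    by (auto simp: doubleton_eq_iff)
  then show ?case
  proof cases
    case 1
    then have "tips l = tips l'" "tips r = tips r'" using leaves_shape by metis+
    then have "e = e'" using Fork.prems(4,5) t by auto
    moreover have "l = l'" using Fork.IH(1)[OF 1(1)] Fork.prems t by simp
    moreover have "r = r'" using Fork.IH(2)[OF 1(2)] Fork.prems t by simp
    ultimately show ?thesis using t by simp
  next
    case 2
    have "head l = head r'" "head r = head l'"
      using hd[OF 2(1)] hd[OF 2(2)] Fork.prems(2,3) t by simp_all
    then show ?thesis using Fork.prems(2,3) t by simp
  qed
qed

lemma clusters_shape_disjoint:
  assumes "ordered (Fork l e r)"
  shows "clusters (shape l) \<inter> clusters (shape r) = {}"
    "tips l \<union> tips r \<notin> clusters (shape l)" "tips l \<union> tips r \<notin> clusters (shape r)"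
proof -
  have d: "tips l \<inter> tips r = {}" using assms by simp
  have sub: "E \<in> clusters (shape l) \<Longrightarrow> E \<subseteq> tips l" "E \<in> clusters (shape r) \<Longrightarrow> E \<subseteq> tips r" for E
    by (rule shape_clusters_subset; assumption)+
  have False if "E \<in> clusters (shape l)" "E \<in> clusters (shape r)" for E
    using sub(1)[OF that(1)] sub(2)[OF that(2)] cluster_shape_ne[OF that(1)] d by blast
  then show "clusters (shape l) \<inter> clusters (shape r) = {}" by blast
  show "tips l \<union> tips r \<notin> clusters (shape l)" "tips l \<union> tips r \<notin> clusters (shape r)"
    using d sub(1)[of "tips l \<union> tips r"] sub(2)[of "tips l \<union> tips r"] head_in_tips[of l] head_in_tips[of r]
    by blast+
qed

lemma marks_agrees:
  "ordered t \<Longrightarrow> agrees L t \<Longrightarrow> image_mset (\<lambda>E. the (L E)) (mset_set (clusters (shape t))) = marks t"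
proof (induction t)
  case (Fork l e r)
  note d = clusters_shape_disjoint[OF Fork.prems(1)]
  have "mset_set (clusters (shape (Fork l e r))) =
      add_mset (tips l \<union> tips r) (mset_set (clusters (shape l)) + mset_set (clusters (shape r)))"
    unfolding clusters_shape_Fork using d by (simp add: mset_set_Union)
  then show ?case using Fork by simp
qed auto

text \<open>Different vertices of an ordered tree have different clusters, so the marks define a
  function of clusters.\<close>

lemma ex_agrees: "ordered t \<Longrightarrow> \<exists>L. dom L = clusters (shape t) \<and> agrees L t"
proof (induction t)
  case (Tip x)
  then show ?case by (intro exI[of _ Map.empty]) auto
next
  case (Fork l e r)
  then obtain Ll Lr where L: "dom Ll = clusters (shape l)" "agrees Ll l" "dom Lr = clusters (shape r)" "agrees Lr r"
    by auto
  note d = clusters_shape_disjoint[OF Fork.prems]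
  let ?L = "(Ll ++ Lr)(tips l \<union> tips r \<mapsto> e)"
  have "agrees ?L l"
  proof (rule agrees_cong[OF L(2)])
    fix E assume E: "E \<in> clusters (shape l)"
    then have "E \<notin> dom Lr" "E \<noteq> tips l \<union> tips r" using d L(3) by auto
    then show "?L E = Ll E" by (simp add: map_add_dom_app_simps(3))
  qed
  moreover have "agrees ?L r"
  proof (rule agrees_cong[OF L(4)])
    fix E assume E: "E \<in> clusters (shape r)"
    then have "E \<in> dom Lr" "E \<noteq> tips l \<union> tips r" using d L(3) by auto
    then show "?L E = Lr E" by (simp add: map_add_dom_app_simps(1))
  qed
  moreover have "dom ?L = clusters (shape (Fork l e r))" unfolding clusters_shape_Fork using L by auto
  moreover have "?L (tips l \<union> tips r) = Some e" by simp
  ultimately show ?case unfolding agrees.simps by blast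
qed

text \<open>Unlike in \<open>good\<close>, the top cluster needs a label as well: the edge above
  \<open>t\<close> becomes internal when \<open>t\<close> is planted next to b.\<close>

definition good_on :: "label stree \<Rightarrow> edge_labeling \<Rightarrow> bool" where
  "good_on t L \<longleftrightarrow>
     (\<forall>E \<in> clusters (shape t). \<exists>l. L E = Some l \<and> slide_edge (clusters (shape t)) L E l)"

lemma open_tips_iff:
  "ordered t \<Longrightarrow> agrees L t \<Longrightarrow>
    x \<in> open_tips t \<longleftrightarrow> x \<in> tips t \<and> (\<forall>G \<in> clusters (shape t). x \<in> G \<longrightarrow> (\<exists>m\<ge>x. L G = Some m))"
proof (induction t)
  case (Fork l e r)
  have d: "tips l \<inter> tips r = {}" using Fork.prems by simp
  have "x \<notin> G" if "x \<in> tips r" "G \<in> clusters (shape l)" for G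
    using that(1) d shape_clusters_subset[OF that(2)] by blast
  moreover have "x \<notin> G" if "x \<in> tips l" "G \<in> clusters (shape r)" for G
    using that(1) d shape_clusters_subset[OF that(2)] by blast
  moreover have "x \<in> open_tips l \<longleftrightarrow> x \<in> tips l \<and> (\<forall>G \<in> clusters (shape l). x \<in> G \<longrightarrow> (\<exists>m\<ge>x. L G = Some m))"
    "x \<in> open_tips r \<longleftrightarrow> x \<in> tips r \<and> (\<forall>G \<in> clusters (shape r). x \<in> G \<longrightarrow> (\<exists>m\<ge>x. L G = Some m))"
    "L (tips l \<union> tips r) = Some e"
    using Fork.IH Fork.prems by simp_all
  ultimately show ?case unfolding clusters_shape_Fork open_tips.simps tips.simps
    by (cases "x \<in> tips l"; cases "x \<in> tips r") (simp_all add: ball_Un conj_commute)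
qed auto

lemma good_on_mono:
  "good_on t L \<Longrightarrow> clusters (shape s) \<subseteq> clusters (shape t) \<Longrightarrow> good_on s L"
  unfolding good_on_def by (meson slide_edge_mono subsetD)

lemma good_on_valid: "ordered t \<Longrightarrow> agrees L t \<Longrightarrow> good_on t L \<Longrightarrow> valid t"
proof (induction t)
  case (Fork l e r)
  have o: "ordered l" "ordered r" "tips l \<inter> tips r = {}" "head l < head r"
    and a: "L (tips l \<union> tips r) = Some e" "agrees L l" "agrees L r" using Fork.prems by auto
  have "good_on l L" "good_on r L"
    by (rule good_on_mono[OF Fork.prems(3)]; unfold clusters_shape_Fork; blast)+
  then have v: "valid l" "valid r" using Fork.IH(1)[OF o(1) a(2)] Fork.IH(2)[OF o(2) a(3)] by simp_all
  note G = Fork.prems(3)[unfolded good_on_def slide_edge_def, THEN bspec]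
  have cl: "tips l \<union> tips r \<in> clusters (shape (Fork l e r))" by simp
  from G[OF this] a(1)
  have g: "e \<in> tips l \<union> tips r" "Min (tips l \<union> tips r) < e"
    and g1: "\<forall>G \<in> clusters (shape (Fork l e r)). G \<subset> tips l \<union> tips r \<longrightarrow> e \<in> G \<longrightarrow> (\<exists>m\<ge>e. L G = Some m)"
    by (simp_all only: option.inject) blast+
  have mw: "Min (tips l \<union> tips r) = head l" using Min_tips[OF Fork.prems(1)] by simp
  have pl: "tips l \<subset> tips l \<union> tips r" using o(3) head_in_tips[of r] by blast
  have ml: "mark_less l e"
  proof (cases l)
    case f: (Fork l1 e1 r1)
    have c: "tips l \<in> clusters (shape (Fork l e r))" using tips_in_clusters[of l] f by auto
    have e1: "L (tips l) = Some e1" using a(2) f by simp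
    have "Min (tips l) = head l" using Min_tips[OF o(1)] .
    then have "\<exists>m>e1. L (tips l \<union> tips r) = Some m"
      using G[OF c] cl pl e1 mw by auto
    then show ?thesis using a(1) f by auto
  qed auto
  \<comment> \<open>A label in the left branch would force a label of at least \<open>e\<close> on
    the edge above \<open>l\<close>. That edge has the same minimum as the fork, so its label is
    below \<open>e\<close>.\<close>
  have "e \<notin> tips l"
  proof
    assume el: "e \<in> tips l"
    show False
    proof (cases l)
      case (Tip y)
      then show ?thesis using el g(2) mw by simp
    next
      case f: (Fork l1 e1 r1)
      have c: "tips l \<in> clusters (shape (Fork l e r))" using tips_in_clusters[of l] f by auto
      show ?thesis using bspec[OF g1 c] pl el a(2) f ml by auto
    qed
  qed
  then have er: "e \<in> tips r" using g(1) by blast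
  have "\<exists>m\<ge>e. L G = Some m" if "G \<in> clusters (shape r)" "e \<in> G" for G
  proof -
    have "G \<subset> tips l \<union> tips r"
      using shape_clusters_subset[OF that(1)] o(3) head_in_tips[of l] by blast
    moreover have "G \<in> clusters (shape (Fork l e r))" using that(1) by simp
    ultimately show ?thesis using bspec[OF g1] that(2) by simp
  qed
  then have "e \<in> open_tips r" using open_tips_iff[OF o(2) a(3), of e] er by simp
  then show ?case using v o ml by simp
qed auto

lemma valid_good_on: "valid t \<Longrightarrow> agrees L t \<Longrightarrow> good_on t L"
proof (induction t)
  case (Tip x)
  then show ?case by (simp add: good_on_def)
next
  case (Fork l e r)
  note v = valid_ForkD[OF Fork.prems(1)]
  have a: "L (tips l \<union> tips r) = Some e" "agrees L l" "agrees L r"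
    using Fork.prems by auto
  note o = valid_ordered[OF v(1)] valid_ordered[OF v(2)]
  have IH: "good_on l L" "good_on r L" using Fork.IH v a by auto
  have mw: "Min (tips l \<union> tips r) = head l" using Min_tips[OF valid_ordered[OF Fork.prems(1)]] by simp
  have er: "e \<in> tips r" using v(6) open_tips_subset by blast
  have sl: "\<And>E. E \<in> clusters (shape l) \<Longrightarrow> E \<subseteq> tips l" and sr: "\<And>E. E \<in> clusters (shape r) \<Longrightarrow> E \<subseteq> tips r"
    by (simp_all add: shape_clusters_subset)
  have "\<exists>l'. L E = Some l' \<and> slide_edge (clusters (shape (Fork l e r))) L E l'"
    if E: "E \<in> clusters (shape (Fork l e r))" for E
  proof -
    consider (top) "E = tips l \<union> tips r" | (left) "E \<in> clusters (shape l)" | (right) "E \<in> clusters (shape r)"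
      using E unfolding clusters_shape_Fork by blast
    then show ?thesis
    proof cases
      case top
      have "\<exists>m\<ge>e. L G = Some m" if "G \<in> clusters (shape (Fork l e r))" "G \<subset> E" "e \<in> G" for G
      proof -
        have "G \<notin> clusters (shape l)" using sl[of G] er v(3) that(3) by blast
        then have "G \<in> clusters (shape r)" using that(1,2) top unfolding clusters_shape_Fork by blast
        then show ?thesis using open_tips_iff[OF o(2) a(3), of e] v(6) that(3) by simp
      qed
      moreover have "\<not> E \<subset> F" if "F \<in> clusters (shape (Fork l e r))" for F
        using that top sl[of F] sr[of F] unfolding clusters_shape_Fork by blast
      ultimately show ?thesis using top a(1) er mark_gt_head[OF Fork.prems(1)] mw unfolding slide_edge_def by auto
    next
      case left
      from bspec[OF IH(1)[unfolded good_on_def slide_edge_def] this] obtain l' where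
        l': "L E = Some l'" "l' \<in> E" "Min E < l'"
        and l1: "\<forall>G \<in> clusters (shape l). G \<subset> E \<longrightarrow> l' \<in> G \<longrightarrow> (\<exists>m\<ge>l'. L G = Some m)"
        and l2: "\<forall>F \<in> clusters (shape l). E \<subset> F \<longrightarrow> Min F = Min E \<longrightarrow> (\<exists>m>l'. L F = Some m)"
        by blast
      have "\<exists>m\<ge>l'. L G = Some m" if "G \<in> clusters (shape (Fork l e r))" "G \<subset> E" "l' \<in> G" for G
      proof -
        have "G \<notin> clusters (shape r)" using sr[of G] v(3) sl[OF left] that(2,3) by blast
        moreover have "G \<noteq> tips l \<union> tips r" using sl[OF left] that(2) by blast
        ultimately have "G \<in> clusters (shape l)" using that(1) unfolding clusters_shape_Fork by blast
        then show ?thesis using bspec[OF l1] that(2,3) by simp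
      qed
      moreover have "\<exists>m>l'. L F = Some m" if F: "F \<in> clusters (shape (Fork l e r))" "E \<subset> F" "Min F = Min E" for F
      proof -
        consider "F = tips l \<union> tips r" | "F \<in> clusters (shape l)" | "F \<in> clusters (shape r)"
          using F unfolding clusters_shape_Fork by blast
        then show ?thesis
        proof cases
          case 1
          have "\<not> is_Tip l" using left by (cases l) auto
          then obtain l1' e1 r1 where f: "l = Fork l1' e1 r1" by (cases l) auto
          have e1: "L (tips l) = Some e1" "e1 < e" using a(2) v(5) f by auto
          \<comment> \<open>Here \<open>E\<close> shares its minimum with the whole fork and thus
            with the edge above \<open>l\<close>, so labels increase from \<open>E\<close> through
            that edge to \<open>e\<close>.\<close>
          have "l' \<le> e1"
          proof (cases "E = tips l")
            case True
            then show ?thesis using l'(1) e1 by simp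
          next
            case False
            then have "E \<subset> tips l" using sl[OF left] by blast
            moreover have "Min (tips l) = Min E" using F(3) 1 mw Min_tips[OF o(1)] by simp
            ultimately show ?thesis using bspec[OF l2 tips_in_clusters] f e1 by auto
          qed
          then show ?thesis using 1 a(1) e1 by auto
        next
          case 2
          then show ?thesis using bspec[OF l2] F(2,3) by simp
        next
          case 3
          then have "E = {}" using sl[OF left] sr[OF 3] v(3) F(2) by blast
          then show ?thesis using l'(2) by blast
        qed
      qed
      ultimately show ?thesis unfolding slide_edge_def by - (rule exI[of _ l'], intro conjI l' ballI impI, blast+)
    next
      case right
      from bspec[OF IH(2)[unfolded good_on_def slide_edge_def] this] obtain l' where
        l': "L E = Some l'" "l' \<in> E" "Min E < l'"
        and l1: "\<forall>G \<in> clusters (shape r). G \<subset> E \<longrightarrow> l' \<in> G \<longrightarrow> (\<exists>m\<ge>l'. L G = Some m)"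
        and l2: "\<forall>F \<in> clusters (shape r). E \<subset> F \<longrightarrow> Min F = Min E \<longrightarrow> (\<exists>m>l'. L F = Some m)"
        by blast
      have "\<exists>m\<ge>l'. L G = Some m" if "G \<in> clusters (shape (Fork l e r))" "G \<subset> E" "l' \<in> G" for G
      proof -
        have "G \<notin> clusters (shape l)" using sl[of G] v(3) sr[OF right] that(2,3) by blast
        moreover have "G \<noteq> tips l \<union> tips r" using sr[OF right] that(2) by blast
        ultimately have "G \<in> clusters (shape r)" using that(1) unfolding clusters_shape_Fork by blast
        then show ?thesis using bspec[OF l1] that(2,3) by simp
      qed
      moreover have "\<exists>m>l'. L F = Some m" if F: "F \<in> clusters (shape (Fork l e r))" "E \<subset> F" "Min F = Min E" for F
      proof -
        consider "F = tips l \<union> tips r" | "F \<in> clusters (shape l)" | "F \<in> clusters (shape r)"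
          using F unfolding clusters_shape_Fork by blast
        then show ?thesis
        proof cases
          case 1
          have "finite E" using sr[OF right] finite_subset finite_tips by blast
          then have "Min E \<in> tips r" using Min_in[of E] l'(2) sr[OF right] by blast
          then have "head r \<le> Min E" using head_le[OF v(2)] by blast
          then show ?thesis using F(3) 1 mw v(4) by simp
        next
          case 2
          then have "E = {}" using sr[OF right] sl[OF 2] v(3) F(2) by blast
          then show ?thesis using l'(2) by blast
        next
          case 3
          then show ?thesis using bspec[OF l2] F(2,3) by simp
        qed
      qed
      ultimately show ?thesis unfolding slide_edge_def by - (rule exI[of _ l'], intro conjI l' ballI impI, blast+)
    qed
  qed
  then show ?case unfolding good_on_def by blast
qed

text \<open>By induction the clusters inside the children number at most the leaves minus the number
  of children, and the vertex adds one. Equality forces exactly two children and equality in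
  both.\<close>

lemma binary_shape:
  fixes T :: "'a :: linorder tree"
  assumes "disjoint_tree T" "branching_tree T"
  shows "Suc (card (clusters T)) \<le> card (leaves T) \<and>
    (Suc (card (clusters T)) = card (leaves T) \<longrightarrow> (\<exists>t. ordered t \<and> shape t = T))"
  using assms
proof (induction T)
  case (Leaf x)
  show ?case using exI[of "\<lambda>t. ordered t \<and> shape t = Leaf x" "Tip x"] by simp
next
  case (Node ts)
  have IH: "Suc (card (clusters t)) \<le> card (leaves t)"
    "Suc (card (clusters t)) = card (leaves t) \<Longrightarrow> \<exists>u. ordered u \<and> shape u = t" if "t \<in> fset ts" for t
    using Node that by (auto simp: disjoint_tree_Node branching_tree_Node)
  have two: "2 \<le> card (fset ts)" using Node.prems by (simp add: branching_tree_Node fcard.rep_eq)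
  have cl: "card (leaves (Node ts)) = (\<Sum>t\<in>fset ts. card (leaves t))"
    using Node.prems(1) by (simp add: disjoint_tree_Node card_UN_disjoint)
  have "clusters (Node ts) = insert (leaves (Node ts)) (\<Union>t\<in>fset ts. clusters t)" by simp
  then have "card (clusters (Node ts)) \<le> Suc (card (\<Union>t\<in>fset ts. clusters t))"
    by (simp add: card_insert_if del: clusters.simps tree.set)
  also have "card (\<Union>t\<in>fset ts. clusters t) \<le> (\<Sum>t\<in>fset ts. card (clusters t))" by (intro card_UN_le) auto
  finally have c1: "Suc (card (clusters (Node ts))) \<le> 2 + (\<Sum>t\<in>fset ts. card (clusters t))" by simp
  have c2: "(\<Sum>t\<in>fset ts. Suc (card (clusters t))) = card (fset ts) + (\<Sum>t\<in>fset ts. card (clusters t))"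
    by (simp add: sum_Suc)
  have c3: "(\<Sum>t\<in>fset ts. Suc (card (clusters t))) \<le> (\<Sum>t\<in>fset ts. card (leaves t))"
    using IH(1) by (intro sum_mono)
  have "\<exists>t. ordered t \<and> shape t = Node ts" if eq: "Suc (card (clusters (Node ts))) = card (leaves (Node ts))"
  proof -
    have "card (fset ts) = 2" and s: "(\<Sum>t\<in>fset ts. Suc (card (clusters t))) = (\<Sum>t\<in>fset ts. card (leaves t))"
      using c1 c2 c3 two cl eq by linarith+
    then obtain u v where uv: "fset ts = {u, v}" "u \<noteq> v" by (meson card_2_iff)
    have "Suc (card (clusters t)) = card (leaves t)" if "t \<in> fset ts" for t
      using sum_mono_inv[OF s IH(1) that] by simp
    then obtain x y where xy: "ordered x" "shape x = u" "ordered y" "shape y = v"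
      using IH(2)[of u] IH(2)[of v] uv(1) by blast
    have "leaves u \<inter> leaves v = {}" using Node.prems(1) uv unfolding disjoint_tree_Node by blast
    then have d: "tips x \<inter> tips y = {}" using xy leaves_shape by metis
    then have "head x \<noteq> head y" by (metis disjoint_iff head_in_tips)
    moreover have "ts = {|u, v|}" "ts = {|v, u|}" using uv(1) by (auto simp: fset_inject[symmetric])
    \<comment> \<open>Shape and order ignore the labels, so \<open>undefined\<close> serves as a
      placeholder; \<open>mark_with\<close> supplies the labels later.\<close>
    ultimately consider "ordered (Fork x undefined y) \<and> shape (Fork x undefined y) = Node ts"
      | "ordered (Fork y undefined x) \<and> shape (Fork y undefined x) = Node ts"
      using xy d by (cases "head x < head y") (simp_all add: Int_commute)
    then show ?thesis by cases blast+
  qed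
  moreover have "Suc (card (clusters (Node ts))) \<le> card (leaves (Node ts))" using c1 c2 c3 two cl by linarith
  ultimately show ?case by blast
qed

section \<open>Planting next to the leaf b, and the word of labels\<close>

lemma leaves_planted: "leaves (planted t) = insert (-1) (tips t)"
  by (simp add: planted_def)

lemma clusters_planted: "clusters (planted t) = insert (insert (-1) (tips t)) (clusters (shape t))"
  by (simp add: planted_def)

lemma proper_planted:
  assumes "ordered t" "-1 \<notin> tips t"
  shows "proper_tree (planted t) {|Leaf (-1), shape t|}"
proof
  have "Leaf (-1) \<noteq> shape t" using assms(2) leaves_shape[of t] by (metis tree.set_intros(1))
  then have "fcard {|Leaf (-1), shape t|} = 2" by (simp add: fcard.rep_eq)
  then show "disjoint_tree (planted t)" "branching_tree (planted t)"
    using proper_shape[OF assms(1)] assms(2)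
    by (auto simp: planted_def disjoint_tree_Node branching_tree_Node)
qed (simp add: planted_def)

lemma stable_tree_iff:
  "stable_tree n T \<longleftrightarrow> leaves T = {-1, 0} \<union> {1..int n} \<and> disjoint_tree T \<and> branching_tree T"
  unfolding stable_tree_def disjoint_tree_def branching_tree_def
  by (simp add: all_conj_distrib imp_conjR) blast

lemma label_set: "{-1, 0} \<union> {1..int n} = insert (-1) {0..int n}"
  by auto

text \<open>The model of \<open>Slide k\<close>: the leaf c is the tip \<open>0\<close>, the leaf b
  is added by \<open>planted\<close>, and a is implicit as before.\<close>

definition slide_strees :: "nat list \<Rightarrow> label stree set" where
  "slide_strees k = {t. valid t \<and> tips t = {0..int (length k)} \<and> marks t = mset (slide_word k)}"

lemma count_concat_replicate:
  "distinct ls \<Longrightarrow> count (mset (concat (map (\<lambda>l. replicate (f l) (int l)) ls))) x =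
     (if 0 \<le> x \<and> nat x \<in> set ls then f (nat x) else 0)"
  by (induction ls) (auto simp: count_replicate_mset)

lemma count_slide_word:
  "count (mset (slide_word k)) x = (if 1 \<le> x \<and> x \<le> int (length k) then k ! (nat x - 1) else 0)"
  unfolding slide_word_def by (subst count_concat_replicate) auto

lemma set_slide_word: "set (slide_word k) \<subseteq> {1..int (length k)}"
  unfolding slide_word_def by auto

lemma sorted_slide_word: "sorted_wrt (\<ge>) (slide_word k)"
proof -
  have s: "sorted_wrt (\<ge>) (concat (map (\<lambda>l. replicate (f l) (int l)) ls))" if "sorted_wrt (>) ls" for f ls
  proof -
    have "sorted_wrt (\<ge>) (replicate m (x :: int))" for m x by (induction m) auto
    then show ?thesis using that by (induction ls) (auto simp: sorted_wrt_append less_imp_le)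
  qed
  have "sorted_wrt (>) (rev [1..<Suc (length k)])"
    by (simp add: sorted_wrt_rev del: upt_Suc)
  then show ?thesis unfolding slide_word_def by (rule s)
qed

lemma length_slide_word: "length (slide_word k) = sum_list k"
proof -
  have "map (\<lambda>l. k ! (l - 1)) [1..<Suc (length k)] = k"
    by (intro nth_equalityI) (auto simp del: upt_Suc)
  then have "sum_list (map (\<lambda>l. k ! (l - 1)) (rev [1..<Suc (length k)])) = sum_list k"
    by (metis rev_map sum_list_rev)
  then show ?thesis unfolding slide_word_def by (simp add: length_concat comp_def del: upt_Suc)
qed

lemma good_Map_empty: "good T Map.empty"
  by (simp add: good_def)

lemma slide_strees_Slide:
  assumes "t \<in> slide_strees k"
  shows "planted t \<in> Slide k" "\<exists>L. slide_labeling k (planted t) = Some L \<and> agrees L t"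
proof -
  have t: "valid t" "tips t = {0..int (length k)}" "marks t = mset (slide_word k)"
    using assms by (auto simp: slide_strees_def)
  note o = valid_ordered[OF t(1)]
  have m1: "-1 \<notin> tips t" using t(2) by auto
  interpret proper_tree "planted t" "{|Leaf (-1), shape t|}" by (rule proper_planted[OF o m1])
  obtain M where M: "dom M = clusters (shape t)" "agrees M t" using ex_agrees[OF o] by blast
  have top: "insert (-1) (tips t) \<notin> clusters (shape t)" using m1 shape_clusters_subset by blast
  have dom: "dom M = clusters (planted t) - {leaves (planted t)}"
    using M(1) top by (simp add: leaves_planted clusters_planted)
  have g: "good_on t M" by (rule valid_good_on[OF t(1) M(2)])
  have "good (planted t) M"
    unfolding good_def
  proof (intro conjI allI impI)
    fix E l assume El: "M E = Some l"
    then have E: "E \<in> clusters (shape t)" using M(1) by blast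
    from bspec[OF g[unfolded good_on_def] E] El have ge: "slide_edge (clusters (shape t)) M E l" by auto
    have sub: "E \<subseteq> tips t" by (rule shape_clusters_subset[OF E])
    then have "finite E" by (rule finite_subset) simp
    then have "Min E \<in> tips t" using sub Min_in[OF _ cluster_shape_ne[OF E]] by blast
    \<comment> \<open>The top cluster contains b and carries no label. Its minimum differs from that
      of \<open>E\<close>, so it imposes no condition on \<open>E\<close>.\<close>
    then have "Min (insert (-1) (tips t)) \<noteq> Min E" using t(2) by (simp add: min_def)
    moreover have "\<not> insert (-1) (tips t) \<subset> E" using sub m1 by blast
    ultimately show "slide_edge (clusters (planted t)) M E l"
      using ge unfolding clusters_planted slide_edge_def by simp
  qed (use dom in simp)
  moreover have "label_mset M = label_mset Map.empty + mset (slide_word k)"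
    using marks_agrees[OF o M(2)] t(3) M(1) by (simp add: label_mset_def)
  moreover have "set (slide_word k) \<subseteq> leaves (planted t)"
    using set_slide_word[of k] t(2) unfolding leaves_planted by auto
  ultimately have sl: "slide_labeling k (planted t) = Some M"
    unfolding slide_labeling_def using dom sorted_slide_word by (intro fold_complete) auto
  then show "\<exists>L. slide_labeling k (planted t) = Some L \<and> agrees L t" using M(2) by blast
  have "stable_tree (length k) (planted t)"
    unfolding stable_tree_iff label_set using disjoint branching t(2) by (simp add: leaves_planted)
  then show "planted t \<in> Slide k" using sl by (simp add: Slide_def)
qed

lemma Slide_slide_strees:
  assumes "T \<in> Slide k" "composition n k"
  shows "\<exists>t \<in> slide_strees k. T = planted t"
proof -
  have n: "length k = n" "sum_list k = n" using assms(2) by (auto simp: composition_def)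
  have LT: "leaves T = insert (-1) {0..int n}" "disjoint_tree T" "branching_tree T"
    using assms(1) n(1) unfolding Slide_def stable_tree_iff label_set by auto
  obtain M where M: "slide_labeling k T = Some M" using assms(1) by (auto simp: Slide_def)
  obtain ts where ts: "T = Node ts"
  proof (cases T)
    case (Leaf x)
    then have "insert (-1) {0..int n} = {x}" using LT(1) by simp
    then have "-1 = x" "0 = x" by (metis atLeastAtMost_iff insertCI of_nat_0_le_iff order_refl singletonD)+
    then show ?thesis by simp
  qed auto
  interpret proper_tree T ts using ts LT(2,3) by unfold_locales
  have "set (slide_word k) \<subseteq> leaves T" using set_slide_word[of k] LT(1) n(1) by auto
  then have gM: "good T M" and mM: "label_mset M = mset (slide_word k)"
    using fold_good[OF good_Map_empty[of T] sorted_slide_word[of k]] M unfolding slide_labeling_def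
    by (auto simp: label_mset_def)
  have "card (dom M) = n" using arg_cong[OF mM, of size] n(2) length_slide_word[of k] by (simp add: label_mset_def)
  moreover have domsub: "dom M \<subseteq> clusters T - {leaves T}" using gM by (simp add: good_def)
  ultimately have le: "n \<le> card (clusters T - {leaves T})" using card_mono[OF _ domsub] by simp
  have cc: "card (clusters T - {leaves T}) = card (clusters T) - 1" using top_cluster by simp
  have cp: "0 < card (clusters T)" using top_cluster card_gt_0_iff finite_clusters by blast
  have cl: "card (leaves T) = Suc (Suc n)" using LT(1) by simp
  note b = binary_shape[OF disjoint branching]
  \<comment> \<open>\<open>n\<close> labels occupy \<open>n\<close> internal edges, and
    \<open>binary_shape\<close> allows no more. So the tree is binary and all its internal edges are
    labelled.\<close>
  have eq: "Suc (card (clusters T)) = card (leaves T)" using b le cc cp cl by linarith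
  then have dom: "dom M = clusters T - {leaves T}"
    using card_subset_eq[OF _ domsub] \<open>card (dom M) = n\<close> cc cl by simp
  obtain u where u: "ordered u" "shape u = T" using b eq by blast
  then obtain x e t where ux: "u = Fork x e t" using ts by (cases u) auto
  have tu: "tips x \<union> tips t = insert (-1) {0..int n}" using u(2) ux LT(1) leaves_shape[of u] by simp
  have "head x = Min (insert (-1) {0..int n})" using Min_tips[OF u(1)] ux tu by simp
  then have hx: "head x = -1" by simp
  \<comment> \<open>An internal edge above b would have the minimum of the whole tree, and goodness
    would demand a label on the top cluster. Hence b is adjacent to a.\<close>
  have "is_Tip x"
  proof (rule ccontr)
    assume "\<not> is_Tip x"
    then have c: "tips x \<in> clusters T" using tips_in_clusters[of x] u(2) ux clusters_shape_Fork[of x e t] by simp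
    have "leaves T = tips x \<union> tips t" using LT(1) tu by simp
    moreover have "head t \<notin> tips x" using u(1) ux head_in_tips[of t] by fastforce
    ultimately have ps: "tips x \<subset> leaves T" using head_in_tips[of t] by blast
    then have "tips x \<in> dom M" using c dom by simp
    then obtain l where l: "M (tips x) = Some l" by blast
    have "Min (leaves T) = Min (tips x)" using Min_tips[of x] u(1) ux hx LT(1) by simp
    moreover have "\<forall>F \<in> clusters T. tips x \<subset> F \<longrightarrow> Min F = Min (tips x) \<longrightarrow> (\<exists>m>l. M F = Some m)"
      using gM l unfolding good_def slide_edge_def by blast
    ultimately obtain m where "M (leaves T) = Some m" using top_cluster ps by meson
    then have "leaves T \<in> dom M" by blast
    then show False using dom by simp
  qed
  then have x: "x = Tip (-1)" using hx by (cases x) auto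
  define s where "s = mark_with M t"
  have Tp: "T = planted s" using u(2) ux x by (simp add: planted_def s_def)
  have o: "ordered s" using u(1) ux by (simp add: s_def)
  have ts: "tips s = {0..int n}" using tu x u(1) ux insert_ident[of "-1" "tips t" "{0..int n}"] by (simp add: s_def)
  have m1: "-1 \<notin> tips s" using ts by simp
  have top: "insert (-1) (tips s) \<notin> clusters (shape s)" using m1 shape_clusters_subset by blast
  have dc: "dom M = clusters (shape s)" using dom top unfolding Tp clusters_planted leaves_planted by simp
  have ag: "agrees M s" using agrees_mark_with[of t M] dc by (simp add: s_def)
  have cs: "clusters (shape s) \<subseteq> clusters T" unfolding Tp clusters_planted by blast
  have "good_on s M"
    unfolding good_on_def
  proof
    fix E assume "E \<in> clusters (shape s)"
    then obtain l where l: "M E = Some l" using dc by blast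
    then have "slide_edge (clusters T) M E l" using gM unfolding good_def by blast
    then show "\<exists>l. M E = Some l \<and> slide_edge (clusters (shape s)) M E l"
      using l slide_edge_mono[OF _ cs] by blast
  qed
  then have "valid s" by (rule good_on_valid[OF o ag])
  moreover have "marks s = mset (slide_word k)" using marks_agrees[OF o ag] mM dc by (simp add: label_mset_def)
  ultimately have "s \<in> slide_strees k" using ts n(1) by (simp add: slide_strees_def)
  then show ?thesis using Tp by blast
qed

text \<open>The labels forgotten by \<open>planted\<close> are recovered because the slide labeling
  is determined by the tree.\<close>

lemma planted_inj:
  assumes "s \<in> slide_strees k" "t \<in> slide_strees k" "planted s = planted t"
  shows "s = t"
proof -
  obtain L where L: "slide_labeling k (planted s) = Some L" "agrees L s" "agrees L t"
    using slide_strees_Slide(2)[OF assms(1)] slide_strees_Slide(2)[OF assms(2)] assms(3) by auto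
  have m: "Leaf (-1) \<noteq> shape u" if "u \<in> slide_strees k" for u
  proof
    assume "Leaf (-1) = shape u"
    then have "tips u = {-1}" using leaves_shape[of u] by (metis tree.set(1))
    moreover have "0 \<in> tips u" using that by (simp add: slide_strees_def)
    ultimately show False by simp
  qed
  have "fset {|Leaf (-1), shape s|} = fset {|Leaf (-1), shape t|}" using assms(3) by (simp add: planted_def)
  then have "{Leaf (-1), shape s} = {Leaf (-1), shape t}" by simp
  then have "shape s = shape t" using m[OF assms(1)] m[OF assms(2)] by (auto simp: doubleton_eq_iff)
  then show ?thesis using assms L(2,3) valid_ordered by (intro shape_inj[of s t L]) (auto simp: slide_strees_def)
qed

section \<open>The insertion maps on marked trees\<close>

text \<open>
  For a valid tree \<open>pmins u\<close> is the list of the \<open>m\<^sub>r\<close> for the path to \<open>u\<close>, and \<open>turns u\<close>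
  consists of those that are smaller than \<open>u\<close>: only the last one can be larger.
\<close>

primrec pmins :: "'a \<Rightarrow> 'a stree \<Rightarrow> 'a list" where
  "pmins u (Tip x) = []"
| "pmins u (Fork l e r) =
     (if u \<in> tips l then (if is_Tip l then [head r] else pmins u l) else head l # pmins u r)"

primrec turns :: "'a \<Rightarrow> 'a stree \<Rightarrow> 'a list" where
  "turns u (Tip x) = []"
| "turns u (Fork l e r) = (if u \<in> tips l then turns u l else head l # turns u r)"

primrec spath :: "'a \<Rightarrow> 'a stree \<Rightarrow> 'a stree list" where
  "spath u (Tip x) = []"
| "spath u (Fork l e r) = Fork l e r # (if u \<in> tips l then spath u l else spath u r)"

fun root_mark :: "'a stree \<Rightarrow> 'a" where
  "root_mark (Fork l e r) = e"
| "root_mark (Tip x) = x"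

fun off_head :: "'a \<Rightarrow> 'a stree \<Rightarrow> 'a" where
  "off_head u (Fork l e r) = (if u \<in> tips l then head r else head l)"
| "off_head u (Tip x) = x"

text \<open>Recursive form of the positions used in \<open>path_mins\<close>. The \<open>- 1\<close>
  reflects that \<open>vs\<close> omits the top vertex of the path, which has number 0.\<close>

fun run_ends :: "'a list \<Rightarrow> 'b list list \<Rightarrow> 'a list" where
  "run_ends vs [] = []"
| "run_ends vs (xs # rs) = vs ! (length xs - 1) # run_ends (drop (length xs) vs) rs"

lemma run_ends_map:
  assumes "[] \<notin> set rs" "sum_list (map length rs) \<le> length vs"
  shows "map (\<lambda>q. vs ! (sum_list (map length (take q rs)) - 1)) [1..<Suc (length rs)] = run_ends vs rs"
  using assms
proof (induction rs arbitrary: vs)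
  case (Cons xs rs)
  have xs: "0 < length xs" using Cons.prems(1) by auto
  have "map (\<lambda>q. vs ! (sum_list (map length (take (Suc q) (xs # rs))) - 1)) [1..<Suc (length rs)] =
      map (\<lambda>q. drop (length xs) vs ! (sum_list (map length (take q rs)) - 1)) [1..<Suc (length rs)]"
  proof (rule map_cong[OF refl])
    fix q assume "q \<in> set [1..<Suc (length rs)]"
    then have q: "1 \<le> q" "q \<le> length rs" by auto
    then obtain ys rs' where "rs = ys # rs'" by (cases rs) auto
    then have "0 < sum_list (map length (take q rs))" using Cons.prems(1) q by (cases q) auto
    then show "vs ! (sum_list (map length (take (Suc q) (xs # rs))) - 1) =
        drop (length xs) vs ! (sum_list (map length (take q rs)) - 1)"
      using Cons.prems(2) by simp
  qed
  also have "\<dots> = run_ends (drop (length xs) vs) rs" using Cons by (intro Cons.IH) auto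
  finally have "map (\<lambda>q. vs ! (sum_list (map length (take q (xs # rs))) - 1)) (map Suc [1..<Suc (length rs)]) =
      run_ends (drop (length xs) vs) rs" by (simp only: map_map comp_def)
  moreover have "[1..<Suc (length (xs # rs))] = 1 # map Suc [1..<Suc (length rs)]"
    by (simp add: map_Suc_upt upt_conv_Cons del: upt_Suc)
  ultimately show ?case by (simp del: upt_Suc)
qed simp

lemma dec_runs_props: "[] \<notin> set (dec_runs xs) \<and> concat (dec_runs xs) = xs"
proof (induction xs rule: dec_runs.induct)
  case (3 x y zs)
  then have ne: "dec_runs (y # zs) \<noteq> []" by auto
  then show ?case using 3 by (cases "dec_runs (y # zs)") (auto simp: Let_def)
qed auto

lemma length_dec_runs: "sum_list (map length (dec_runs xs)) = length xs"
  using dec_runs_props[of xs] length_concat[of "dec_runs xs"] by simp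

lemma open_le_root: "x \<in> open_tips (Fork l e r) \<Longrightarrow> x \<le> e"
  by simp

text \<open>On a step to the left the label drops by \<open>mark_less\<close>; on a step to the
  right it does not, since \<open>e\<close> is open in the right branch. So the runs end exactly at
  the right turns and at the neighbour of \<open>u\<close>.\<close>

lemma run_ends_pmins:
  "valid t \<Longrightarrow> u \<in> tips t \<Longrightarrow>
    run_ends (map (off_head u) (spath u t)) (dec_runs (map root_mark (spath u t))) = pmins u t"
proof (induction t)
  case (Fork l e r)
  have v: "valid l" "valid r" "mark_less l e" "e \<in> open_tips r" using Fork.prems by auto
  show ?case
  proof (cases "u \<in> tips l")
    case True
    note IH = Fork.IH(1)[OF v(1) True]
    show ?thesis
    proof (cases l)
      case (Tip x)
      then show ?thesis using True by simp
    next
      case f: (Fork l1 e1 r1)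
      let ?ls = "map root_mark (spath u l)"
      obtain zs where ls: "?ls = e1 # zs" using f by simp
      have lt: "e1 < e" using v(3) f by simp
      obtain x xs rs where rs: "dec_runs ?ls = (x # xs) # rs"
        using dec_runs_props[of ?ls] ls by (cases "dec_runs ?ls"; cases "hd (dec_runs ?ls)") auto
      have "dec_runs (e # ?ls) = (e # x # xs) # rs"
        using rs lt unfolding ls by (simp add: Let_def)
      then show ?thesis using IH True f rs by simp
    qed
  next
    case False
    then have ur: "u \<in> tips r" using Fork.prems by simp
    note IH = Fork.IH(2)[OF v(2) ur]
    show ?thesis
    proof (cases r)
      case (Tip x)
      then show ?thesis using False by simp
    next
      case f: (Fork l1 e1 r1)
      let ?ls = "map root_mark (spath u r)"
      obtain zs where ls: "?ls = e1 # zs" using f by simp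
      have "\<not> e1 < e" using v(4) f open_le_root[of e l1 e1 r1] by simp
      then have "dec_runs (e # ?ls) = [e] # dec_runs ?ls" unfolding ls by (simp add: Let_def)
      then show ?thesis using IH False by simp
    qed
  qed
qed simp

lemma path_shape:
  assumes "ordered t" "u \<in> tips t" "\<not> is_Tip t"
  shows "path (shape t) u = map shape (spath u t)"
  using assms
proof (induction t)
  case (Fork l e r)
  have o: "ordered l" "ordered r" "tips l \<inter> tips r = {}" using Fork.prems by auto
  have d: "disjoint_tree (Node {|shape l, shape r|})" using proper_shape[OF Fork.prems(1)] by simp
  have step: "path (Node {|shape l, shape r|}) u = Node {|shape l, shape r|} # map shape (spath u c)"
    if c: "c = l \<or> c = r" "u \<in> tips c" "\<not> is_Tip c \<Longrightarrow> path (shape c) u = map shape (spath u c)" for c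
  proof (cases c)
    case (Tip x)
    then have "Leaf u \<in> fset {|shape l, shape r|}" using c by auto
    then show ?thesis using path_Node_Leaf[OF d] Tip by simp
  next
    case f: (Fork l1 e1 r1)
    have "shape c \<in> fset {|shape l, shape r|}" using c(1) by auto
    then have "path (Node {|shape l, shape r|}) u = Node {|shape l, shape r|} # path (shape c) u"
      using path_Node_Node[OF d, of "{|shape l1, shape r1|}" u] c(2) f by simp
    then show ?thesis using c(3) f by simp
  qed
  show ?case
  proof (cases "u \<in> tips l")
    case True
    then show ?thesis using step[of l] Fork.IH(1) o by simp
  next
    case False
    then show ?thesis using step[of r] Fork.IH(2) o Fork.prems by simp
  qed
qed simp

lemma disjoint_planted: "ordered t \<Longrightarrow> -1 \<notin> tips t \<Longrightarrow> disjoint_tree (planted t)"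
  using proper_planted proper_tree.disjoint by blast

lemma path_planted:
  assumes "ordered t" "u \<in> tips t" "-1 \<notin> tips t"
  shows "path (planted t) u = planted t # map shape (spath u t)"
proof (cases t)
  case (Tip x)
  then show ?thesis using path_Node_Leaf[of "{|Leaf (-1), shape t|}" u] disjoint_planted[OF assms(1,3)] assms(2)
    by (simp add: planted_def)
next
  case (Fork l e r)
  then have "path (planted t) u = planted t # path (shape t) u"
    using path_Node_Node[of "{|Leaf (-1), shape t|}" "{|shape l, shape r|}" u]
      disjoint_planted[OF assms(1,3)] assms(2) by (simp add: planted_def)
  then show ?thesis using path_shape[OF assms(1,2)] Fork by simp
qed

lemma in_spath: "v \<in> set (spath u t) \<Longrightarrow> u \<in> tips t \<Longrightarrow> \<not> is_Tip v \<and> u \<in> tips v"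
  by (induction t) (auto split: if_splits)

lemma ordered_spath: "ordered t \<Longrightarrow> v \<in> set (spath u t) \<Longrightarrow> ordered v"
  by (induction t) (auto split: if_splits)

lemma agrees_spath: "agrees L t \<Longrightarrow> v \<in> set (spath u t) \<Longrightarrow> L (tips v) = Some (root_mark v)"
  by (induction t) (auto split: if_splits)

lemma off_branch_shape:
  assumes "ordered v" "u \<in> tips v" "\<not> is_Tip v"
  shows "Min (leaves (off_branch (shape v) u)) = off_head u v"
proof (cases v)
  case (Fork l e r)
  have d: "tips l \<inter> tips r = {}" "ordered l" "ordered r" using assms(1) Fork by auto
  let ?c = "if u \<in> tips l then r else l"
  have "off_branch (shape v) u = shape ?c"
    unfolding off_branch_def
  proof (rule the_equality)
    show "shape ?c \<in> children (shape v) \<and> u \<notin> leaves (shape ?c)" using Fork d by auto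
  next
    fix t assume "t \<in> children (shape v) \<and> u \<notin> leaves t"
    then show "t = shape ?c" using Fork assms(2) by auto
  qed
  then show ?thesis using Min_tips[OF d(2)] Min_tips[OF d(3)] Fork by simp
qed (use assms in simp)

lemma path_mins_pmins:
  assumes "valid t" "agrees L t" "u \<in> tips t" "-1 \<notin> tips t"
  shows "path_mins L (planted t) u = pmins u t"
proof -
  note o = valid_ordered[OF assms(1)]
  let ?s = "spath u t"
  have p: "path (planted t) u = planted t # map shape ?s" by (rule path_planted[OF o assms(3,4)])
  have "map (\<lambda>v. the (L (leaves v))) (map shape ?s) = map root_mark ?s"
    using agrees_spath[OF assms(2)] by simp
  then have rs: "path_runs L (planted t) u = dec_runs (map root_mark ?s)"
    unfolding path_runs_def p by (simp only: list.sel)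
  let ?rs = "dec_runs (map root_mark ?s)"
  have ne: "[] \<notin> set ?rs" and len: "sum_list (map length ?rs) \<le> length (map (off_head u) ?s)"
    using dec_runs_props[of "map root_mark ?s"] length_dec_runs[of "map root_mark ?s"] by auto
  have "path_mins L (planted t) u =
      map (\<lambda>q. map (off_head u) ?s ! (sum_list (map length (take q ?rs)) - 1)) [1..<Suc (length ?rs)]"
    unfolding path_mins_def rs Let_def p
  proof (rule map_cong[OF refl])
    fix q assume "q \<in> set [1..<Suc (length ?rs)]"
    then have q: "1 \<le> q" "q \<le> length ?rs" by auto
    let ?m = "sum_list (map length (take q ?rs))"
    obtain ys rs' where r: "?rs = ys # rs'" using q by (cases ?rs) auto
    then have "ys \<noteq> []" using ne by auto
    then have "0 < ?m" using q unfolding r by (cases q) auto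
    moreover have "?m \<le> length ?s"
    proof -
      have "sum_list (map length ?rs) = ?m + sum_list (map length (drop q ?rs))"
        by (metis append_take_drop_id map_append sum_list_append)
      then show ?thesis using len by simp
    qed
    ultimately obtain m where m: "?m = Suc m" "m < length ?s" by (cases ?m) auto
    have v: "?s ! m \<in> set ?s" using m(2) by simp
    \<comment> \<open>Position 0 is the planted top vertex, so position \<open>?m = Suc m\<close> is
      entry \<open>m\<close> of \<open>spath\<close>.\<close>
    have "(planted t # map shape ?s) ! ?m = shape (?s ! m)" using m by simp
    then show "Min (leaves (off_branch ((planted t # map shape ?s) ! ?m) u)) =
        map (off_head u) ?s ! (?m - 1)"
      using off_branch_shape[OF ordered_spath[OF o v], of u] in_spath[OF v assms(3)] m by simp
  qed
  also have "\<dots> = run_ends (map (off_head u) ?s) ?rs" by (rule run_ends_map[OF ne len])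
  also have "\<dots> = pmins u t" by (rule run_ends_pmins[OF assms(1,3)])
  finally show ?thesis .
qed

lemma turns_in_tips: "set (turns u t) \<subseteq> tips t"
  by (induction t) auto

lemma turns_sorted:
  "valid t \<Longrightarrow> u \<in> tips t \<Longrightarrow> sorted_wrt (<) (turns u t @ [u]) \<and> (\<forall>x \<in> set (turns u t). head t \<le> x)"
proof (induction t)
  case (Fork l e r)
  then show ?case
  proof (cases "u \<in> tips l")
    case False
    then have ur: "u \<in> tips r" using Fork.prems by simp
    have "valid r" "head l < head r" using Fork.prems by auto
    moreover from this have "head r \<le> u" using head_le ur by blast
    ultimately show ?thesis using Fork.IH(2) ur False by fastforce
  qed auto
qed simp

text \<open>The additional entry arises when \<open>u\<close> is a left tip and is then the minimum
  of its sibling. This separates the cases \<open>m\<^sub>l < j\<close> and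
  \<open>j < m\<^sub>l\<close> of \<open>sigma2\<close>.\<close>

lemma pmins_turns:
  assumes "valid t" "u \<in> tips t" "\<not> is_Tip t"
  shows "pmins u t = turns u t \<and> turns u t \<noteq> [] \<or>
    (\<exists>m \<in> tips t. pmins u t = turns u t @ [m] \<and> u < m)"
  using assms
proof (induction t)
  case (Fork l e r)
  then show ?case
  proof (cases "u \<in> tips l")
    case True
    show ?thesis
    proof (cases "is_Tip l")
      case T: True
      then show ?thesis using True Fork.prems by (cases l) auto
    next
      case False
      then show ?thesis using Fork.IH(1) Fork.prems True by auto
    qed
  next
    case False
    then have ur: "u \<in> tips r" "valid r" using Fork.prems by auto
    show ?thesis
    proof (cases "is_Tip r")
      case T: True
      then show ?thesis using False by (cases r) auto
    next
      case F: False
      then show ?thesis using Fork.IH(2)[OF ur(2,1) F] False by auto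
    qed
  qed
qed simp

section \<open>The map \<open>sigma2\<close> on marked trees\<close>

lemma shift_chain_Nil [simp]: "shift_chain i [] x = x"
  by (simp add: shift_chain_def)

lemma shift_chain_Cons: "shift_chain i (m # ms) x = (if x = m then i else shift_chain m ms x)"
  by (cases ms) (auto simp: shift_chain_def)

lemma shift_chain_id: "x \<notin> set ms \<Longrightarrow> shift_chain i ms x = x"
  by (induction ms arbitrary: i) (auto simp: shift_chain_Cons)

lemma graft_id: "x \<notin> leaves T \<Longrightarrow> graft x y T = T"
proof (induction T)
  case (Node ts)
  then have "graft x y |`| ts = id |`| ts" by (intro fset.map_cong) auto
  then show ?case by simp
qed simp

lemma shape_set_head: "ordered t \<Longrightarrow>
  shape (set_head x t) = relabel (\<lambda>y. if y = head t then x else y) (shape t)"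
proof (induction t)
  case (Fork l e r)
  have "head l \<notin> tips r" using Fork.prems head_in_tips[of l] unfolding ordered.simps by blast
  then have "relabel (\<lambda>y. if y = head l then x else y) (shape r) = relabel id (shape r)"
    by (intro tree.map_cong) auto
  then show ?case using Fork by (simp add: tree.map_id)
qed simp

lemma relabel_id_on: "(\<And>y. y \<in> leaves T \<Longrightarrow> f y = y) \<Longrightarrow> relabel f T = T"
  using tree.map_cong[of T T f id] by (simp add: tree.map_id)

text \<open>\<open>ins\<close> moves one minimum at each right turn, \<open>shift_chain\<close> all
  of them at once. They agree because the branches left behind are disjoint from the rest of the
  path.\<close>

lemma shape_ins:
  assumes "valid t" "j \<in> tips t" "x < head t"
  shows "shape (ins j t x) = graft j (last (x # turns j t)) (relabel (shift_chain x (turns j t)) (shape t))"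
  using assms
proof (induction t arbitrary: x)
  case (Tip y)
  then show ?case by (simp add: finsert_commute)
next
  case (Fork l e r)
  have v: "valid l" "valid r" "tips l \<inter> tips r = {}" "head l < head r" using Fork.prems by auto
  show ?case
  proof (cases "j \<in> tips l")
    case True
    have jr: "j \<notin> tips r" using True v by auto
    have "relabel (shift_chain x (turns j l)) (shape r) = shape r"
      using turns_in_tips[of j l] v by (intro relabel_id_on shift_chain_id) auto
    then show ?thesis using Fork.IH(1)[OF v(1) True, of x] Fork.prems(3) True jr by (simp add: graft_id)
  next
    case False
    then have jr: "j \<in> tips r" using Fork.prems by simp
    have hl: "head l \<notin> tips r" using head_notin_right[OF Fork.prems(1)] .
    have xj: "x \<noteq> j" using head_le[OF Fork.prems(1,2)] Fork.prems(3) by auto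
    have "relabel (shift_chain x (head l # turns j r)) (shape l) = relabel (\<lambda>y. if y = head l then x else y) (shape l)"
    proof (intro tree.map_cong refl)
      fix z assume "z \<in> leaves (shape l)"
      then have "z \<notin> set (turns j r)" using turns_in_tips[of j r] v(3) by auto
      then show "shift_chain x (head l # turns j r) z = (if z = head l then x else z)"
        by (simp add: shift_chain_Cons shift_chain_id)
    qed
    then have "relabel (shift_chain x (head l # turns j r)) (shape l) = shape (set_head x l)"
      using shape_set_head[OF valid_ordered[OF v(1)]] by simp
    moreover have "j \<notin> leaves (shape (set_head x l))" using False xj tips_set_head[OF v(1)] by simp
    moreover have "relabel (shift_chain x (head l # turns j r)) (shape r) = relabel (shift_chain (head l) (turns j r)) (shape r)"
      using hl by (intro tree.map_cong refl) (auto simp: shift_chain_Cons)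
    ultimately show ?thesis using Fork.IH(2)[OF v(2) jr v(4)] False by (simp add: graft_id)
  qed
qed

lemma shape_place:
  assumes "valid t" "j \<in> tips t" "i \<notin> tips t" "i < j"
  defines "c \<equiv> filter ((<) i) (turns j t)"
  shows "shape (place i j t) = graft j (last (i # c)) (relabel (shift_chain i c) (shape t))"
  using assms(1-3) unfolding c_def
proof (induction t)
  case (Tip y)
  then show ?case using assms(4) by (simp add: finsert_commute)
next
  case (Fork l e r)
  have v: "valid l" "valid r" "tips l \<inter> tips r = {}" "head l < head r" using Fork.prems by auto
  show ?case
  proof (cases "i < head l")
    case True
    have "filter ((<) i) (turns j (Fork l e r)) = turns j (Fork l e r)"
      using turns_sorted[OF Fork.prems(1,2)] True by (intro filter_True) fastforce
    then show ?thesis using shape_ins[OF Fork.prems(1,2), of i] True by simp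
  next
    case F: False
    show ?thesis
    proof (cases "j \<in> tips l")
      case True
      have jr: "j \<notin> tips r" using True v by auto
      have "relabel (shift_chain i (filter ((<) i) (turns j l))) (shape r) = shape r"
        using turns_in_tips[of j l] v by (intro relabel_id_on shift_chain_id) auto
      then show ?thesis using Fork.IH(1)[OF v(1) True] Fork.prems(3) True jr F by (simp add: graft_id)
    next
      case False
      then have jr: "j \<in> tips r" using Fork.prems by simp
      have "relabel (shift_chain i (filter ((<) i) (turns j r))) (shape l) = shape l"
        using turns_in_tips[of j r] v by (intro relabel_id_on shift_chain_id) auto
      then show ?thesis using Fork.IH(2)[OF v(2) jr] Fork.prems(3) False F by (simp add: graft_id)
    qed
  qed
qed

lemma sorted_insert_split:
  fixes xs :: "int list"
  assumes "sorted_wrt (<) xs" "i \<notin> set xs"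
  shows "xs = filter (\<lambda>x. x < i) xs @ filter ((<) i) xs"
  using assms
proof (induction xs)
  case (Cons x xs)
  show ?case
  proof (cases "x < i")
    case False
    then have "i < x" using Cons.prems(2) by auto
    then have "\<forall>y \<in> set xs. i < y" using Cons.prems(1) by auto
    then have "filter (\<lambda>x. x < i) xs = []" "filter ((<) i) xs = xs" by (auto simp: filter_empty_conv)
    then show ?thesis using \<open>i < x\<close> by simp
  qed (use Cons in simp)
qed simp

text \<open>Provides the uniqueness behind \<open>THE d\<close> in \<open>sigma2\<close>.\<close>

lemma sorted_insert_position:
  fixes xs :: "int list"
  assumes "sorted_wrt (<) (take d xs @ [i] @ drop d xs)" "d \<le> length xs"
  shows "d = length (filter (\<lambda>x. x < i) xs)"
proof -
  have "filter (\<lambda>x. x < i) (take d xs @ drop d xs) = take d xs"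
    using assms(1) by (subst filter_append) (auto simp: sorted_wrt_append filter_empty_conv)
  then show ?thesis using assms(2) by simp
qed

text \<open>The three cases have one description: shift along the list \<open>c\<close> of turns
  above \<open>i\<close> and graft at its last element, or at \<open>i\<close> if \<open>c\<close>
  is empty. The first case is \<open>c = []\<close>; the other two differ in whether
  \<open>ms\<close> has a last entry above \<open>j\<close> beyond the turns.\<close>

lemma sigma2_place:
  assumes "slide_labeling h S = Some L" "relabel (bump i) S = planted t"
    and agr: "agrees (bump_labeling i L) t"
    and "valid t" "j \<in> tips t" "i \<notin> tips t" "i < j" "-1 \<notin> tips t" "\<not> is_Tip t"
  shows "sigma2 h i j S = planted (place i j t)"
proof -
  define ms where "ms = path_mins (bump_labeling i L) (planted t) j"
  define em where "em = turns j t"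
  define c where "c = filter ((<) i) em"
  have ms: "ms = pmins j t" unfolding ms_def by (rule path_mins_pmins[OF assms(4) agr assms(5,8)])
  have es: "sorted_wrt (<) (em @ [j])" using turns_sorted[OF assms(4,5)] by (simp add: em_def)
  have ei: "i \<notin> set em" using turns_in_tips[of j t] assms(6) by (auto simp: em_def)
  have split: "em = filter (\<lambda>x. x < i) em @ c"
    unfolding c_def using es ei by (intro sorted_insert_split) (auto simp: sorted_wrt_append)
  have es': "sorted_wrt (<) (filter (\<lambda>x. x < i) em @ [i] @ c @ [j])"
  proof -
    define as where "as = filter (\<lambda>x. x < i) em"
    have "sorted_wrt (<) ((as @ c) @ [j])" using es split unfolding as_def by simp
    then have "sorted_wrt (<) as" "sorted_wrt (<) c" "\<forall>x \<in> set as. x < j" "\<forall>x \<in> set c. x < j"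
      "\<forall>x \<in> set as. \<forall>y \<in> set c. x < y"
      unfolding sorted_wrt_append by simp_all
    moreover have "\<forall>x \<in> set as. x < i" "\<forall>x \<in> set c. i < x" by (simp_all add: as_def c_def)
    ultimately have "sorted_wrt (<) (as @ [i] @ c @ [j])" using assms(7)
      unfolding sorted_wrt_append by simp
    then show ?thesis unfolding as_def .
  qed
  let ?d = "length (filter (\<lambda>x. x < i) em)"
  have td: "take ?d em = filter (\<lambda>x. x < i) em" "drop ?d em = c"
    by (metis split append_eq_conv_conj)+
  have "planted (place i j t) = Node {|Leaf (-1), graft j (last (i # c)) (relabel (shift_chain i c) (shape t))|}"
    unfolding planted_def c_def em_def by (simp only: shape_place[OF assms(4-7)])
  moreover have "shift_chain i c (-1) = -1"
  proof -
    have "-1 \<notin> set c" using turns_in_tips[of j t] assms(8) by (auto simp: c_def em_def)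
    then show ?thesis by (rule shift_chain_id)
  qed
  moreover have "j \<noteq> -1" using assms(5,8) by auto
  ultimately have res: "planted (place i j t) = graft j (last (i # c)) (relabel (shift_chain i c) (planted t))"
    by (simp add: planted_def)
  let ?case2 = "\<lambda>d. d < length ms \<and> sorted_wrt (<) (take d ms @ [i] @ drop d ms @ [j])"
  let ?case3 = "\<lambda>d. d < length ms - 1 \<and>
      sorted_wrt (<) (take d ms @ [i] @ drop d (butlast ms) @ [j, last ms])"
  let ?simple = "(last ms < i \<and> i < j) \<or>
      ((length ms = 1 \<or> ms ! (length ms - 2) < i) \<and> i < j \<and> j < last ms)"
  have def: "sigma2 h i j S = (if ?simple then graft j i (planted t)
      else if \<exists>d. ?case2 d then
        graft j (last (drop (THE d. ?case2 d) ms)) (relabel (shift_chain i (drop (THE d. ?case2 d) ms)) (planted t))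
      else if \<exists>d. ?case3 d then
        graft j (last (drop (THE d. ?case3 d) (butlast ms)))
          (relabel (shift_chain i (drop (THE d. ?case3 d) (butlast ms))) (planted t))
      else undefined)"
    unfolding sigma2_def assms(1,2) Let_def option.sel ms_def[symmetric] by (rule refl)
  have c0: "c = [] \<longleftrightarrow> (em = [] \<or> last em < i)"
  proof
    assume "c = []"
    then have "\<forall>x \<in> set em. \<not> i < x" by (simp add: c_def filter_empty_conv)
    then show "em = [] \<or> last em < i" using ei by (metis last_in_set linorder_neqE)
  next
    assume a: "em = [] \<or> last em < i"
    show "c = []"
    proof (rule ccontr)
      assume n: "c \<noteq> []"
      then have "last em = last c" "last c \<in> set c" using split by (metis last_appendR, simp)
      then show False using a n split by (auto simp: c_def)
    qed
  qed
  have relabel_Nil: "relabel (shift_chain i []) U = U" for U by (intro relabel_id_on) simp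
  from pmins_turns[OF assms(4,5,9)] ms
  consider (R) "ms = em" "em \<noteq> []" | (L) m where "ms = em @ [m]" "j < m"
    unfolding em_def by blast
  then show ?thesis
  proof cases
    case R
    have lj: "last em < j" using es R(2) by (simp add: sorted_wrt_append)
    have simple: "?simple \<longleftrightarrow> c = []" using R lj assms(7) c0 by auto
    show ?thesis
    proof (cases "c = []")
      case True
      then show ?thesis using def simple res relabel_Nil by simp
    next
      case False
      have c2: "?case2 ?d" using es' td False split R by (metis append.assoc length_append less_add_same_cancel1 length_greater_0_conv)
      have uniq: "d = ?d" if "?case2 d" for d
      proof (rule sorted_insert_position)
        show "sorted_wrt (<) (take d em @ [i] @ drop d em)" "d \<le> length em"
          using that R by (auto simp: sorted_wrt_append)
      qed
      have "(THE d. ?case2 d) = ?d" using c2 uniq by (rule the_equality)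
      then show ?thesis using def simple False c2 res td R by auto
    qed
  next
    case L
    have lm: "last ms = m" "butlast ms = em" "length ms = Suc (length em)" using L by auto
    have l2: "em \<noteq> [] \<Longrightarrow> ms ! (length ms - 2) = last em"
      using L by (simp add: nth_append last_conv_nth)
    have simple: "?simple \<longleftrightarrow> c = []"
    proof (cases "em = []")
      case False
      show ?thesis using l2[OF False] False lm assms(7) L(2) c0 by simp
    qed (use L assms(7) c0 lm in simp)
    have n2: "\<not> ?case2 d" for d
    proof
      assume a: "?case2 d"
      then have "drop d ms = drop d em @ [m]" using L by simp
      then show False using a L(2) by (simp add: sorted_wrt_append)
    qed
    show ?thesis
    proof (cases "c = []")
      case True
      then show ?thesis using def simple res relabel_Nil by simp
    next
      case False
      have dl: "?d < length em" using split False by (metis length_append less_add_same_cancel1 length_greater_0_conv)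
      have tk: "take d ms = take d em" if "d < length ms - 1" for d using that L by simp
      have c3: "?case3 ?d"
      proof -
        have "take ?d ms @ [i] @ drop ?d (butlast ms) @ [j, last ms] = (filter (\<lambda>x. x < i) em @ [i] @ c @ [j]) @ [m]"
          using tk[of ?d] dl lm td by simp
        moreover have "sorted_wrt (<) ((filter (\<lambda>x. x < i) em @ [i] @ c @ [j]) @ [m])"
        proof -
          have "\<forall>x \<in> set (filter (\<lambda>x. x < i) em @ [i] @ c @ [j]). x \<le> j"
            using es' by (auto simp: sorted_wrt_append less_imp_le)
          then show ?thesis using es' L(2) by (subst sorted_wrt_append) fastforce
        qed
        ultimately show ?thesis using dl lm by simp
      qed
      have uniq: "d = ?d" if "?case3 d" for d
      proof (rule sorted_insert_position)
        show "sorted_wrt (<) (take d em @ [i] @ drop d em)" "d \<le> length em"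
          using that tk[of d] lm by (auto simp: sorted_wrt_append)
      qed
      have "(THE d. ?case3 d) = ?d" using c3 uniq by (rule the_equality)
      then show ?thesis using def simple False n2 c3 res td lm by auto
    qed
  qed
qed

section \<open>The last leaf as the end of a chain\<close>

primrec min2_stree :: "'a :: linorder stree \<Rightarrow> 'a stree" where
  "min2_stree (Tip x) = Tip x"
| "min2_stree (Fork l e r) = (if \<not> is_Tip l \<and> chain l ! 1 < head r then min2_stree l else r)"

primrec substrees :: "'a stree \<Rightarrow> 'a stree set" where
  "substrees (Tip x) = {Tip x}"
| "substrees (Fork l e r) = insert (Fork l e r) (substrees l \<union> substrees r)"

lemma subtrees_shape: "subtrees (shape t) = shape ` substrees t"
  by (induction t) auto

lemma tips_substrees: "s \<in> substrees t \<Longrightarrow> tips s \<subseteq> tips t"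
  by (induction t) auto

lemma ordered_substrees: "ordered t \<Longrightarrow> s \<in> substrees t \<Longrightarrow> ordered s"
  by (induction t) auto

lemma substrees_refl [simp]: "t \<in> substrees t"
  by (cases t) auto

lemma chain_min2: "\<not> is_Tip t \<Longrightarrow> chain t = head t # chain (min2_stree t)"
  by (induction t) auto

lemma valid_min2: "valid t \<Longrightarrow> valid (min2_stree t)"
  by (induction t) auto

lemma min2_in_substrees: "min2_stree t \<in> substrees t"
  by (induction t) auto

lemma branch_in_substrees: "branch i t \<in> substrees t"
  by (induction t) auto

lemma substrees_psubset:
  assumes "ordered t" "s \<in> substrees t" shows "s = t \<or> tips s \<subset> tips t"
proof (cases t)
  case (Fork l e r)
  have "tips l \<inter> tips r = {}" using assms(1) Fork by simp
  then have "head r \<notin> tips l" "head l \<notin> tips r" by (metis disjoint_iff head_in_tips)+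
  then have "tips l \<subset> tips t" "tips r \<subset> tips t"
    unfolding Fork tips.simps using head_in_tips[of l] head_in_tips[of r] by blast+
  moreover have "s = t \<or> tips s \<subseteq> tips l \<or> tips s \<subseteq> tips r"
    using assms(2) Fork tips_substrees[of s l] tips_substrees[of s r] by auto
  ultimately show ?thesis by blast
qed (use assms in auto)

text \<open>A competing largest element contains all leaves of \<open>b\<close> and is itself a
  subtree of \<open>b\<close>; in an ordered tree a proper subtree has fewer leaves.\<close>

lemma largest_shape:
  assumes "ordered b" "b \<in> X" "\<And>b'. b' \<in> X \<Longrightarrow> b' \<in> substrees b"
  shows "largest (shape ` X) = shape b"
  unfolding largest_def
proof (rule the_equality)
  show "shape b \<in> shape ` X \<and> (\<forall>B'\<in>shape ` X. B' \<in> subtrees (shape b))"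
    using assms by (auto simp: subtrees_shape)
next
  fix B assume B: "B \<in> shape ` X \<and> (\<forall>B'\<in>shape ` X. B' \<in> subtrees B)"
  then obtain b' where b': "B = shape b'" "b' \<in> X" by blast
  have "shape b \<in> subtrees (shape b')" using B b' assms(2) by auto
  then obtain s where "s \<in> substrees b'" "shape b = shape s" by (auto simp: subtrees_shape)
  then have "tips b \<subseteq> tips b'" using tips_substrees leaves_shape by metis
  then show "B = shape b" using substrees_psubset[OF assms(1) assms(3)[OF b'(2)]] b'(1) by auto
qed

lemma head_min2: "\<not> is_Tip t \<Longrightarrow> head (min2_stree t) = chain t ! 1"
  using chain_min2[of t] chain_Cons[of "min2_stree t"] by (metis One_nat_def nth_Cons_0 nth_Cons_Suc)

lemma min2_shape:
  assumes "valid t" "\<not> is_Tip t"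
  shows "min2 (shape t) = shape (min2_stree t)"
proof -
  note o = valid_ordered[OF assms(1)]
  let ?q = "chain t ! 1"
  have p: "Min (leaves (shape t)) = head t" using Min_tips[OF o] by simp
  have q: "Min (leaves (shape t) - {head t}) = ?q"
  proof (rule Min_eqI)
    fix y assume "y \<in> leaves (shape t) - {head t}"
    then show "?q \<le> y" using chain_second[OF assms] by auto
  next
    have "?q \<in> tips t" using head_min2[OF assms(2)] head_in_tips[of "min2_stree t"]
        tips_substrees[OF min2_in_substrees, of t] by auto
    then show "?q \<in> leaves (shape t) - {head t}" using second_gt_head[OF assms] by simp
  qed simp
  let ?X = "{s \<in> substrees t. ?q \<in> tips s \<and> head t \<notin> tips s}"
  have S: "{B' \<in> subtrees (shape t). ?q \<in> leaves B' \<and> head t \<notin> leaves B'} = shape ` ?X"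
    by (auto simp: subtrees_shape)
  have hm: "head t \<notin> tips (min2_stree t)" if "valid t" "\<not> is_Tip t" for t :: "label stree"
    using that
  proof (induction t)
    case (Fork l e r)
    then show ?case using head_notin_right[OF Fork.prems(1)] by auto
  qed simp
  have sub: "s \<in> substrees (min2_stree t)"
    if "valid t" "\<not> is_Tip t" "s \<in> substrees t" "chain t ! 1 \<in> tips s" "head t \<notin> tips s" for s t :: "label stree"
    using that
  proof (induction t)
    case (Fork l e r)
    have v: "valid l" "valid r" "tips l \<inter> tips r = {}" using Fork.prems by auto
    have s: "s \<in> substrees l \<union> substrees r" using Fork.prems(3,5) head_in_tips[of l] by auto
    show ?case
    proof (cases "\<not> is_Tip l \<and> chain l ! 1 < head r")
      case True
      have "chain l ! 1 \<in> tips l" using True head_min2[of l] head_in_tips[of "min2_stree l"]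
        tips_substrees[OF min2_in_substrees, of l] by auto
      then have "s \<notin> substrees r" using tips_substrees[of s r] v(3) Fork.prems(4) True by auto
      then show ?thesis using Fork.IH(1)[OF v(1)] True s Fork.prems(4,5) by auto
    next
      case False
      have "chain r ! 0 = head r" by (metis chain_Cons nth_Cons_0)
      then have "head r \<in> tips s" using Fork.prems(4) False by (auto split: if_splits)
      then have "s \<notin> substrees l" using tips_substrees[of s l] v(3) head_in_tips[of r] by blast
      then show ?thesis using s False by auto
    qed
  qed simp
  have "largest (shape ` ?X) = shape (min2_stree t)"
  proof (rule largest_shape)
    show "ordered (min2_stree t)" using valid_ordered[OF valid_min2[OF assms(1)]] .
    show "min2_stree t \<in> ?X" using min2_in_substrees hm[OF assms] head_min2[OF assms(2)] head_in_tips[of "min2_stree t"] by auto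
    show "\<And>b'. b' \<in> ?X \<Longrightarrow> b' \<in> substrees (min2_stree t)" using sub[OF assms] by blast
  qed
  then show ?thesis unfolding min2_def Let_def p q S .
qed

lemma card_tips_ge: "valid t \<Longrightarrow> 2 \<le> card (tips t) \<longleftrightarrow> \<not> is_Tip t"
  using size_marks[of t] by (cases t) auto

lemma while_min2:
  "valid t \<Longrightarrow> while (\<lambda>B. 2 \<le> card (leaves B)) min2 (shape t) = Leaf (last (chain t))"
proof (induction "length (chain t)" arbitrary: t rule: less_induct)
  case less
  show ?case
  proof (cases "is_Tip t")
    case True
    then show ?thesis by (cases t) (auto simp: while_unfold)
  next
    case False
    have c: "chain t = head t # chain (min2_stree t)" by (rule chain_min2[OF False])
    then have "while (\<lambda>B. 2 \<le> card (leaves B)) min2 (shape (min2_stree t)) = Leaf (last (chain (min2_stree t)))"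
      using less.prems valid_min2 by (intro less.hyps) auto
    then show ?thesis using card_tips_ge[OF less.prems] False min2_shape[OF less.prems False] c
      by (subst while_unfold) simp
  qed
qed

lemma branch_largest:
  "ordered t \<Longrightarrow> i \<in> tips t \<Longrightarrow> s \<in> substrees t \<Longrightarrow> head s = i \<Longrightarrow> s \<in> substrees (branch i t)"
proof (induction t)
  case (Fork l e r)
  have o: "ordered l" "ordered r" "tips l \<inter> tips r = {}" using Fork.prems by auto
  have i: "i \<in> tips s" using Fork.prems(4) head_in_tips[of s] by simp
  show ?case
  proof (cases "head l = i")
    case False
    then have "s \<in> substrees l \<or> s \<in> substrees r" using Fork.prems(3,4) by auto
    moreover have "s \<in> substrees l \<Longrightarrow> i \<in> tips l" "s \<in> substrees r \<Longrightarrow> i \<in> tips r"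
      using i tips_substrees[of s] by blast+
    ultimately show ?thesis using Fork.IH o Fork.prems(4) False by auto
  qed (use Fork.prems in simp)
qed simp

lemma last_leaf_planted:
  assumes "valid t" "int (maxzero h) \<in> tips t" "-1 \<notin> tips t"
  shows "last_leaf h (planted t) = last (chain (branch (int (maxzero h)) t))"
proof -
  note o = valid_ordered[OF assms(1)]
  let ?i = "int (maxzero h)"
  have "planted t \<notin> subtrees (shape t)"
  proof
    assume "planted t \<in> subtrees (shape t)"
    then obtain s where "s \<in> substrees t" "planted t = shape s" by (auto simp: subtrees_shape)
    then have "leaves (planted t) \<subseteq> tips t" using tips_substrees leaves_shape by metis
    then show False using assms(3) by (simp add: leaves_planted)
  qed
  moreover have "Leaf (-1) \<notin> subtrees (shape t)"
  proof
    assume "Leaf (-1) \<in> subtrees (shape t)"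
    then obtain s where "s \<in> substrees t" "Leaf (-1) = shape s" by (auto simp: subtrees_shape)
    then have "{-1} \<subseteq> tips t" using tips_substrees leaves_shape by (metis tree.set(1))
    then show False using assms(3) by simp
  qed
  ultimately have br: "branches (planted t) = shape ` substrees t"
    unfolding branches_def by (auto simp: planted_def subtrees_shape)
  have "{B \<in> branches (planted t). Min (leaves B) = ?i} = shape ` {s \<in> substrees t. head s = ?i}"
  proof -
    have "Min (tips s) = head s" if "s \<in> substrees t" for s using Min_tips[OF ordered_substrees[OF o that]] .
    then show ?thesis unfolding br by (auto intro!: image_eqI)
  qed
  moreover have "largest (shape ` {s \<in> substrees t. head s = ?i}) = shape (branch ?i t)"
    using valid_ordered[OF valid_branch[OF assms(1)]] branch_in_substrees head_branch[OF assms(2)]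
      branch_largest[OF o assms(2)] by (intro largest_shape) auto
  ultimately show ?thesis unfolding last_leaf_def using while_min2[OF valid_branch[OF assms(1)]] by simp
qed

text \<open>The path to the end of the chain turns right precisely when the chain advances, so the
  list of the \<open>m\<^sub>r\<close> is the chain without its end.\<close>

lemma chain_end_cherry:
  assumes "valid t" "\<not> is_Tip t" "v = last (chain t)"
  shows "(\<exists>e. last (spath v t) = Fork (Tip (last (butlast (chain t)))) e (Tip v)) \<and>
    pmins v t = butlast (chain t)"
  using assms
proof (induction t)
  case (Fork l e r)
  note v = valid_ForkD[OF Fork.prems(1)]
  show ?case
  proof (cases "\<not> is_Tip l \<and> chain l ! 1 < head r")
    case True
    then have vl: "v = last (chain l)" "v \<in> tips l" using Fork.prems(3) last_chain_in_tips[of l] by auto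
    moreover have "spath v l \<noteq> []" using True by (cases l) auto
    ultimately show ?thesis using Fork.IH(1)[OF v(1) _ vl(1)] True by simp
  next
    case False
    then have vr: "v = last (chain r)" "v \<in> tips r" using Fork.prems(3) last_chain_in_tips[of r] by auto
    then have vl: "v \<notin> tips l" using v(3) by auto
    show ?thesis
    proof (cases r)
      case (Tip x)
      then have c: "\<not> (\<not> is_Tip l \<and> chain l ! 1 < x)" "x = v" using False vr by auto
      then obtain y where l: "l = Tip y" "e = x" using cherry_at_right_tip Fork.prems(1) unfolding Tip by blast
      then have x: "x = v" "e = v" using c by simp_all
      then show ?thesis using Tip l(1) vl by simp
    next
      case f: (Fork l1 e1 r1)
      then have "spath v r \<noteq> []" "butlast (chain r) \<noteq> []" "\<not> is_Tip r"
        using chain_min2[of r] by (auto simp del: chain.simps)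
      moreover have "chain (Fork l e r) = head l # chain r" using False by auto
      ultimately show ?thesis using Fork.IH(2)[OF v(2) _ vr(1)] vl by (simp del: chain.simps)
    qed
  qed
qed simp

text \<open>Every right turn above the branch passes a minimum below \<open>i\<close>, so the
  additional entries come first and do not disturb comparisons with a label above
  \<open>i\<close>.\<close>

lemma spath_branch:
  assumes "valid t" "i \<in> tips t" "v \<in> tips (branch i t)" "\<not> is_Tip (branch i t)"
  shows "last (spath v t) = last (spath v (branch i t)) \<and>
    (\<exists>pre. pmins v t = pre @ pmins v (branch i t) \<and> (\<forall>x \<in> set pre. x < i))"
  using assms
proof (induction t)
  case (Fork l e r)
  have v: "valid l" "valid r" "tips l \<inter> tips r = {}" "head l < head r" using Fork.prems by auto
  have ne: "spath v c \<noteq> []" if "\<not> is_Tip (branch i c)" for c using that by (cases c) auto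
  show ?case
  proof (cases "head l = i")
    case True
    then show ?thesis by auto
  next
    case False
    show ?thesis
    proof (cases "i \<in> tips l")
      case True
      have b: "branch i (Fork l e r) = branch i l" using True False by simp
      then have vl: "v \<in> tips l" using Fork.prems(3) tips_branch[of i l] by auto
      have "\<not> is_Tip l" using True False by (cases l) auto
      then show ?thesis using Fork.IH(1)[OF v(1) True] Fork.prems(3,4) b vl ne[of l] by simp
    next
      case nl: False
      then have ir: "i \<in> tips r" using Fork.prems by auto
      have b: "branch i (Fork l e r) = branch i r" using nl False by simp
      then have "v \<in> tips r" using Fork.prems(3) tips_branch[of i r] by auto
      then have vl: "v \<notin> tips l" using v(3) by auto
      have "head l < i" using v(4) head_le[OF v(2) ir] by simp
      from Fork.IH(2)[OF v(2) ir] Fork.prems(3,4) obtain pre where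
        "last (spath v r) = last (spath v (branch i r))" "pmins v r = pre @ pmins v (branch i r)" "\<forall>x \<in> set pre. x < i"
        unfolding b by blast
      then show ?thesis using b vl ne[of r] Fork.prems(4) \<open>head l < i\<close> by (auto intro!: exI[of _ "head l # pre"])
    qed
  qed
qed simp

lemma shape_sgraft: "shape (sgraft p j t) = graft p j (shape t)"
  by (induction t) auto

lemma planted_sgraft: "p \<noteq> -1 \<Longrightarrow> planted (sgraft p j t) = graft p j (planted t)"
  by (simp add: planted_def shape_sgraft)

lemma sigma1_graft:
  assumes "slide_labeling h S = Some L" "relabel (bump j) S = planted t"
    and agr: "agrees (bump_labeling j L) t"
    and last: "bump j (last_leaf h S) = last (chain (branch i t))"
    and "valid t" "i \<in> tips t" "j \<notin> tips t" "i < j" "-1 \<notin> tips t"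
  shows "sigma1 h j S = planted (sgraft (slot j (branch i t)) j t)"
proof -
  define ch where "ch = chain (branch i t)"
  define v where "v = last ch"
  define u where "u = (THE i. i < v \<and> Leaf i \<in> children (last (path (planted t) v)))"
  define ms where "ms = path_mins (bump_labeling j L) (planted t) v"
  let ?P = "\<lambda>d. Suc d < length ms \<and> ms ! d < j \<and> j < ms ! Suc d"
  have def: "sigma1 h j S = (if v < j then graft v j (planted t)
      else if u < j \<and> j < v then graft u j (planted t)
      else if j < u then graft (ms ! (THE d. ?P d)) j (planted t) else undefined)"
    unfolding sigma1_def assms(1,2) last Let_def option.sel u_def ms_def v_def ch_def by (rule refl)
  note vb = valid_branch[OF assms(5), of i]
  have hb: "head (branch i t) = i" by (rule head_branch[OF assms(6)])
  have sl: "slot j (branch i t) = last (takeWhile (\<lambda>x. x < j) ch)" by (simp add: slot_def ch_def)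
  have "slot j (branch i t) \<in> tips t" using slot_props(1)[of "branch i t" j] hb assms(8) tips_branch[of i t] by auto
  then have pl: "planted (sgraft (slot j (branch i t)) j t) = graft (slot j (branch i t)) j (planted t)"
    using assms(9) by (intro planted_sgraft) auto
  have sc: "sorted_wrt (<) ch" unfolding ch_def by (rule sorted_chain[OF vb])
  have ch_tips: "set ch \<subseteq> tips t" unfolding ch_def using chain_in_tips[of "branch i t"] tips_branch[of i t] by blast
  have chne: "ch \<noteq> []" by (simp add: ch_def)
  have vt: "v \<in> tips t" using ch_tips last_in_set[OF chne] by (auto simp: v_def)
  have le_v: "x \<le> v" if "x \<in> set ch" for x
  proof -
    have "ch = butlast ch @ [v]" using chne by (simp add: v_def)
    then show ?thesis using sc that by (metis UnE append_is_Nil_conv in_set_conv_decomp less_imp_le order_refl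
          set_append set_ConsD list.set_intros(1) sorted_wrt_append list.distinct(1) empty_iff list.set(1))
  qed
  show ?thesis
  proof (cases "v < j")
    case True
    then have "takeWhile (\<lambda>x. x < j) ch = ch" using le_v by (fastforce simp: takeWhile_eq_all_conv)
    then have "slot j (branch i t) = v" unfolding sl v_def by (simp only:)
    then show ?thesis using def True pl by simp
  next
    case False
    then have jv: "j < v" using assms(7) vt by (metis linorder_neqE)
    have nt: "\<not> is_Tip (branch i t)"
    proof
      assume "is_Tip (branch i t)"
      then have "ch = [i]" using chain_Tip[of "branch i t"] hb by (simp add: ch_def)
      then show False using jv assms(8) v_def by simp
    qed
    have vbr: "v \<in> tips (branch i t)" using last_chain_in_tips by (simp add: v_def ch_def)
    define w where "w = last (butlast ch)"
    have "v = last (chain (branch i t))" by (simp add: v_def ch_def)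
    from chain_end_cherry[OF vb nt this] obtain e where
      e: "last (spath v (branch i t)) = Fork (Tip w) e (Tip v)" and pb: "pmins v (branch i t) = butlast ch"
      by (auto simp: w_def ch_def)
    from spath_branch[OF assms(5,6) vbr nt] e obtain pre where
      et: "last (spath v t) = Fork (Tip w) e (Tip v)"
      and pt: "pmins v t = pre @ butlast ch" and pre: "\<forall>x \<in> set pre. x < i" unfolding pb by auto
    have ms: "ms = pre @ butlast ch"
      unfolding ms_def path_mins_pmins[OF assms(5) agr vt assms(9)] by (rule pt)
    have "\<not> is_Tip t" using nt by (cases t) auto
    then have "spath v t \<noteq> []" by (cases t) auto
    then have lp: "last (path (planted t) v) = Node {|Leaf w, Leaf v|}"
      using et path_planted[OF valid_ordered[OF assms(5)] vt assms(9)] by (simp add: last_map)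
    have ch2: "ch = butlast ch @ [v]" using chne by (simp add: v_def)
    have bne: "butlast ch \<noteq> []" using chain_min2[OF nt] by (simp add: ch_def)
    then have wch: "w \<in> set (butlast ch)" by (simp add: w_def)
    have wv: "w < v" using sc wch ch2 by (metis sorted_wrt_append list.set_intros(1))
    have u: "u = w" unfolding u_def lp using wv by (intro the_equality) auto
    have hd_ch: "hd ch = i" using hb by (simp add: ch_def)
    have bl: "hd (butlast ch) = i" using bne ch2 hd_ch by (metis hd_append2)
    have sb: "sorted_wrt (<) (butlast ch)" using sc ch2 by (metis sorted_wrt_append)
    have tw: "takeWhile (\<lambda>x. x < j) ch = takeWhile (\<lambda>x. x < j) (butlast ch)"
    proof (cases "\<forall>x \<in> set (butlast ch). x < j")
      case True
      then have e: "takeWhile (\<lambda>x. x < j) (butlast ch) = butlast ch" by (simp only: takeWhile_eq_all_conv)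
      show ?thesis unfolding e using True jv by (subst ch2) simp
    next
      case False
      then show ?thesis by (subst ch2) (auto simp: takeWhile_append)
    qed
    show ?thesis
    proof (cases "w < j")
      case True
      have "x \<le> w" if "x \<in> set (butlast ch)" for x
      proof -
        have "butlast ch = butlast (butlast ch) @ [w]" using bne by (simp add: w_def)
        then show ?thesis using sb that by (metis UnE append_is_Nil_conv less_imp_le order_refl
          set_append set_ConsD list.set_intros(1) sorted_wrt_append list.distinct(1) empty_iff list.set(1))
      qed
      then have "takeWhile (\<lambda>x. x < j) (butlast ch) = butlast ch" using True by (fastforce simp: takeWhile_eq_all_conv)
      then have "slot j (branch i t) = w" unfolding sl tw w_def by (simp only:)
      then show ?thesis using def False True jv u pl by simp
    next
      case wj: False
      have "w \<in> tips t" using wch ch_tips by (meson in_set_butlastD subsetD)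
      then have jw: "j < w" using wj assms(7) by (metis linorder_neqE)
      define xs where "xs = takeWhile (\<lambda>x. x < j) (butlast ch)"
      have xs_ne: "xs \<noteq> []" using bne bl assms(8) by (cases "butlast ch") (auto simp: xs_def)
      obtain y ys where ys: "butlast ch = xs @ y # ys" "\<not> y < j"
      proof -
        have "dropWhile (\<lambda>x. x < j) (butlast ch) \<noteq> []" using wch wj by (auto simp: dropWhile_eq_Nil_conv)
        then obtain y ys where "dropWhile (\<lambda>x. x < j) (butlast ch) = y # ys" by (cases "dropWhile (\<lambda>x. x < j) (butlast ch)") auto
        then show ?thesis using that[of y ys] takeWhile_dropWhile_id[of "\<lambda>x. x < j" "butlast ch"]
            hd_dropWhile[of "\<lambda>x. x < j" "butlast ch"] by (simp add: xs_def)
      qed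
      have "y \<in> tips t" using ys(1) ch_tips by (metis in_set_butlastD in_set_conv_decomp subsetD)
      then have jy: "j < y" using ys(2) assms(7) by (metis linorder_neqE)
      obtain m where lx: "length xs = Suc m" using xs_ne by (cases xs) auto
      \<comment> \<open>\<open>m\<close> is the index of the last chain element below
        \<open>j\<close>; the entries in \<open>pre\<close> come from right turns above the branch
        and are below \<open>j\<close> as well.\<close>
      define d where "d = length pre + m"
      have low: "ms ! a < j" if "a \<le> d" for a
      proof -
        have "a < length (pre @ xs)" using that lx by (simp add: d_def)
        then have "ms ! a \<in> set (pre @ xs)" unfolding ms ys(1) by (metis append.assoc nth_append nth_mem)
        then show ?thesis using pre assms(8) by (auto simp: xs_def dest: set_takeWhileD)
      qed
      have high: "j < ms ! a" if "d < a" "a < length ms" for a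
      proof -
        have "length (pre @ xs) \<le> a" using that lx by (simp add: d_def)
        then have "ms ! a = (y # ys) ! (a - length (pre @ xs))" unfolding ms ys(1) by (metis append.assoc leD nth_append)
        moreover have "a - length (pre @ xs) < length (y # ys)" using that(2) \<open>length (pre @ xs) \<le> a\<close> by (simp add: ms ys(1))
        ultimately have "ms ! a \<in> set (y # ys)" by (metis nth_mem)
        moreover have "\<forall>z \<in> set (y # ys). y \<le> z" using sb unfolding ys(1) by (auto simp: sorted_wrt_append less_imp_le)
        ultimately show ?thesis using jy by fastforce
      qed
      have dl: "Suc d < length ms" using lx by (simp add: ms ys(1) d_def)
      have "(THE d. ?P d) = d"
      proof (rule the_equality)
        show "?P d" using dl low[of d] high[of "Suc d"] by simp
      next
        fix a assume a: "?P a"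
        then have "\<not> d < a" using high[of a] by auto
        moreover have "\<not> Suc a \<le> d" using low[of "Suc a"] a by auto
        ultimately show "a = d" by simp
      qed
      moreover have "ms ! d = last xs"
        unfolding ms ys(1) d_def using lx xs_ne by (simp add: nth_append last_conv_nth)
      moreover have "slot j (branch i t) = last xs" unfolding sl tw xs_def ..
      ultimately show ?thesis using def False jv u jw pl by simp
    qed
  qed
qed

section \<open>The recursion\<close>

lemma bump_less [simp]: "bump i x < bump i y \<longleftrightarrow> x < y"
  by (auto simp: bump_def)

lemma bump_le [simp]: "bump i x \<le> bump i y \<longleftrightarrow> x \<le> y"
  by (auto simp: bump_def)

lemma bump_eq [simp]: "bump i x = bump i y \<longleftrightarrow> x = y"
  by (auto simp: bump_def)

lemma inj_bump: "inj (bump i)"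
  by (simp add: inj_def)

lemma bump_image: "0 \<le> r \<Longrightarrow> r \<le> m \<Longrightarrow> bump r ` {0..m - 1} = {0..m} - {r}"
proof (intro equalityI subsetI)
  fix y assume "0 \<le> r" "y \<in> {0..m} - {r}"
  then have "y = bump r (if y < r then y else y - 1)" "(if y < r then y else y - 1) \<in> {0..m - 1}" if "r \<le> m"
    using that by (auto simp: bump_def)
  moreover assume "r \<le> m"
  ultimately show "y \<in> bump r ` {0..m - 1}" by blast
qed (auto simp: bump_def split: if_splits)

lemma tips_map [simp]: "tips (map_stree f t) = f ` tips t"
  by (induction t) auto

lemma head_map [simp]: "head (map_stree f t) = f (head t)"
  by (induction t) auto

lemma is_Tip_map [simp]: "is_Tip (map_stree f t) = is_Tip t"
  by (cases t) auto

lemma marks_map [simp]: "marks (map_stree f t) = image_mset f (marks t)"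
  by (induction t) auto

lemma shape_map: "shape (map_stree f t) = relabel f (shape t)"
  by (induction t) auto

lemma open_tips_map: "open_tips (map_stree (bump i) t) = bump i ` open_tips t"
  by (induction t) auto

lemma mark_less_map: "mark_less (map_stree (bump i) t) (bump i e) = mark_less t e"
  by (cases t) auto

lemma valid_map: "valid (map_stree (bump i) t) = valid t"
  by (induction t) (auto simp: open_tips_map mark_less_map image_Int[OF inj_bump, symmetric] inj_image_mem_iff[OF inj_bump])

lemma chain_map: "chain (map_stree (bump i) t) = map (bump i) (chain t)"
proof (induction t)
  case (Fork l e r)
  have "\<not> is_Tip l \<Longrightarrow> map (bump i) (chain l) ! 1 = bump i (chain l ! 1)"
    by (erule chain_Fork) (metis One_nat_def length_Cons lessI less_Suc_eq_0_disj nth_map Suc_less_eq zero_less_Suc)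
  then show ?case using Fork by auto
qed simp

lemma branch_map: "branch (bump i z) (map_stree (bump i) t) = map_stree (bump i) (branch z t)"
  by (induction t) (auto simp: inj_image_mem_iff[OF inj_bump])

lemma planted_map: "0 \<le> i \<Longrightarrow> relabel (bump i) (planted t) = planted (map_stree (bump i) t)"
  by (simp add: planted_def shape_map bump_def)

lemma agrees_bump: "agrees L t \<Longrightarrow> agrees (bump_labeling i L) (map_stree (bump i) t)"
proof (induction t)
  case (Fork l e r)
  have "bump i -` (bump i ` tips l \<union> bump i ` tips r) = tips l \<union> tips r"
    using inj_vimage_image_eq[OF inj_bump, of i "tips l \<union> tips r"] by (simp add: image_Un)
  then show ?case using Fork by (simp add: bump_labeling_def)
qed simp

lemma set_stree: "set_stree t = tips t \<union> set_mset (marks t)"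
  by (induction t) auto

text \<open>Labels are leaves, so \<open>i\<close> is missing among the marks too, and the gap can
  be closed.\<close>

lemma ex_unbump:
  assumes "valid t" "i \<notin> tips t" shows "\<exists>s. t = map_stree (bump i) s"
proof -
  let ?f = "\<lambda>x. if i < x then x - 1 else x"
  have "i \<notin> set_stree t" using assms marks_in_tips[OF assms(1)] by (auto simp: set_stree)
  then have "map_stree (bump i \<circ> ?f) t = map_stree id t"
    by (intro stree.map_cong) (auto simp: bump_def)
  then have "t = map_stree (bump i) (map_stree ?f t)" by (simp add: stree.map_comp stree.map_id)
  then show ?thesis by blast
qed

lemma inj_map_bump: "map_stree (bump i) s = map_stree (bump i) t \<Longrightarrow> s = t"
  using stree.inj_map[OF inj_bump] by (simp add: inj_def)

section \<open>Changing a composition and its word\<close>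

lemma maxzero_props:
  "maxzero k \<le> length k" "maxzero k = 0 \<or> k ! (maxzero k - 1) = 0"
  "\<And>z. maxzero k < z \<Longrightarrow> z \<le> length k \<Longrightarrow> k ! (z - 1) \<noteq> 0"
proof -
  let ?Z = "insert 0 {z \<in> {1..length k}. k ! (z - 1) = 0}"
  have "maxzero k \<in> ?Z" unfolding maxzero_def by (intro Max_in) auto
  then show "maxzero k \<le> length k" "maxzero k = 0 \<or> k ! (maxzero k - 1) = 0" by auto
  fix z assume z: "maxzero k < z" "z \<le> length k"
  show "k ! (z - 1) \<noteq> 0"
  proof
    assume "k ! (z - 1) = 0"
    then have "z \<in> ?Z" using z by auto
    then have "z \<le> maxzero k" unfolding maxzero_def by (intro Max_ge) auto
    then show False using z by simp
  qed
qed

lemma maxzero_eqI: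
  assumes "z \<le> length k" "z = 0 \<or> k ! (z - 1) = 0" "\<And>y. z < y \<Longrightarrow> y \<le> length k \<Longrightarrow> k ! (y - 1) \<noteq> 0"
  shows "maxzero k = z"
  unfolding maxzero_def
proof (rule Max_eqI)
  fix y assume y: "y \<in> insert 0 {z \<in> {1..length k}. k ! (z - 1) = 0}"
  show "y \<le> z"
  proof (rule ccontr)
    assume "\<not> y \<le> z"
    then show False using assms(3)[of y] y by auto
  qed
qed (use assms(1,2) in auto)

lemma count_image_mset_bump: "count (image_mset (bump i) M) (bump i x) = count M x"
  by (induction M) auto

lemma image_mset_bump_eq: "image_mset (bump i) M = image_mset (bump i) N \<longleftrightarrow> M = N"
  by (metis count_image_mset_bump multiset_eqI)

text \<open>The entries behind the deleted zero move one position to the left, which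
  \<open>bump\<close> compensates.\<close>

lemma slide_word_remove:
  assumes "1 \<le> r" "r \<le> length k" "k ! (r - 1) = 0"
  shows "image_mset (bump (int r)) (mset (slide_word (take (r - 1) k @ drop r k))) = mset (slide_word k)"
proof (rule multiset_eqI)
  fix y :: int
  let ?h = "take (r - 1) k @ drop r k"
  have len: "length ?h = length k - 1" using assms by simp
  have nth: "?h ! (a - 1) = (if a < r then k ! (a - 1) else k ! a)" if "1 \<le> a" "a < length k" for a
    using assms that by (auto simp: nth_append min_def)
  show "count (image_mset (bump (int r)) (mset (slide_word ?h))) y = count (mset (slide_word k)) y"
  proof (cases "y = int r")
    case True
    have "y \<notin># image_mset (bump (int r)) (mset (slide_word ?h))" using True by (auto simp: bump_def)
    then have "count (image_mset (bump (int r)) (mset (slide_word ?h))) y = 0" by (simp only: not_in_iff)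
    then show ?thesis using True assms by (simp add: count_slide_word)
  next
    case False
    define x where "x = (if y < int r then y else y - 1)"
    have y: "y = bump (int r) x" using False by (auto simp: x_def bump_def)
    have "count (image_mset (bump (int r)) (mset (slide_word ?h))) y = count (mset (slide_word ?h)) x"
      unfolding y by (rule count_image_mset_bump)
    also have "\<dots> = count (mset (slide_word k)) y"
    proof (cases "1 \<le> x \<and> x \<le> int (length ?h)")
      case True
      define a where "a = nat x"
      have "x \<le> int (length k - 1)" using True unfolding len by simp
      then have a: "x = int a" "1 \<le> a" "a < length k" using True assms by (auto simp: a_def)
      have "nat (int a + 1) = Suc a" by simp
      then show ?thesis using nth[of a] a unfolding count_slide_word y len
        by (auto simp: bump_def)
    next
      case F: False
      have "\<not> (1 \<le> y \<and> y \<le> int (length k))"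
        using F len assms False unfolding x_def by (auto split: if_splits)
      then show ?thesis using F by (simp only: count_slide_word if_False)
    qed
    finally show ?thesis .
  qed
qed

lemma slide_word_decrease:
  assumes "1 \<le> j" "j \<le> length k" "0 < k ! (j - 1)"
  shows "add_mset (int j) (mset (slide_word (k[j - 1 := k ! (j - 1) - 1]))) = mset (slide_word k)"
proof (rule multiset_eqI)
  fix y :: int
  show "count (add_mset (int j) (mset (slide_word (k[j - 1 := k ! (j - 1) - 1])))) y = count (mset (slide_word k)) y"
    using assms by (cases "y = int j") (auto simp: count_slide_word nth_list_update)
qed

section \<open>The bijection for a fixed composition\<close>

locale slide_recursion =
  fixes n :: nat and k :: "nat list"
  assumes n: "1 \<le> n" and comp: "composition n k"
begin

lemma length_k: "length k = n" and sum_k: "sum_list k = n"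
  using comp by (auto simp: composition_def)

definition i where "i = maxzero k"

text \<open>The position of the zero that is deleted in the passage from \<open>k\<close> to \<open>k\<^sup>(\<^sup>j\<^sup>)\<close>.\<close>

definition removed :: "nat \<Rightarrow> nat" where
  "removed j = (if k ! (j - 1) = 1 then j else i)"

text \<open>\<open>n\<close> positive entries with sum \<open>n\<close> are all equal to 1, so an
  entry above 1 requires a zero entry.\<close>

lemma i_pos:
  assumes "i < j" "j \<le> n" "1 < k ! (j - 1)" shows "1 \<le> i"
proof (rule ccontr)
  assume "\<not> 1 \<le> i"
  then have z: "k ! z \<noteq> 0" if "z < n" for z using maxzero_props(3)[of k "Suc z"] that length_k by (simp add: i_def)
  have "(\<Sum>z<n. 1) < (\<Sum>z<n. k ! z)"
  proof (rule sum_strict_mono_ex1)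
    show "\<forall>z\<in>{..<n}. 1 \<le> k ! z" using z by (auto simp: Suc_le_eq)
    show "\<exists>z\<in>{..<n}. 1 < k ! z" using assms by (intro bexI[of _ "j - 1"]) auto
  qed simp
  then show False using sum_k length_k by (simp add: sum_list_sum_nth atLeast0LessThan)
qed

lemma k_pos: "i < j \<Longrightarrow> j \<le> n \<Longrightarrow> 0 < k ! (j - 1)"
  using maxzero_props(3)[of k j] length_k by (simp add: i_def)

lemma maxzero_decreased:
  assumes "i < j" "j \<le> n"
  shows "maxzero (k[j - 1 := k ! (j - 1) - 1]) = removed j"
proof (rule maxzero_eqI)
  show "removed j \<le> length (k[j - 1 := k ! (j - 1) - 1])"
    using assms length_k maxzero_props(1)[of k] by (simp add: removed_def i_def)
  show "removed j = 0 \<or> k[j - 1 := k ! (j - 1) - 1] ! (removed j - 1) = 0"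
    using assms length_k maxzero_props(2)[of k] by (auto simp: removed_def i_def nth_list_update)
next
  fix y assume "removed j < y" "y \<le> length (k[j - 1 := k ! (j - 1) - 1])"
  then show "k[j - 1 := k ! (j - 1) - 1] ! (y - 1) \<noteq> 0"
    using assms length_k maxzero_props(3)[of k y] k_pos[OF assms]
    by (auto simp: removed_def i_def nth_list_update split: if_splits)
qed

lemma removed_bounds:
  assumes "i < j" "j \<le> n" shows "1 \<le> removed j" "removed j \<le> n"
  using assms i_pos[OF assms] k_pos[OF assms] by (auto simp: removed_def)

lemma lower_eq:
  assumes "i < j" "j \<le> n"
  shows "lower k j = take (removed j - 1) (k[j - 1 := k ! (j - 1) - 1]) @ drop (removed j) (k[j - 1 := k ! (j - 1) - 1])"
  unfolding lower_def Let_def maxzero_decreased[OF assms] ..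

lemma length_lower: "i < j \<Longrightarrow> j \<le> n \<Longrightarrow> length (lower k j) = n - 1"
  using removed_bounds[of j] length_k by (simp add: lower_eq)

lemma word_lower:
  assumes "i < j" "j \<le> n"
  shows "add_mset (int j) (image_mset (bump (int (removed j))) (mset (slide_word (lower k j)))) = mset (slide_word k)"
proof -
  let ?k = "k[j - 1 := k ! (j - 1) - 1]"
  have "?k ! (removed j - 1) = 0"
    using maxzero_props(2)[of ?k] maxzero_decreased[OF assms] removed_bounds[OF assms] by auto
  then have "image_mset (bump (int (removed j))) (mset (slide_word (lower k j))) = mset (slide_word ?k)"
    unfolding lower_eq[OF assms] using removed_bounds[OF assms] length_k by (intro slide_word_remove) auto
  then show ?thesis using slide_word_decrease[of j k] assms k_pos[OF assms] length_k by simp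
qed

lemma composition_lower:
  assumes "i < j" "j \<le> n" shows "composition (n - 1) (lower k j)"
proof -
  have "size (mset (slide_word k)) = Suc (size (mset (slide_word (lower k j))))"
    unfolding word_lower[OF assms, symmetric] by simp
  then show ?thesis using length_lower[OF assms] sum_k by (simp add: composition_def length_slide_word)
qed

text \<open>The summand \<open>j\<close> after relabelling, so that the leaf to be added,
  \<open>removed j\<close>, is free and one label \<open>j\<close> is missing.\<close>

definition reduced :: "nat \<Rightarrow> label stree set" where
  "reduced j = {t. valid t \<and> tips t = {0..int n} - {int (removed j)} \<and> add_mset (int j) (marks t) = mset (slide_word k)}"

lemma bump_reduced:
  assumes "i < j" "j \<le> n"
  shows "s \<in> slide_strees (lower k j) \<longleftrightarrow> map_stree (bump (int (removed j))) s \<in> reduced j"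
proof -
  let ?r = "int (removed j)"
  have "bump ?r ` {0..int (n - 1)} = {0..int n} - {?r}"
    using bump_image[of ?r "int n"] removed_bounds[OF assms] n by (simp add: of_nat_diff)
  moreover have "bump ?r ` tips s = bump ?r ` {0..int (n - 1)} \<longleftrightarrow> tips s = {0..int (n - 1)}"
    by (rule inj_image_eq_iff[OF inj_bump])
  moreover have "image_mset (bump ?r) (marks s) = image_mset (bump ?r) (mset (slide_word (lower k j))) \<longleftrightarrow>
      marks s = mset (slide_word (lower k j))"
    by (rule image_mset_bump_eq)
  ultimately show ?thesis
    unfolding slide_strees_def reduced_def word_lower[OF assms, symmetric]
    by (simp add: valid_map length_lower[OF assms])
qed

definition insert_j :: "nat \<Rightarrow> label stree \<Rightarrow> label stree" where
  "insert_j j t = (if 1 < k ! (j - 1) then place (int i) (int j) t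
     else sgraft (slot (int j) (branch (int i) t)) (int j) t)"

lemma Sigma_map_planted:
  assumes "i < j" "j \<le> n" "s \<in> slide_strees (lower k j)"
  shows "Sigma_map k (j, planted s) = planted (insert_j j (map_stree (bump (int (removed j))) s))"
proof -
  let ?r = "int (removed j)"
  let ?t = "map_stree (bump ?r) s"
  have red: "?t \<in> reduced j" using bump_reduced[OF assms(1,2)] assms(3) by blast
  then have t: "valid ?t" "tips ?t = {0..int n} - {?r}" by (auto simp: reduced_def)
  obtain L where L: "slide_labeling (lower k j) (planted s) = Some L" "agrees L s"
    using slide_strees_Slide(2)[OF assms(3)] by blast
  note agr = agrees_bump[OF L(2), of ?r]
  have rel: "relabel (bump ?r) (planted s) = planted ?t" by (rule planted_map) simp
  have m1: "-1 \<notin> tips ?t" unfolding t(2) by simp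
  show ?thesis
  proof (cases "1 < k ! (j - 1)")
    case True
    then have r: "removed j = i" by (simp add: removed_def)
    have "i \<noteq> j" "1 \<le> i" using assms i_pos[OF assms(1,2) True] by auto
    have jt: "int j \<in> tips ?t" "0 \<in> tips ?t" unfolding t(2) unfolding r using assms \<open>1 \<le> i\<close> by auto
    have "int i \<notin> tips ?t" unfolding t(2) unfolding r by simp
    moreover have "\<not> is_Tip ?t"
    proof
      assume "is_Tip ?t"
      then obtain x where "tips ?t = {x}" by (cases ?t) auto
      then show False using jt assms(1) by auto
    qed
    ultimately have "sigma2 (lower k j) (int i) (int j) (planted s) = planted (place (int i) (int j) ?t)"
      using sigma2_place[OF L(1) rel[unfolded r] agr[unfolded r]] t(1) jt(1) assms(1) m1 r by simp
    then show ?thesis using True by (simp add: Sigma_map_def insert_j_def i_def)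
  next
    case False
    then have k1: "k ! (j - 1) = 1" using k_pos[OF assms(1,2)] by linarith
    then have r: "removed j = j" by (simp add: removed_def)
    \<comment> \<open>The zero deleted here comes from \<open>j\<close> and lies to the right of
      \<open>i\<close>, so the chain of the smaller tree starts at the same leaf
      \<open>i\<close>.\<close>
    have mz: "maxzero (lower k j) = i"
    proof (rule maxzero_eqI)
      have lo: "lower k j = take (j - 1) k @ drop j k"
        unfolding lower_eq[OF assms(1,2)] r using assms by (simp add: take_update_cancel drop_update_cancel)
      have nth: "lower k j ! (a - 1) = (if a < j then k ! (a - 1) else k ! a)" if "1 \<le> a" "a < n" for a
        unfolding lo using that assms length_k by (auto simp: nth_append min_def)
      show "i \<le> length (lower k j)" using assms length_lower by simp
      show "i = 0 \<or> lower k j ! (i - 1) = 0"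
        using nth[of i] maxzero_props(2)[of k] assms by (cases "i = 0") (auto simp: i_def)
      fix y assume "i < y" "y \<le> length (lower k j)"
      then show "lower k j ! (y - 1) \<noteq> 0"
        using nth[of y] maxzero_props(3)[of k y] maxzero_props(3)[of k "Suc y"] length_lower[OF assms(1,2)] length_k n
        by (auto simp: i_def)
    qed
    have bi: "bump (int j) (int i) = int i" using assms(1) by (simp add: bump_def)
    have its: "int i \<in> tips s" "-1 \<notin> tips s" "valid s"
      using assms length_lower by (auto simp: slide_strees_def)
    have "last_leaf (lower k j) (planted s) = last (chain (branch (int i) s))"
      using last_leaf_planted[of s "lower k j"] its unfolding mz by simp
    moreover have "chain (branch (int i) ?t) = map (bump (int j)) (chain (branch (int i) s))"
      using branch_map[of "int j" "int i" s] unfolding r bi by (simp add: chain_map)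
    ultimately have last: "bump (int j) (last_leaf (lower k j) (planted s)) = last (chain (branch (int i) ?t))"
      by (simp add: last_map)
    have "int i \<in> tips ?t" "int j \<notin> tips ?t" unfolding t(2) unfolding r using assms(1,2) by auto
    then have "sigma1 (lower k j) (int j) (planted s) = planted (sgraft (slot (int j) (branch (int i) ?t)) (int j) ?t)"
      using sigma1_graft[OF L(1) rel[unfolded r] agr[unfolded r] last[unfolded r]] t(1) assms(1) m1 r by simp
    then show ?thesis using False by (simp add: Sigma_map_def insert_j_def)
  qed
qed

text \<open>Separates the summands: it has the value \<open>j\<close> on the image of the summand
  \<open>j\<close>.\<close>

definition last_tip :: "label stree \<Rightarrow> label" where
  "last_tip t = last (chain (branch (int i) t))"

lemma insert_j_slide:
  assumes "i < j" "j \<le> n" "t \<in> reduced j"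
  shows "insert_j j t \<in> slide_strees k" "last_tip (insert_j j t) = int j"
proof -
  have t: "valid t" "tips t = {0..int n} - {int (removed j)}" "add_mset (int j) (marks t) = mset (slide_word k)"
    using assms(3) by (auto simp: reduced_def)
  have *: "insert_j j t \<in> slide_strees k \<and> last_tip (insert_j j t) = int j"
  proof (cases "1 < k ! (j - 1)")
    case True
    then have r: "removed j = i" by (simp add: removed_def)
    have "int j \<in> tips t" "int i \<notin> tips t" "insert (int i) (tips t) = {0..int n}" unfolding t(2) unfolding r using assms by auto
    then show ?thesis using place_props[OF t(1), of "int j" "int i"] True assms(1) t(3) length_k
      by (simp add: insert_j_def slide_strees_def last_tip_def)
  next
    case False
    then have k1: "k ! (j - 1) = 1" using k_pos[OF assms(1,2)] by linarith
    then have r: "removed j = j" by (simp add: removed_def)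
    let ?b = "branch (int i) t"
    have ij: "int i \<in> tips t" "int j \<notin> tips t" "insert (int j) (tips t) = {0..int n}" "int i < int j"
      unfolding t(2) unfolding r using assms by auto
    have hb: "head ?b = int i" by (rule head_branch[OF ij(1)])
    have p: "slot (int j) ?b \<in> tips t" using slot_props(1)[of ?b "int j"] hb ij(4) tips_branch[of "int i" t] by auto
    note g = graft_branch[OF t(1) ij(2,1,4)]
    have "int j \<notin> tips ?b" using ij(2) tips_branch[of "int i" t] by auto
    then have "chain (sgraft (slot (int j) ?b) (int j) ?b) = takeWhile (\<lambda>x. x < int j) (chain ?b) @ [int j]"
      using graft_chain[of ?b "int j"] valid_branch[OF t(1)] hb ij(4) by simp
    then show ?thesis using g tips_sgraft[OF p] marks_sgraft[OF t(1) p] ij(3) False t(3) length_k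
      by (simp add: insert_j_def slide_strees_def last_tip_def)
  qed
  then show "insert_j j t \<in> slide_strees k" "last_tip (insert_j j t) = int j" by blast+
qed

lemma insert_j_inj:
  assumes "i < j" "j \<le> n" "s \<in> reduced j" "t \<in> reduced j" "insert_j j s = insert_j j t"
  shows "s = t"
proof (cases "1 < k ! (j - 1)")
  case True
  then have r: "removed j = i" by (simp add: removed_def)
  show ?thesis using place_inj[of "int i" "int j" s t] assms True by (simp add: insert_j_def reduced_def r)
next
  case False
  then have k1: "k ! (j - 1) = 1" using k_pos[OF assms(1,2)] by linarith
  then have r: "removed j = j" by (simp add: removed_def)
  show ?thesis using sgraft_inj[of _ "int j" s _ t] assms False by (simp add: insert_j_def reduced_def r)
qed

text \<open>A tip that is its own largest branch is a right branch, and then no other leaf can be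
  the label of the fork above it. Applied to \<open>i\<close>, which labels nothing, this shows that
  its chain has a second element.\<close>

lemma branch_Tip_marked:
  "valid t \<Longrightarrow> z \<in> tips t \<Longrightarrow> is_Tip (branch z t) \<Longrightarrow> \<not> is_Tip t \<Longrightarrow> z \<in># marks t" for t :: "label stree"
proof (induction t)
  case (Fork l e r)
  have v: "valid l" "valid r" "e \<in> open_tips r" using Fork.prems by auto
  have z: "head l \<noteq> z" using Fork.prems(3) by auto
  show ?case
  proof (cases "z \<in> tips l")
    case True
    then have "\<not> is_Tip l" using z by (cases l) auto
    then show ?thesis using Fork.IH(1)[OF v(1) True] Fork.prems(3) z True by simp
  next
    case False
    then have zr: "z \<in> tips r" using Fork.prems by simp
    then show ?thesis using Fork.IH(2)[OF v(2) zr] Fork.prems(3) z False v(3) by (cases r) auto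
  qed
qed simp

lemma slide_insert_j:
  assumes "t \<in> slide_strees k"
  shows "\<exists>j s. i < j \<and> j \<le> n \<and> s \<in> reduced j \<and> t = insert_j j s"
proof -
  have t: "valid t" "tips t = {0..int n}" "marks t = mset (slide_word k)"
    using assms length_k by (auto simp: slide_strees_def)
  have cnt: "count (marks t) x = (if 1 \<le> x \<and> x \<le> int n then k ! (nat x - 1) else 0)" for x
    unfolding t(3) count_slide_word length_k ..
  have iu: "int i \<notin># marks t"
    using cnt[of "int i"] maxzero_props(2)[of k] by (auto simp: not_in_iff i_def)
  have it: "int i \<in> tips t" unfolding t(2) using maxzero_props(1)[of k] length_k by (simp add: i_def)
  have nt: "\<not> is_Tip t"
  proof
    assume "is_Tip t"
    then obtain x where "tips t = {x}" by (cases t) auto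
    moreover have "0 \<in> tips t" "1 \<in> tips t" unfolding t(2) using n by auto
    ultimately show False by simp
  qed
  then have nb: "\<not> is_Tip (branch (int i) t)" using branch_Tip_marked[OF t(1) it] iu by blast
  define j where "j = nat (last_tip t)"
  have vb: "valid (branch (int i) t)" by (rule valid_branch[OF t(1)])
  have "last_tip t \<in># marks (branch (int i) t)" unfolding last_tip_def by (rule last_chain_marked[OF vb nb])
  then have gt: "int i < last_tip t" using marks_neq_head[OF vb] head_branch[OF it] by auto
  have "last_tip t \<in> tips t" unfolding last_tip_def by (rule subsetD[OF tips_branch last_chain_in_tips])
  then have jn: "last_tip t = int j" "j \<le> n" using gt unfolding t(2) j_def by auto
  then have ij: "i < j" using gt by simp
  have lj: "int j = last (chain (branch (int i) t))" using jn(1) by (simp add: last_tip_def)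
  have cj: "count (marks t) (int j) = k ! (j - 1)" using cnt[of "int j"] ij jn(2) by simp
  show ?thesis
  proof (cases "1 < k ! (j - 1)")
    case True
    then have r: "removed j = i" by (simp add: removed_def)
    \<comment> \<open>Entries beyond the last zero are positive, so for the whole tree the first
      alternative holds.\<close>
    have "y \<in># marks t \<or> y \<in> open_tips t" if "y \<in> tips t" "int i < y" for y
    proof -
      have "0 < k ! (nat y - 1)" using k_pos[of "nat y"] that unfolding t(2) by auto
      then have "count (marks t) y \<noteq> 0" using cnt[of y] that unfolding t(2) by auto
      then show ?thesis by (simp add: not_in_iff)
    qed
    moreover have "2 \<le> count (marks t) (int j) + (if int j \<in> open_tips t then 1 else 0)" using cj True by simp
    ultimately obtain s where s: "valid s" "int j \<in> tips s" "int i \<notin> tips s" "int i < int j" "t = place (int i) (int j) s"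
      using unplace[OF t(1) it nb lj iu] by blast
    note p = place_props[OF s(1,2,4,3), folded s(5)]
    then have "tips s = {0..int n} - {int i}" using s(3) t(2) by auto
    then have "s \<in> reduced j" using s(1) p t(3) by (simp add: reduced_def r)
    then show ?thesis using ij jn(2) s(5) True by (auto simp: insert_j_def)
  next
    case False
    then have k1: "k ! (j - 1) = 1" using k_pos[OF ij jn(2)] by linarith
    then have r: "removed j = j" by (simp add: removed_def)
    obtain s where s: "valid s" "int j \<notin> tips s" "int i \<in> tips s"
      "t = sgraft (slot (int j) (branch (int i) s)) (int j) s"
      using ungraft_branch[OF t(1) it nb lj] cj k1 by auto
    let ?p = "slot (int j) (branch (int i) s)"
    have p: "?p \<in> tips s" using slot_props(1)[of "branch (int i) s" "int j"] head_branch[OF s(3)] ij tips_branch[of "int i" s] by auto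
    have "tips t = insert (int j) (tips s)" "marks t = add_mset (int j) (marks s)"
      using tips_sgraft[OF p, of "int j"] marks_sgraft[OF s(1) p, of "int j"] unfolding s(4)[symmetric] by auto
    then have "s \<in> reduced j" using s(1,2) t(2,3) by (auto simp: reduced_def r)
    then show ?thesis using ij jn(2) s(4) False by (auto simp: insert_j_def)
  qed
qed

lemma bij_Sigma_map: "bij_betw (Sigma_map k) (D k) (Slide k)"
proof (rule bij_betwI')
  have Dk: "\<exists>j s. x = (j, planted s) \<and> i < j \<and> j \<le> n \<and> s \<in> slide_strees (lower k j)" if x: "x \<in> D k" for x
  proof -
    obtain j T where jT: "x = (j, T)" "i < j" "j \<le> n" "T \<in> Slide (lower k j)"
      using x length_k by (auto simp: D_def i_def)
    then show ?thesis using Slide_slide_strees[OF jT(4) composition_lower[OF jT(2,3)]] by blast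
  qed
  {
    fix x y assume "x \<in> D k" "y \<in> D k"
    then obtain j s j' s' where x: "x = (j, planted s)" "i < j" "j \<le> n" "s \<in> slide_strees (lower k j)"
      and y: "y = (j', planted s')" "i < j'" "j' \<le> n" "s' \<in> slide_strees (lower k j')"
      using Dk by metis
    let ?t = "map_stree (bump (int (removed j))) s" and ?t' = "map_stree (bump (int (removed j'))) s'"
    have t: "?t \<in> reduced j" "?t' \<in> reduced j'" using bump_reduced x y by blast+
    show "Sigma_map k x = Sigma_map k y \<longleftrightarrow> x = y"
    proof
      assume "Sigma_map k x = Sigma_map k y"
      then have "planted (insert_j j ?t) = planted (insert_j j' ?t')"
        using Sigma_map_planted[OF x(2-4)] Sigma_map_planted[OF y(2-4)] x(1) y(1) by simp
      then have eq: "insert_j j ?t = insert_j j' ?t'"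
        using planted_inj insert_j_slide(1)[OF x(2,3) t(1)] insert_j_slide(1)[OF y(2,3) t(2)] by blast
      then have "j = j'" using insert_j_slide(2)[OF x(2,3) t(1)] insert_j_slide(2)[OF y(2,3) t(2)] by simp
      then have "?t = ?t'" using insert_j_inj[OF x(2,3) t(1)] t(2) eq by simp
      then show "x = y" using inj_map_bump \<open>j = j'\<close> x(1) y(1) by blast
    qed simp
  next
    fix x assume "x \<in> D k"
    then obtain j s where x: "x = (j, planted s)" "i < j" "j \<le> n" "s \<in> slide_strees (lower k j)"
      using Dk by blast
    have "map_stree (bump (int (removed j))) s \<in> reduced j" using bump_reduced x by blast
    then show "Sigma_map k x \<in> Slide k"
      using Sigma_map_planted[OF x(2-4)] slide_strees_Slide(1) insert_j_slide(1)[OF x(2,3)] x(1) by simp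
  next
    fix T assume "T \<in> Slide k"
    then obtain t where t: "t \<in> slide_strees k" "T = planted t" using Slide_slide_strees[OF _ comp] by blast
    from slide_insert_j[OF t(1)] obtain j s where js: "i < j" "j \<le> n" "s \<in> reduced j" "t = insert_j j s" by blast
    have "valid s" "int (removed j) \<notin> tips s" using js(3) by (auto simp: reduced_def)
    then obtain u where u: "s = map_stree (bump (int (removed j))) u" using ex_unbump by blast
    then have us: "u \<in> slide_strees (lower k j)" using bump_reduced[OF js(1,2)] js(3) by simp
    have "(j, planted u) \<in> D k" using slide_strees_Slide(1)[OF us] js(1,2) length_k by (simp add: D_def i_def)
    moreover have "T = Sigma_map k (j, planted u)" using Sigma_map_planted[OF js(1,2) us] t(2) js(4) u by simp
    ultimately show "\<exists>x\<in>D k. T = Sigma_map k x" by blast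
  }
qed

end

theorem theorem1p2:
  fixes n :: nat and k :: "nat list"
  assumes "n \<ge> 1" and "composition n k"
  shows "bij_betw (Sigma_map k) (D k) (Slide k)"
proof -
  interpret slide_recursion n k using assms by unfold_locales
  show ?thesis by (rule bij_Sigma_map)
qed

end
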